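(* Let $0<T<\infty$, let $P$ be a probability distribution on the space $\mathcal{D}_T$ of positive, countable, $T$-bounded persistence diagrams, and let $\mathcal{P}_1,\mathcal{P}_2,\ldots$ be independent and identically distributed diagrams with distribution $P$. For $t\in[0,T]$ let $f_t:\mathcal{D}_T\to\mathbb{R}$, $f_t(\mathcal{P})=\mathcal{L}_{\mathcal{P}}(1,t)$, be the evaluation at $t$ of the first persistence landscape. For $n\ge 1$ define the process $$\mathbb{G}_n f_t=\sqrt{n}\left(\frac1n\sum_{i=1}^n f_t(\mathcal{P}_i)-\int f_t(\mathcal{P})\,dP(\mathcal{P})\right),\qquad t\in[0,T].$$ Let $\mathbb{G}$ be a Brownian bridge (a zero-mean Gaussian process indexed by $t\in[0,T]$) with covariance function $$\kappa(t,u)=\int f_t(\mathcal{P})f_u(\mathcal{P})\,dP(\mathcal{P})-\int f_t(\mathcal{P})\,dP(\mathcal{P})\int f_u(\mathcal{P})\,dP(\mathcal{P}).$$ Then, as $n\to\infty$, $\mathbb{G}_n$ converges in distribution to $\mathbb{G}$ in the space $\ell^\infty([0,T])$ of bounded real functions on the index set.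
   Context: Persistence diagrams. A homological feature with birth $b$ and death $d$ (with $d\le b$) is recorded as the point $(x,y)=\left(\frac{b+d}{2},\frac{b-d}{2}\right)$. $\mathcal{D}_T$ is the set of multisets $\mathcal{P}$ of such points with $0\le d\le b\le T$ for every point, with only countably many points (with multiplicity) having $y>0$; points on the line $y=0$ are included with infinite multiplicity. $\mathcal{D}_T$ carries a $\sigma$-algebra for which every map $f_t$ is measurable (for instance the Borel $\sigma$-algebra of the bottleneck distance). Landscapes. For a point $p=(x,y)$ define the triangle function $t_p:\mathbb{R}\to\mathbb{R}$ by $t_p(z)=z-x+y$ if $z\in[x-y,x]$, $t_p(z)=x+y-z$ if $z\in(x,x+y]$, and $t_p(z)=0$ otherwise. The first persistence landscape of $\mathcal{P}$ is $\mathcal{L}_{\mathcal{P}}(1,z)=\sup_{p\in\mathcal{P}}t_p(z)$. Convergence in distribution. $\ell^\infty([0,T])$ has the supremum norm, the process being indexed by $t$ through the class $\mathcal{F}=\{f_t:0\le t\le T\}$. Convergence in distribution is the usual weak convergence of empirical process theory: $\mathbb{G}$ is a tight Borel random element of this space and $\mathbb{E}^*h(\mathbb{G}_n)\to\mathbb{E}h(\mathbb{G})$ for every bounded continuous $h:\ell^\infty([0,T])\to\mathbb{R}$, where $\mathbb{E}^*$ is outer expectation. *)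

theory Defs
  imports "HOL-Analysis.Urysohn" "HOL-Probability.Probability" "HOL-Library.Extended_Nat"
begin

definition diagram_point :: "real \<Rightarrow> real \<Rightarrow> real \<times> real" where
  "diagram_point b d = ((b + d) / 2, (b - d) / 2)"

(* A multiset of points is given by its multiplicity function; the value \<infinity> stands for
   countably infinite multiplicity, so "countably many points counted with multiplicity" only
   requires the underlying set of off-diagonal points to be countable. The bound on birth and
   death applies to the diagonal points too, so these are the points (x, 0) with 0 \<le> x \<le> T. *)
definition persistence_diagrams :: "real \<Rightarrow> (real \<times> real \<Rightarrow> enat) set" where
  "persistence_diagrams T =
     {D. (\<forall>p. D p \<noteq> 0 \<longrightarrow> (\<exists>b d. 0 \<le> d \<and> d \<le> b \<and> b \<le> T \<and> p = diagram_point b d)) \<and>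
         countable {p. D p \<noteq> 0 \<and> snd p > 0} \<and>
         (\<forall>b. 0 \<le> b \<and> b \<le> T \<longrightarrow> D (diagram_point b b) = \<infinity>)}"

definition triangle :: "real \<times> real \<Rightarrow> real \<Rightarrow> real" where
  "triangle p z =
     (let x = fst p; y = snd p in
      if z \<in> {x - y..x} then z - x + y
      else if z \<in> {x<..x + y} then x + y - z
      else 0)"

definition first_landscape :: "(real \<times> real \<Rightarrow> enat) \<Rightarrow> real \<Rightarrow> real" where
  "first_landscape D z = (SUP p\<in>{p. D p \<noteq> 0}. triangle p z)"

(* The space of bounded real functions on S with the supremum metric; its elements are
   extensional, i.e. equal to undefined outside S. *)
definition linf :: "'a set \<Rightarrow> ('a \<Rightarrow> real) metric" where
  "linf S = funspace S euclidean_metric"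

definition metric_borel :: "'a metric \<Rightarrow> 'a measure" where
  "metric_borel m = sigma (mspace m) {U. openin (mtopology_of m) U}"

definition tight_random_element :: "'a metric \<Rightarrow> 'w measure \<Rightarrow> ('w \<Rightarrow> 'a) \<Rightarrow> bool" where
  "tight_random_element m N X \<longleftrightarrow>
     prob_space N \<and> X \<in> measurable N (metric_borel m) \<and>
     (\<forall>\<epsilon>>0. \<exists>K. compactin (mtopology_of m) K \<and>
        measure N {\<omega> \<in> space N. X \<omega> \<in> K} \<ge> 1 - \<epsilon>)"

(* Outer expectation of a bounded, possibly non-measurable function on a probability space.
   Majorants are real-valued and integrable: for bounded Y, extended-real majorants or majorants
   with infinite integral give the same infimum. *)
definition outer_expectation :: "'w measure \<Rightarrow> ('w \<Rightarrow> real) \<Rightarrow> real" where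
  "outer_expectation M Y =
     Inf {integral\<^sup>L M U | U. integrable M U \<and> (\<forall>\<omega>\<in>space M. Y \<omega> \<le> U \<omega>)}"

definition converges_in_distribution ::
    "'a metric \<Rightarrow> 'w measure \<Rightarrow> (nat \<Rightarrow> 'w \<Rightarrow> 'a) \<Rightarrow> 'v measure \<Rightarrow> ('v \<Rightarrow> 'a) \<Rightarrow> bool" where
  "converges_in_distribution m M X N Y \<longleftrightarrow>
     (\<forall>n. X n \<in> space M \<rightarrow> mspace m) \<and>
     tight_random_element m N Y \<and>
     (\<forall>h. continuous_map (mtopology_of m) euclideanreal h \<and> bounded (h ` mspace m) \<longrightarrow>
        (\<lambda>n. outer_expectation M (\<lambda>\<omega>. h (X n \<omega>))) \<longlonglongrightarrow> (\<integral>\<omega>. h (Y \<omega>) \<partial>N))"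

(* Constants count as (degenerate) Gaussian variables; normal_density is a density only for
   positive standard deviation. *)
definition gaussian_variable :: "'w measure \<Rightarrow> ('w \<Rightarrow> real) \<Rightarrow> bool" where
  "gaussian_variable N X \<longleftrightarrow>
     X \<in> borel_measurable N \<and>
     ((\<exists>\<mu> \<sigma>. \<sigma> > 0 \<and> distributed N lborel X (normal_density \<mu> \<sigma>)) \<or>
      (\<exists>c. AE \<omega> in N. X \<omega> = c))"

definition gaussian_process :: "'w measure \<Rightarrow> 'i set \<Rightarrow> ('w \<Rightarrow> 'i \<Rightarrow> real) \<Rightarrow> bool" where
  "gaussian_process N I X \<longleftrightarrow>
     prob_space N \<and>
     (\<forall>J a. finite J \<and> J \<subseteq> I \<longrightarrow> gaussian_variable N (\<lambda>\<omega>. \<Sum>t\<in>J. a t * X \<omega> t))"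

definition landscape_cov :: "(real \<times> real \<Rightarrow> enat) measure \<Rightarrow> real \<Rightarrow> real \<Rightarrow> real" where
  "landscape_cov P t u =
     (\<integral>D. first_landscape D t * first_landscape D u \<partial>P) -
     (\<integral>D. first_landscape D t \<partial>P) * (\<integral>D. first_landscape D u \<partial>P)"

definition brownian_bridge ::
    "real \<Rightarrow> (real \<times> real \<Rightarrow> enat) measure \<Rightarrow> 'w measure \<Rightarrow> ('w \<Rightarrow> real \<Rightarrow> real) \<Rightarrow> bool" where
  "brownian_bridge T P N G \<longleftrightarrow>
     gaussian_process N {0..T} G \<and>
     (\<forall>t\<in>{0..T}. (\<integral>\<omega>. G \<omega> t \<partial>N) = 0) \<and>
     (\<forall>t\<in>{0..T}. \<forall>u\<in>{0..T}. (\<integral>\<omega>. G \<omega> t * G \<omega> u \<partial>N) = landscape_cov P t u)"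

(* The sample of size n is D 0, ..., D (n - 1). *)
definition empirical_process ::
    "real \<Rightarrow> (real \<times> real \<Rightarrow> enat) measure \<Rightarrow> (nat \<Rightarrow> 'w \<Rightarrow> real \<times> real \<Rightarrow> enat) \<Rightarrow>
     nat \<Rightarrow> 'w \<Rightarrow> real \<Rightarrow> real" where
  "empirical_process T P D n \<omega> =
     (\<lambda>t\<in>{0..T}. sqrt (real n) *
        ((1 / real n) * (\<Sum>i<n. first_landscape (D i \<omega>) t) - (\<integral>E. first_landscape E t \<partial>P)))"

end

theory Submission
  imports Defs "HOL-Real_Asymp.Real_Asymp"
begin

text \<open>
  The first landscape of a diagram with births and deaths in \<open>[0, T]\<close> is bounded by \<open>T / 2\<close> and
  is 1-Lipschitz in its argument. The variance of \<open>f s - f t\<close> is therefore at most \<open>(s - t)\<^sup>2\<close>, so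
  both the empirical process (whose summands are uncorrelated) and every centred process with the
  limit covariance satisfy \<open>E (X s - X t)\<^sup>2 \<le> (s - t)\<^sup>2\<close>. The exponent 2 exceeds the dimension 1 of
  the index set, and this is the Kolmogorov condition: second moments give uniform control of the
  paths.

  The control is a chaining argument along the grids of mesh \<open>T / 16 ^ m\<close>. The \<open>energy\<close> of a path is a
  weighted sum of its squared increments from each grid point to its parent in the next coarser
  grid. Its expectation is at most \<open>64 * T\<^sup>2\<close> (\<open>nn_integral_energy_le\<close>), and a path of energy at
  most \<open>c\<^sup>2\<close> is within \<open>2 * c / 2 ^ m\<close> of the step function that interpolates it at level \<open>m\<close>,
  wherever it is the limit of its values at the grid points below (\<open>energy_controls_step\<close>). A Lipschitz functional of the process is thus, uniformly in the
  sample size, close to a functional of finitely many coordinates.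

  For finitely many coordinates the one-dimensional central limit theorem, applied to linear
  combinations, gives convergence of the expectations of trigonometric polynomials, and these
  approximate Lipschitz functions well enough (\<open>Cramer_Wold_Lipschitz\<close>). Bounded continuous
  functionals are increasing limits of Lipschitz ones, which is enough for convergence of
  expectations (\<open>weak_convergence_from_Lipschitz\<close>). The functionals of the empirical process are
  measurable, being limits of functionals of step functions, so outer expectations are ordinary
  expectations. All this is collected in \<open>weak_convergence_criterion\<close>.

  A tight bridge is not assumed to have continuous paths. Tightness gives it a separable support, on which countably many times determine the deviation of
  a path from its step functions; so almost all paths do have the chaining property
  (\<open>tight_mean_square_Lipschitz_continuous\<close>). That a tight bridge exists is shown by building a
  Gaussian family with the required covariance on the grid points, from independent normal
  variables by successive linear regression (\<open>gaussian_sequence\<close>), and extending its paths, which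
  have finite energy, to \<open>[0, T]\<close> by continuity (\<open>brownian_bridge_exists\<close>).
\<close>

section \<open>First landscapes are bounded and Lipschitz\<close>

lemma triangle_eq_max:
  assumes "0 \<le> snd p"
  shows "triangle p z = max 0 (snd p - \<bar>z - fst p\<bar>)"
  using assms by (auto simp: triangle_def Let_def max_def abs_if)

lemma triangle_Lipschitz:
  assumes "0 \<le> snd p"
  shows "\<bar>triangle p s - triangle p t\<bar> \<le> \<bar>s - t\<bar>"
  unfolding triangle_eq_max[OF assms] by (auto simp: max_def abs_if split: if_splits)

context
  fixes T :: real and D :: "real \<times> real \<Rightarrow> enat"
  assumes T: "0 < T" and D: "D \<in> persistence_diagrams T"
begin

lemma diagram_height:
  assumes "D p \<noteq> 0"
  shows "0 \<le> snd p" "snd p \<le> T / 2"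
proof -
  have "\<forall>p. D p \<noteq> 0 \<longrightarrow> (\<exists>b d. 0 \<le> d \<and> d \<le> b \<and> b \<le> T \<and> p = diagram_point b d)"
    using D unfolding persistence_diagrams_def by blast
  then obtain b d where "0 \<le> d" "d \<le> b" "b \<le> T" "p = diagram_point b d"
    using assms by blast
  then show "0 \<le> snd p" "snd p \<le> T / 2"
    by (auto simp: diagram_point_def)
qed

lemma diagram_nonempty: "{p. D p \<noteq> 0} \<noteq> {}"
proof -
  have "D (diagram_point 0 0) = \<infinity>"
    using D T by (auto simp: persistence_diagrams_def)
  then have "diagram_point 0 0 \<in> {p. D p \<noteq> 0}" by simp
  then show ?thesis by blast
qed

lemma triangle_bounds:
  assumes "D p \<noteq> 0"
  shows "0 \<le> triangle p z" "triangle p z \<le> T / 2"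
proof -
  note h = diagram_height[OF assms]
  show "0 \<le> triangle p z" using h by (simp add: triangle_eq_max)
  have "max 0 (snd p - \<bar>z - fst p\<bar>) \<le> snd p" using h by linarith
  then show "triangle p z \<le> T / 2" using h by (simp only: triangle_eq_max)
qed

lemma bdd_above_triangle: "bdd_above ((\<lambda>p. triangle p z) ` {p. D p \<noteq> 0})"
  using triangle_bounds by (intro bdd_aboveI2[where M="T/2"]) auto

text \<open>
  The value 0 is a lower bound because every triangle function is nonnegative, and the
  supremum ranges over a nonempty set: a diagram contains the whole diagonal.
\<close>
lemma first_landscape_bounds: "0 \<le> first_landscape D z" "first_landscape D z \<le> T / 2"
proof -
  obtain p where p: "D p \<noteq> 0" using diagram_nonempty by auto
  show "0 \<le> first_landscape D z"
    unfolding first_landscape_def using p triangle_bounds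
    by (intro cSUP_upper2[OF bdd_above_triangle, of p]) auto
  show "first_landscape D z \<le> T / 2"
    unfolding first_landscape_def using diagram_nonempty triangle_bounds
    by (intro cSUP_least) auto
qed

lemma first_landscape_Lipschitz: "\<bar>first_landscape D s - first_landscape D t\<bar> \<le> \<bar>s - t\<bar>"
proof -
  have *: "first_landscape D s \<le> first_landscape D t + \<bar>s - t\<bar>" for s t
    unfolding first_landscape_def
  proof (rule cSUP_least[OF diagram_nonempty])
    fix p assume p: "p \<in> {p. D p \<noteq> 0}"
    have "triangle p s \<le> triangle p t + \<bar>s - t\<bar>"
      using triangle_Lipschitz[of p s t] diagram_height[of p] p by auto
    also have "triangle p t \<le> (SUP p\<in>{p. D p \<noteq> 0}. triangle p t)"
      by (rule cSUP_upper[OF p bdd_above_triangle])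
    finally show "triangle p s \<le> (SUP p\<in>{p. D p \<noteq> 0}. triangle p t) + \<bar>s - t\<bar>" by simp
  qed
  from *[of s t] *[of t s] show ?thesis by linarith
qed

end


section \<open>Grids and chaining\<close>

definition grid :: "real \<Rightarrow> nat \<Rightarrow> nat \<Rightarrow> real" where
  "grid T m k = T * real k / 16 ^ m"

definition cell :: "real \<Rightarrow> nat \<Rightarrow> real \<Rightarrow> nat" where
  "cell T m t = nat \<lfloor>16 ^ m * t / T\<rfloor>"

text \<open>
  Values outside \<open>[0, T]\<close> are \<open>undefined\<close>, as for the elements of \<open>linf {0..T}\<close>.
\<close>
definition step :: "real \<Rightarrow> nat \<Rightarrow> (real \<Rightarrow> real) \<Rightarrow> real \<Rightarrow> real" where
  "step T m x = (\<lambda>t\<in>{0..T}. x (grid T m (cell T m t)))"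

text \<open>
  The point with index \<open>k\<close> at level \<open>j + 1\<close> has the parent with index \<open>k div 16\<close> at level \<open>j\<close>.
  The refinement factor 16 leaves room for the weight \<open>4 ^ j\<close>: level \<open>j\<close> has about
  \<open>16 ^ (j + 1)\<close> increments, each with second moment at most \<open>(T / 16 ^ j)\<^sup>2\<close>, so the weighted
  expectations still decay like \<open>1 / 4 ^ j\<close>.
\<close>
definition energy :: "real \<Rightarrow> (real \<Rightarrow> real) \<Rightarrow> ennreal" where
  "energy T x = (\<Sum>j. ennreal (4 ^ j *
     (\<Sum>k\<le>16 ^ Suc j. (x (grid T (Suc j) k) - x (grid T j (k div 16)))\<^sup>2)))"

lemma grid_mem: "0 < T \<Longrightarrow> k \<le> 16 ^ m \<Longrightarrow> grid T m k \<in> {0..T}"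
proof -
  assume T: "0 < T" and k: "k \<le> 16 ^ m"
  have "real k \<le> real (16 ^ m)" using k by linarith
  then show "grid T m k \<in> {0..T}" using T by (simp add: grid_def field_simps)
qed

definition grid_points :: "real \<Rightarrow> real set" where
  "grid_points T = {grid T m k | m k. k \<le> 16 ^ m}"

lemma grid_in_grid_points: "k \<le> 16 ^ m \<Longrightarrow> grid T m k \<in> grid_points T"
  by (auto simp: grid_points_def)

lemma grid_points_subset: "0 < T \<Longrightarrow> grid_points T \<subseteq> {0..T}"
  using grid_mem by (auto simp: grid_points_def)

lemma countable_grid_points: "countable (grid_points T)"
proof -
  have "grid_points T \<subseteq> range (\<lambda>(m, k). grid T m k)" by (auto simp: grid_points_def)
  then show ?thesis by (rule countable_subset) simp
qed

lemma cell_le: 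
  assumes "0 < T" "t \<in> {0..T}"
  shows "cell T m t \<le> 16 ^ m"
proof -
  have "16 ^ m * t / T \<le> 16 ^ m"
    using assms by (simp add: field_simps)
  then have "\<lfloor>16 ^ m * t / T\<rfloor> \<le> \<lfloor>(16 ^ m :: real)\<rfloor>" by (rule floor_mono)
  also have "\<dots> = int (16 ^ m)"
    using floor_of_nat[of "16 ^ m", where 'a=real] by simp
  finally show ?thesis by (simp add: cell_def)
qed

lemma cell_bounds:
  assumes "0 < T" "t \<in> {0..T}"
  shows "grid T m (cell T m t) \<le> t" "t - grid T m (cell T m t) \<le> T / 16 ^ m"
proof -
  define y where "y = 16 ^ m * t / T"
  have y: "0 \<le> y" using assms by (simp add: y_def)
  have k: "real (cell T m t) = of_int \<lfloor>y\<rfloor>" using y by (simp add: cell_def y_def)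
  have t: "t = T * y / 16 ^ m" using assms by (simp add: y_def)
  have "T * of_int \<lfloor>y\<rfloor> \<le> T * y" using assms by (intro mult_left_mono) auto
  then show "grid T m (cell T m t) \<le> t"
    unfolding grid_def k by (subst t) (simp add: divide_right_mono)
  have "T * y - T * of_int \<lfloor>y\<rfloor> = T * (y - of_int \<lfloor>y\<rfloor>)" by (simp add: algebra_simps)
  also have "\<dots> \<le> T * 1" using assms by (intro mult_left_mono; linarith)
  finally have "(T * y - T * of_int \<lfloor>y\<rfloor>) / 16 ^ m \<le> T / 16 ^ m"
    by (simp add: divide_right_mono)
  then show "t - grid T m (cell T m t) \<le> T / 16 ^ m"
    unfolding grid_def k by (subst t) (simp add: diff_divide_distrib)
qed

text \<open>
  Passing to the parent of the current cell gives the current cell one level down, so the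
  approximations of \<open>t\<close> form a chain of increments that the energy controls.
\<close>
lemma cell_Suc_div: "cell T (Suc m) t div 16 = cell T m t"
proof -
  have "\<lfloor>16 ^ m * t / T\<rfloor> = \<lfloor>(16 ^ Suc m * t / T) / real 16\<rfloor>" by simp
  also have "\<dots> = \<lfloor>16 ^ Suc m * t / T\<rfloor> div 16"
    using floor_divide_real_eq_div[of 16 "16 ^ Suc m * t / T"] by simp
  finally show ?thesis
    unfolding cell_def by (simp add: nat_div_distrib')
qed

lemma grid_parent:
  assumes "0 < T"
  shows "\<bar>grid T (Suc j) k - grid T j (k div 16)\<bar> \<le> T / 16 ^ j"
proof -
  define r where "r = k mod 16"
  have "k = 16 * (k div 16) + r" by (simp add: r_def)
  then have k: "real k = 16 * real (k div 16) + real r"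
    by (metis of_nat_add of_nat_mult of_nat_numeral)
  have "grid T (Suc j) k - grid T j (k div 16) = T * real r / (16 * 16 ^ j)"
    unfolding grid_def k by (simp add: field_simps)
  moreover have "0 \<le> T * real r / (16 * 16 ^ j)" using assms by simp
  moreover have "T * real r / (16 * 16 ^ j) \<le> T * 16 / (16 * 16 ^ j)"
    using assms by (intro divide_right_mono mult_left_mono) (auto simp: r_def)
  ultimately show ?thesis by simp
qed

lemma div_16_le: "k \<le> 16 ^ Suc j \<Longrightarrow> k div 16 \<le> (16::nat) ^ j"
  by (auto simp: div_le_mono intro: order_trans[OF div_le_mono[of k "16 ^ Suc j" 16]])

lemma cell_grid:
  assumes T: "0 < T" and "m \<le> n"
  shows "grid T n (cell T n (grid T m k)) = grid T m k"
proof -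
  have n: "(16::real) ^ n = 16 ^ (n - m) * 16 ^ m" using assms(2) by (simp flip: power_add)
  have "16 ^ n * grid T m k / T = real (16 ^ (n - m) * k)"
    using T by (simp add: grid_def n)
  then have "cell T n (grid T m k) = 16 ^ (n - m) * k"
    unfolding cell_def by (simp only: floor_of_nat nat_int)
  then show ?thesis by (simp add: grid_def n)
qed

lemma cell_tendsto:
  assumes "0 < T" "t \<in> {0..T}"
  shows "(\<lambda>m. grid T m (cell T m t)) \<longlonglongrightarrow> t"
proof (rule LIMSEQ_I)
  have lim: "(\<lambda>m. T / 16 ^ m) \<longlonglongrightarrow> 0" by real_asymp
  show "\<exists>n0. \<forall>n\<ge>n0. norm (grid T n (cell T n t) - t) < r" if r: "0 < r" for r
  proof -
    obtain n0 where "\<forall>n\<ge>n0. norm (T / 16 ^ n - 0) < r"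
      using LIMSEQ_D[OF lim r] by auto
    then have "norm (grid T n (cell T n t) - t) < r" if "n \<ge> n0" for n
      using cell_bounds[OF assms, of n] that assms(1) by (fastforce simp: abs_if)
    then show ?thesis by blast
  qed
qed

lemma step_apply: "t \<in> {0..T} \<Longrightarrow> step T m x t = x (grid T m (cell T m t))"
  by (simp add: step_def)

lemma energy_controls_increment:
  assumes "energy T x \<le> ennreal (c\<^sup>2)" "0 \<le> c" "k \<le> 16 ^ Suc j"
  shows "\<bar>x (grid T (Suc j) k) - x (grid T j (k div 16))\<bar> \<le> c / 2 ^ j"
proof -
  let ?d = "\<lambda>k. x (grid T (Suc j) k) - x (grid T j (k div 16))"
  have "(?d k)\<^sup>2 \<le> (\<Sum>k\<le>16 ^ Suc j. (?d k)\<^sup>2)"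
    using assms(3) by (intro member_le_sum) auto
  then have "4 ^ j * (?d k)\<^sup>2 \<le> 4 ^ j * (\<Sum>k\<le>16 ^ Suc j. (?d k)\<^sup>2)" by simp
  then have "ennreal (4 ^ j * (?d k)\<^sup>2) \<le> ennreal (4 ^ j * (\<Sum>k\<le>16 ^ Suc j. (?d k)\<^sup>2))"
    by (rule ennreal_leI)
  also have "\<dots> \<le> energy T x"
    unfolding energy_def using sum_le_suminf[of "\<lambda>j. ennreal (4 ^ j *
     (\<Sum>k\<le>16 ^ Suc j. (x (grid T (Suc j) k) - x (grid T j (k div 16)))\<^sup>2))" "{j}"] by simp
  also have "\<dots> \<le> ennreal (c\<^sup>2)" by fact
  finally have "4 ^ j * (?d k)\<^sup>2 \<le> c\<^sup>2" by (simp add: ennreal_le_iff)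
  moreover have "4 ^ j = ((2::real) ^ j)\<^sup>2" by (simp add: power_mult[symmetric] power2_eq_square power_mult_distrib[symmetric])
  ultimately have "(2 ^ j * \<bar>?d k\<bar>)\<^sup>2 \<le> c\<^sup>2" by (simp add: power_mult_distrib)
  then have "2 ^ j * \<bar>?d k\<bar> \<le> c" using assms(2) by (rule power2_le_imp_le)
  then show ?thesis by (simp add: field_simps)
qed

text \<open>
  The increments along the chain from level \<open>m\<close> to level \<open>n\<close> form a geometric series.
\<close>
lemma energy_controls_levels:
  assumes "0 < T" "t \<in> {0..T}" "energy T x \<le> ennreal (c\<^sup>2)" "0 \<le> c" "m \<le> n"
  shows "\<bar>x (grid T n (cell T n t)) - x (grid T m (cell T m t))\<bar> \<le> 2 * c / 2 ^ m - 2 * c / 2 ^ n"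
  using assms(5)
proof (induction n rule: dec_induct)
  case base show ?case by simp
next
  case (step n)
  have "\<bar>x (grid T (Suc n) (cell T (Suc n) t)) - x (grid T n (cell T n t))\<bar> \<le> c / 2 ^ n"
    using energy_controls_increment[OF assms(3,4) cell_le[OF assms(1,2), of "Suc n"]]
    by (simp add: cell_Suc_div)
  moreover have "2 * c / 2 ^ n = c / 2 ^ n + 2 * c / 2 ^ Suc n" by simp
  ultimately show ?case using step.IH by linarith
qed

text \<open>
  Chaining to infinity is possible at those arguments at which the path is the limit of its
  values along the grid approximations.
\<close>
lemma energy_controls_step:
  assumes "0 < T" "t \<in> {0..T}" "energy T x \<le> ennreal (c\<^sup>2)" "0 \<le> c"
    and lim: "(\<lambda>n. x (grid T n (cell T n t))) \<longlonglongrightarrow> x t"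
  shows "\<bar>x t - step T m x t\<bar> \<le> 2 * c / 2 ^ m"
proof -
  have "(\<lambda>n. \<bar>x (grid T n (cell T n t)) - x (grid T m (cell T m t))\<bar>) \<longlonglongrightarrow>
      \<bar>x t - x (grid T m (cell T m t))\<bar>"
    by (intro tendsto_intros lim)
  moreover have "\<bar>x (grid T n (cell T n t)) - x (grid T m (cell T m t))\<bar> \<le> 2 * c / 2 ^ m"
    if "n \<ge> m" for n
    using energy_controls_levels[OF assms(1-4) that] assms(4)
    by (smt (verit) divide_nonneg_pos zero_less_power)
  ultimately have "\<bar>x t - x (grid T m (cell T m t))\<bar> \<le> 2 * c / 2 ^ m"
    by (intro LIMSEQ_le_const2) auto
  then show ?thesis using assms(2) by (simp add: step_apply)
qed

lemma energy_measurable: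
  assumes X: "\<And>t. t \<in> grid_points T \<Longrightarrow> (\<lambda>\<omega>. X \<omega> t) \<in> borel_measurable N"
  shows "(\<lambda>\<omega>. energy T (X \<omega>)) \<in> borel_measurable N"
proof -
  have m: "grid T (Suc j) k \<in> grid_points T" "grid T j (k div 16) \<in> grid_points T"
    if "k \<in> {..16 ^ Suc j}" for j k
    using that div_16_le[of k j] by (blast intro: grid_in_grid_points)+
  show ?thesis
    unfolding energy_def
    by (intro borel_measurable_suminf_order measurable_compose[OF _ measurable_ennreal]
          borel_measurable_times borel_measurable_sum borel_measurable_power
          borel_measurable_diff X m) auto
qed

text \<open>
  The hypotheses concern grid points only, because the limit process is first constructed
  there and extended to other times by means of this bound.
\<close>
lemma nn_integral_energy_le:
  assumes T: "0 < T"
    and meas: "\<And>t. t \<in> grid_points T \<Longrightarrow> (\<lambda>\<omega>. X \<omega> t) \<in> borel_measurable N"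
    and incr: "\<And>s t. s \<in> grid_points T \<Longrightarrow> t \<in> grid_points T \<Longrightarrow>
        (\<integral>\<^sup>+\<omega>. ennreal ((X \<omega> s - X \<omega> t)\<^sup>2) \<partial>N) \<le> ennreal ((s - t)\<^sup>2)"
  shows "(\<integral>\<^sup>+\<omega>. energy T (X \<omega>) \<partial>N) \<le> ennreal (64 * T\<^sup>2)"
proof -
  let ?d = "\<lambda>\<omega> j k. X \<omega> (grid T (Suc j) k) - X \<omega> (grid T j (k div 16))"
  have m: "grid T (Suc j) k \<in> grid_points T" "grid T j (k div 16) \<in> grid_points T" if "k \<le> 16 ^ Suc j" for j k
    using that div_16_le[OF that] by (blast intro: grid_in_grid_points)+
  have [measurable]: "(\<lambda>\<omega>. ?d \<omega> j k) \<in> borel_measurable N" if "k \<le> 16 ^ Suc j" for j k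
    using m[OF that] by (intro borel_measurable_diff meas)
  have level: "(\<integral>\<^sup>+\<omega>. ennreal (4 ^ j * (\<Sum>k\<le>16 ^ Suc j. (?d \<omega> j k)\<^sup>2)) \<partial>N) \<le>
      ennreal (32 * T\<^sup>2 * (1 / 2) ^ j)" for j
  proof -
    have "(\<integral>\<^sup>+\<omega>. ennreal (4 ^ j * (\<Sum>k\<le>16 ^ Suc j. (?d \<omega> j k)\<^sup>2)) \<partial>N) =
        (\<integral>\<^sup>+\<omega>. (\<Sum>k\<le>16 ^ Suc j. ennreal (4 ^ j) * ennreal ((?d \<omega> j k)\<^sup>2)) \<partial>N)"
      by (simp add: ennreal_mult sum_nonneg sum_distrib_left flip: sum_ennreal)
    also have "\<dots> = (\<Sum>k\<le>16 ^ Suc j. ennreal (4 ^ j) * (\<integral>\<^sup>+\<omega>. ennreal ((?d \<omega> j k)\<^sup>2) \<partial>N))"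
      by (subst nn_integral_sum) (auto simp del: power_Suc intro!: sum.cong nn_integral_cmult)
    also have "\<dots> \<le> (\<Sum>k\<le>(16::nat) ^ Suc j. ennreal (4 ^ j) * ennreal ((T / 16 ^ j)\<^sup>2))"
    proof (intro sum_mono mult_left_mono)
      fix k :: nat assume k: "k \<in> {..16 ^ Suc j}"
      have "(\<integral>\<^sup>+\<omega>. ennreal ((?d \<omega> j k)\<^sup>2) \<partial>N) \<le> ennreal ((grid T (Suc j) k - grid T j (k div 16))\<^sup>2)"
        using m[of k j] k by (intro incr) auto
      also have "\<dots> \<le> ennreal ((T / 16 ^ j)\<^sup>2)"
        using grid_parent[OF T, of j k] by (intro ennreal_leI) (metis abs_ge_zero power2_abs power_mono)
      finally show "(\<integral>\<^sup>+\<omega>. ennreal ((?d \<omega> j k)\<^sup>2) \<partial>N) \<le> ennreal ((T / 16 ^ j)\<^sup>2)" .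
    qed auto
    \<comment> \<open>There are \<open>16 * 16 ^ j + 1 \<le> 32 * 16 ^ j\<close> terms; the ratio 1 / 4 is weakened to 1 / 2 for a simple sum.\<close>
    also have "\<dots> = ennreal (\<Sum>k\<le>(16::nat) ^ Suc j. 4 ^ j * (T / 16 ^ j)\<^sup>2)"
      by (subst sum_ennreal[symmetric]) (simp_all add: ennreal_mult)
    also have "\<dots> \<le> ennreal (32 * T\<^sup>2 * (1 / 2) ^ j)"
    proof (rule ennreal_leI)
      have "(\<Sum>k\<le>(16::nat) ^ Suc j. 4 ^ j * (T / 16 ^ j)\<^sup>2) = (16 * 16 ^ j + 1) * (4 ^ j * (T / 16 ^ j)\<^sup>2)"
        by simp
      also have "\<dots> \<le> (32 * 16 ^ j) * (4 ^ j * (T / 16 ^ j)\<^sup>2)"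
        by (intro mult_right_mono) (auto simp: intro: order_trans[OF one_le_power[of 16 j]])
      also have "\<dots> = 32 * T\<^sup>2 * (4 ^ j / 16 ^ j)"
        by (simp add: power2_eq_square field_simps)
      also have "\<dots> = 32 * T\<^sup>2 * (1 / 4) ^ j"
        by (simp flip: power_divide)
      also have "\<dots> \<le> 32 * T\<^sup>2 * (1 / 2) ^ j"
        by (intro mult_left_mono power_mono) auto
      finally show "(\<Sum>k\<le>(16::nat) ^ Suc j. 4 ^ j * (T / 16 ^ j)\<^sup>2) \<le> 32 * T\<^sup>2 * (1 / 2) ^ j" .
    qed
    finally show ?thesis .
  qed
  have "(\<integral>\<^sup>+\<omega>. energy T (X \<omega>) \<partial>N) = (\<Sum>j. \<integral>\<^sup>+\<omega>. ennreal (4 ^ j * (\<Sum>k\<le>16 ^ Suc j. (?d \<omega> j k)\<^sup>2)) \<partial>N)"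
    unfolding energy_def
    by (intro nn_integral_suminf measurable_compose[OF _ measurable_ennreal]
          borel_measurable_times borel_measurable_sum borel_measurable_power
          borel_measurable_diff meas m) auto
  also have "\<dots> \<le> (\<Sum>j. ennreal (32 * T\<^sup>2 * (1 / 2) ^ j))"
    by (intro suminf_le level) auto
  also have "\<dots> = ennreal (\<Sum>j. 32 * T\<^sup>2 * (1 / 2) ^ j)"
    by (intro suminf_ennreal2 summable_mult summable_geometric) auto
  also have "(\<Sum>j. 32 * T\<^sup>2 * (1 / 2) ^ j) = 64 * T\<^sup>2"
    by (subst suminf_mult) (auto simp: suminf_geometric)
  finally show ?thesis .
qed


section \<open>Weak convergence tested on Lipschitz functionals\<close>

lemma continuous_map_mtopology_of_iff:
  "continuous_map (mtopology_of m) euclideanreal h \<longleftrightarrow>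
   (\<forall>x\<in>mspace m. \<forall>e>0. \<exists>\<delta>>0. \<forall>y\<in>mspace m. mdist m x y < \<delta> \<longrightarrow> \<bar>h x - h y\<bar> < e)"
proof -
  have "continuous_map (mtopology_of m) (mtopology_of euclidean_metric) h \<longleftrightarrow>
   (\<forall>x\<in>mspace m. \<forall>e>0. \<exists>\<delta>>0. \<forall>y\<in>mspace m. mdist m x y < \<delta> \<longrightarrow> \<bar>h x - h y\<bar> < e)"
    unfolding mtopology_of_def
    by (subst Metric_space.metric_continuous_map)
      (auto simp add: dist_real_def Met_TC.Metric_space_axioms Ball_def imp_conjL)
  then show ?thesis by simp
qed

lemma Lipschitz_imp_continuous_map:
  assumes "\<And>x y. x \<in> mspace m \<Longrightarrow> y \<in> mspace m \<Longrightarrow> \<bar>h x - h y\<bar> \<le> k * mdist m x y"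
  shows "continuous_map (mtopology_of m) euclideanreal h"
  unfolding continuous_map_mtopology_of_iff
proof (intro ballI allI impI)
  fix x e assume x: "x \<in> mspace m" and e: "(0::real) < e"
  show "\<exists>\<delta>>0. \<forall>y\<in>mspace m. mdist m x y < \<delta> \<longrightarrow> \<bar>h x - h y\<bar> < e"
  proof (intro exI[of _ "e / (\<bar>k\<bar> + 1)"] conjI ballI impI)
    fix y assume y: "y \<in> mspace m" and d: "mdist m x y < e / (\<bar>k\<bar> + 1)"
    have nn: "0 \<le> mdist m x y" by simp
    have "\<bar>h x - h y\<bar> \<le> k * mdist m x y" by (rule assms[OF x y])
    also have "\<dots> \<le> (\<bar>k\<bar> + 1) * mdist m x y" using nn by (intro mult_right_mono) auto
    also have "\<dots> < e" using d by (simp add: field_simps)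
    finally show "\<bar>h x - h y\<bar> < e" .
  qed (use e in auto)
qed

text \<open>
  The largest \<open>k\<close>-Lipschitz function below \<open>h\<close> (Moreau, Pasch and Hausdorff).
\<close>
definition inf_convolution :: "'a metric \<Rightarrow> ('a \<Rightarrow> real) \<Rightarrow> nat \<Rightarrow> 'a \<Rightarrow> real" where
  "inf_convolution m h k x = (INF y\<in>mspace m. h y + real k * mdist m x y)"

context
  fixes m :: "'a metric" and h :: "'a \<Rightarrow> real" and B :: real
  assumes bounded: "\<And>x. x \<in> mspace m \<Longrightarrow> \<bar>h x\<bar> \<le> B"
begin

lemma inf_convolution_bdd: "bdd_below ((\<lambda>y. h y + real k * mdist m x y) ` mspace m)"
proof (rule bdd_belowI2)
  fix y assume "y \<in> mspace m"
  then have "- B \<le> h y" using bounded[of y] by linarith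
  moreover have "0 \<le> real k * mdist m x y" by simp
  ultimately show "- B \<le> h y + real k * mdist m x y" by linarith
qed

lemma inf_convolution_le:
  assumes "x \<in> mspace m"
  shows "inf_convolution m h k x \<le> h x"
  unfolding inf_convolution_def
proof (rule cINF_lower2[OF inf_convolution_bdd assms])
  have "mdist m x x = 0" using assms by simp
  then show "h x + real k * mdist m x x \<le> h x" by simp
qed

lemma inf_convolution_ge:
  assumes "x \<in> mspace m"
  shows "- B \<le> inf_convolution m h k x"
  unfolding inf_convolution_def
proof (rule cINF_greatest)
  fix y assume "y \<in> mspace m"
  then have "- B \<le> h y" using bounded[of y] by linarith
  moreover have "0 \<le> real k * mdist m x y" by simp
  ultimately show "- B \<le> h y + real k * mdist m x y" by linarith
qed (use assms in auto)

lemma inf_convolution_abs_le: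
  assumes "x \<in> mspace m"
  shows "\<bar>inf_convolution m h k x\<bar> \<le> B"
  using inf_convolution_le[OF assms, of k] inf_convolution_ge[OF assms, of k] bounded[OF assms] by linarith

lemma inf_convolution_Lipschitz:
  assumes "x \<in> mspace m" "y \<in> mspace m"
  shows "\<bar>inf_convolution m h k x - inf_convolution m h k y\<bar> \<le> real k * mdist m x y"
proof -
  have *: "inf_convolution m h k x \<le> inf_convolution m h k y + real k * mdist m x y"
    if x: "x \<in> mspace m" and y: "y \<in> mspace m" for x y
  proof -
    have "inf_convolution m h k x - real k * mdist m x y \<le> inf_convolution m h k y"
      unfolding inf_convolution_def[of _ _ _ y]
    proof (rule cINF_greatest)
      fix z assume z: "z \<in> mspace m"
      have "inf_convolution m h k x \<le> h z + real k * mdist m x z"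
        unfolding inf_convolution_def by (rule cINF_lower[OF inf_convolution_bdd z])
      moreover have "real k * mdist m x z \<le> real k * (mdist m x y + mdist m y z)"
        using mdist_triangle[OF x y z] by (intro mult_left_mono) auto
      ultimately show "inf_convolution m h k x - real k * mdist m x y \<le> h z + real k * mdist m y z"
        by (simp add: algebra_simps)
    qed (use y in auto)
    then show ?thesis by linarith
  qed
  show ?thesis
    using *[OF assms] *[OF assms(2,1)] by (simp add: mdist_commute)
qed

text \<open>
  Far from \<open>x\<close> the penalty \<open>k * mdist m x y\<close> exceeds the oscillation \<open>2 * B\<close> of \<open>h\<close>, so for
  large \<open>k\<close> only points near \<open>x\<close> compete in the infimum, and there \<open>h\<close> is close to \<open>h x\<close>.
\<close>
lemma inf_convolution_tendsto:
  assumes cont: "continuous_map (mtopology_of m) euclideanreal h" and x: "x \<in> mspace m"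
  shows "(\<lambda>k. inf_convolution m h k x) \<longlonglongrightarrow> h x"
proof (rule LIMSEQ_I)
  fix r :: real assume r: "0 < r"
  have "0 < r / 2" using r by simp
  then obtain \<delta> where \<delta>: "\<delta> > 0" "\<And>y. y \<in> mspace m \<Longrightarrow> mdist m x y < \<delta> \<Longrightarrow> \<bar>h x - h y\<bar> < r / 2"
    using cont x unfolding continuous_map_mtopology_of_iff by meson
  have B: "0 \<le> B" using bounded[OF x] by linarith
  obtain k0 :: nat where k0: "2 * B / \<delta> \<le> real k0" by (meson real_arch_simple)
  show "\<exists>k0. \<forall>k\<ge>k0. norm (inf_convolution m h k x - h x) < r"
  proof (intro exI[of _ k0] allI impI)
    fix k assume "k0 \<le> k"
    then have "2 * B / \<delta> \<le> real k" using k0 by linarith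
    then have k: "2 * B \<le> real k * \<delta>" using \<delta>(1) by (simp add: field_simps)
    have "h x - r / 2 \<le> inf_convolution m h k x"
      unfolding inf_convolution_def
    proof (rule cINF_greatest)
      fix y assume y: "y \<in> mspace m"
      show "h x - r / 2 \<le> h y + real k * mdist m x y"
      proof (cases "mdist m x y < \<delta>")
        case True
        moreover have "0 \<le> real k * mdist m x y" by simp
        ultimately show ?thesis using \<delta>(2)[OF y] by linarith
      next
        case False
        then have "real k * \<delta> \<le> real k * mdist m x y" by (intro mult_left_mono) auto
        then show ?thesis using k bounded[OF x] bounded[OF y] r by linarith
      qed
    qed (use x in auto)
    then show "norm (inf_convolution m h k x - h x) < r"
      using inf_convolution_le[OF x, of k] r by simp
  qed
qed

end

text \<open>
  The inf-convolutions of \<open>h\<close> are Lipschitz, lie below \<open>h\<close> and converge to it, so convergence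
  for them bounds the lower limit of the expectations of \<open>h\<close> from below by the expectation in
  the limit. Applied to \<open>- h\<close>, the same argument bounds the upper limit.
\<close>
lemma weak_convergence_from_Lipschitz:
  fixes X :: "nat \<Rightarrow> 'w \<Rightarrow> 'a" and Y :: "'v \<Rightarrow> 'a"
  assumes M: "prob_space M" and N: "prob_space N"
    and X: "\<And>n. X n \<in> space M \<rightarrow> mspace m" and Y: "Y \<in> space N \<rightarrow> mspace m"
    and Xm: "\<And>n h. continuous_map (mtopology_of m) euclideanreal h \<Longrightarrow> (\<lambda>\<omega>. h (X n \<omega>)) \<in> borel_measurable M"
    and Ym: "\<And>h. continuous_map (mtopology_of m) euclideanreal h \<Longrightarrow> (\<lambda>\<omega>. h (Y \<omega>)) \<in> borel_measurable N"
    and Lip: "\<And>h B k. \<lbrakk>\<And>x. x \<in> mspace m \<Longrightarrow> \<bar>h x\<bar> \<le> B;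
        \<And>x y. x \<in> mspace m \<Longrightarrow> y \<in> mspace m \<Longrightarrow> \<bar>h x - h y\<bar> \<le> k * mdist m x y; 0 \<le> k\<rbrakk>
        \<Longrightarrow> (\<lambda>n. \<integral>\<omega>. h (X n \<omega>) \<partial>M) \<longlonglongrightarrow> (\<integral>\<omega>. h (Y \<omega>) \<partial>N)"
    and cont: "continuous_map (mtopology_of m) euclideanreal h" and bdd: "\<And>x. x \<in> mspace m \<Longrightarrow> \<bar>h x\<bar> \<le> B"
  shows "(\<lambda>n. \<integral>\<omega>. h (X n \<omega>) \<partial>M) \<longlonglongrightarrow> (\<integral>\<omega>. h (Y \<omega>) \<partial>N)"
proof -
  interpret M: prob_space M by (rule M)
  interpret N: prob_space N by (rule N)
  have intX: "integrable M (\<lambda>\<omega>. g (X n \<omega>))"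
    if "continuous_map (mtopology_of m) euclideanreal g" "\<And>x. x \<in> mspace m \<Longrightarrow> \<bar>g x\<bar> \<le> C" for g n and C :: real
    using X[of n] that by (intro M.integrable_const_bound[where B=C] Xm) auto
  have lower: "\<forall>\<^sub>F n in sequentially. (\<integral>\<omega>. h (Y \<omega>) \<partial>N) - e < (\<integral>\<omega>. h (X n \<omega>) \<partial>M)"
    if cont: "continuous_map (mtopology_of m) euclideanreal h"
      and bdd: "\<And>x. x \<in> mspace m \<Longrightarrow> \<bar>h x\<bar> \<le> B" and e: "0 < e" for h and e :: real
  proof -
    note Lc = inf_convolution_Lipschitz[of m h B, OF bdd]
    note cc = Lipschitz_imp_continuous_map[OF Lc]
    have "(\<lambda>k. \<integral>\<omega>. inf_convolution m h k (Y \<omega>) \<partial>N) \<longlonglongrightarrow> (\<integral>\<omega>. h (Y \<omega>) \<partial>N)"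
    proof (rule integral_dominated_convergence[where w="\<lambda>_. B"])
      show "AE \<omega> in N. (\<lambda>k. inf_convolution m h k (Y \<omega>)) \<longlonglongrightarrow> h (Y \<omega>)"
        using Y by (intro AE_I2 inf_convolution_tendsto[of m h B] bdd cont) auto
      show "AE \<omega> in N. norm (inf_convolution m h k (Y \<omega>)) \<le> B" for k
        using Y inf_convolution_abs_le[of m h B, OF bdd] by (intro AE_I2) auto
    qed (auto intro: Ym cont cc)
    then have "\<forall>\<^sub>F k in sequentially. (\<integral>\<omega>. h (Y \<omega>) \<partial>N) - e / 2 < (\<integral>\<omega>. inf_convolution m h k (Y \<omega>) \<partial>N)"
      using e by (intro order_tendstoD) auto
    then obtain k where k: "(\<integral>\<omega>. h (Y \<omega>) \<partial>N) - e / 2 < (\<integral>\<omega>. inf_convolution m h k (Y \<omega>) \<partial>N)"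
      by (auto simp: eventually_sequentially)
    have "(\<lambda>n. \<integral>\<omega>. inf_convolution m h k (X n \<omega>) \<partial>M) \<longlonglongrightarrow> (\<integral>\<omega>. inf_convolution m h k (Y \<omega>) \<partial>N)"
      by (rule Lip[where B=B and k="real k"]) (auto intro: Lc inf_convolution_abs_le[of m h B, OF bdd])
    then have "\<forall>\<^sub>F n in sequentially. (\<integral>\<omega>. h (Y \<omega>) \<partial>N) - e < (\<integral>\<omega>. inf_convolution m h k (X n \<omega>) \<partial>M)"
      using e k by (intro order_tendstoD) auto
    then show ?thesis
    proof (rule eventually_mono)
      fix n assume *: "(\<integral>\<omega>. h (Y \<omega>) \<partial>N) - e < (\<integral>\<omega>. inf_convolution m h k (X n \<omega>) \<partial>M)"
      have "(\<integral>\<omega>. inf_convolution m h k (X n \<omega>) \<partial>M) \<le> (\<integral>\<omega>. h (X n \<omega>) \<partial>M)"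
      proof (rule integral_mono)
        show "integrable M (\<lambda>\<omega>. inf_convolution m h k (X n \<omega>))"
          by (rule intX[OF cc inf_convolution_abs_le[of m h B, OF bdd]])
        show "integrable M (\<lambda>\<omega>. h (X n \<omega>))" by (rule intX[OF cont bdd])
        show "inf_convolution m h k (X n \<omega>) \<le> h (X n \<omega>)" if "\<omega> \<in> space M" for \<omega>
          using X[of n] that by (intro inf_convolution_le[of m h B] bdd) auto
      qed
      then show "(\<integral>\<omega>. h (Y \<omega>) \<partial>N) - e < (\<integral>\<omega>. h (X n \<omega>) \<partial>M)" using * by linarith
    qed
  qed
  show ?thesis
  proof (rule order_tendstoI)
    fix a assume "a < (\<integral>\<omega>. h (Y \<omega>) \<partial>N)"
    then show "\<forall>\<^sub>F n in sequentially. a < (\<integral>\<omega>. h (X n \<omega>) \<partial>M)"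
      using lower[OF cont bdd, of "(\<integral>\<omega>. h (Y \<omega>) \<partial>N) - a"] by simp
  next
    fix a assume a: "(\<integral>\<omega>. h (Y \<omega>) \<partial>N) < a"
    have "continuous_map (mtopology_of m) euclideanreal (\<lambda>x. - h x)"
      using cont by (intro continuous_intros)
    from lower[OF this, of "a - (\<integral>\<omega>. h (Y \<omega>) \<partial>N)"] a bdd
    show "\<forall>\<^sub>F n in sequentially. (\<integral>\<omega>. h (X n \<omega>) \<partial>M) < a" by simp
  qed
qed

text \<open>
  An integrable variable is its own least majorant.
\<close>
lemma outer_expectation_eq_integral:
  assumes "integrable M Y"
  shows "outer_expectation M Y = integral\<^sup>L M Y"
  unfolding outer_expectation_def
proof (rule cInf_eq_minimum)
  show "integral\<^sup>L M Y \<in> {integral\<^sup>L M U |U. integrable M U \<and> (\<forall>\<omega>\<in>space M. Y \<omega> \<le> U \<omega>)}"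
    using assms by auto
  show "integral\<^sup>L M Y \<le> x" if "x \<in> {integral\<^sup>L M U |U. integrable M U \<and> (\<forall>\<omega>\<in>space M. Y \<omega> \<le> U \<omega>)}" for x
    using that assms by (auto intro: integral_mono)
qed

lemma mspace_linf_iff:
  "x \<in> mspace (linf S) \<longleftrightarrow> x \<in> extensional S \<and> (\<exists>B. \<forall>t\<in>S. \<bar>x t\<bar> \<le> B)"
  by (simp add: linf_def Met_TC.fspace_def bounded_real)

lemma linf_dist_le_iff:
  assumes "x \<in> mspace (linf S)" "y \<in> mspace (linf S)" "S \<noteq> {}"
  shows "mdist (linf S) x y \<le> a \<longleftrightarrow> (\<forall>t\<in>S. \<bar>x t - y t\<bar> \<le> a)"
  using funspace_mdist_le[of x S euclidean_metric y a] assms by (simp add: linf_def dist_real_def)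

lemma linf_abs_diff_le:
  assumes "x \<in> mspace (linf S)" "y \<in> mspace (linf S)" "t \<in> S"
  shows "\<bar>x t - y t\<bar> \<le> mdist (linf S) x y"
  using linf_dist_le_iff[OF assms(1,2), of "mdist (linf S) x y"] assms(3) by auto


section \<open>A Cramer-Wold device for Lipschitz functions\<close>

text \<open>
  The product topology only sees finitely many coordinates, so a condition on the coordinates
  in a finite set yields continuity on the whole product.
\<close>
lemma continuous_on_finite_coordinates:
  fixes H :: "(nat \<Rightarrow> real) \<Rightarrow> real"
  assumes I: "finite I"
    and H: "\<And>x e. 0 < e \<Longrightarrow> \<exists>\<delta>>0. \<forall>y. (\<forall>i\<in>I. \<bar>x i - y i\<bar> < \<delta>) \<longrightarrow> \<bar>H x - H y\<bar> < e"
  shows "continuous_on UNIV H"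
proof (rule continuous_at_imp_continuous_on, intro ballI)
  fix x :: "nat \<Rightarrow> real"
  have "(H \<longlongrightarrow> H x) (at x)"
  proof (rule tendstoI)
    fix e :: real assume "0 < e"
    then obtain \<delta> where \<delta>: "0 < \<delta>" "\<And>y. (\<forall>i\<in>I. \<bar>x i - y i\<bar> < \<delta>) \<Longrightarrow> \<bar>H x - H y\<bar> < e"
      using H by blast
    have "\<forall>\<^sub>F y in at x. \<bar>x i - y i\<bar> < \<delta>" for i
    proof -
      have "((\<lambda>y. y i) \<longlongrightarrow> x i) (at x)"
        using continuous_on_product_coordinates[of i]
        by (metis UNIV_I continuous_on_def)
      then have "\<forall>\<^sub>F y in at x. dist (y i) (x i) < \<delta>"
        using \<delta>(1) by (rule tendstoD)
      then show ?thesis by (simp add: dist_real_def abs_minus_commute)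
    qed
    then have "\<forall>\<^sub>F y in at x. \<forall>i\<in>I. \<bar>x i - y i\<bar> < \<delta>"
      using I by (intro eventually_ball_finite) auto
    then show "\<forall>\<^sub>F y in at x. dist (H y) (H x) < e"
      by (rule eventually_mono) (use \<delta>(2) in \<open>auto simp: dist_real_def abs_minus_commute\<close>)
  qed
  then show "isCont H x" by (simp add: isCont_def)
qed

lemma measurable_finite_coordinates:
  fixes H :: "(nat \<Rightarrow> real) \<Rightarrow> real"
  assumes I: "finite I"
    and H: "\<And>x e. 0 < e \<Longrightarrow> \<exists>\<delta>>0. \<forall>y. (\<forall>i\<in>I. \<bar>x i - y i\<bar> < \<delta>) \<longrightarrow> \<bar>H x - H y\<bar> < e"
    and V: "\<And>i. i \<in> I \<Longrightarrow> (\<lambda>\<omega>. V \<omega> i) \<in> borel_measurable M"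
  shows "(\<lambda>\<omega>. H (V \<omega>)) \<in> borel_measurable M"
proof -
  define W where "W \<omega> i = (if i \<in> I then V \<omega> i else 0)" for \<omega> i
  have "H (V \<omega>) = H (W \<omega>)" for \<omega>
  proof (rule ccontr)
    assume "H (V \<omega>) \<noteq> H (W \<omega>)"
    then have "0 < \<bar>H (V \<omega>) - H (W \<omega>)\<bar>" by simp
    from H[OF this, of "V \<omega>"] obtain \<delta> where
      "0 < \<delta>" "\<And>y. (\<forall>i\<in>I. \<bar>V \<omega> i - y i\<bar> < \<delta>) \<Longrightarrow> \<bar>H (V \<omega>) - H y\<bar> < \<bar>H (V \<omega>) - H (W \<omega>)\<bar>"
      by blast
    from this(2)[of "W \<omega>"] this(1) show False by (simp add: W_def)
  qed
  moreover have "W \<in> borel_measurable M"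
  proof (rule measurable_coordinatewise_then_product)
    show "(\<lambda>\<omega>. W \<omega> i) \<in> borel_measurable M" for i
      by (cases "i \<in> I") (simp_all add: W_def V)
  qed
  moreover have "H \<in> borel_measurable borel"
    by (intro borel_measurable_continuous_onI continuous_on_finite_coordinates[OF I H])
  ultimately show ?thesis by (simp add: measurable_compose)
qed

text \<open>
  The phase \<open>b\<close> covers sines and constants, so that the class is closed under products by a
  single addition formula.
\<close>
inductive trig_poly :: "nat set \<Rightarrow> ((nat \<Rightarrow> real) \<Rightarrow> real) \<Rightarrow> bool" for I where
  cos: "trig_poly I (\<lambda>x. c * cos ((\<Sum>i\<in>I. a i * x i) + b))"
| add: "trig_poly I f \<Longrightarrow> trig_poly I g \<Longrightarrow> trig_poly I (\<lambda>x. f x + g x)"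

lemma trig_poly_const: "trig_poly I (\<lambda>_. c)"
  using trig_poly.cos[of I c "\<lambda>_. 0" 0] by simp

lemma trig_poly_sin:
  assumes "finite I" "i \<in> I"
  shows "trig_poly I (\<lambda>x. c * sin (a * x i))"
proof -
  have "(\<Sum>j\<in>I. (if j = i then a else 0) * x j) = a * x i" for x
  proof -
    have "(\<Sum>j\<in>I. (if j = i then a else 0) * x j) = (\<Sum>j\<in>I. if j = i then a * x j else 0)"
      by (rule sum.cong) auto
    then show ?thesis using assms by simp
  qed
  then show ?thesis
    using trig_poly.cos[of I c "\<lambda>j. if j = i then a else 0" "- pi / 2"] by (simp add: cos_diff)
qed

lemma trig_poly_mult:
  assumes "trig_poly I f" "trig_poly I g"
  shows "trig_poly I (\<lambda>x. f x * g x)"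
  using assms(1)
proof induction
  case (cos c a b)
  from assms(2) show ?case
  proof induction
    case (cos c' a' b')
    define u where "u x = (\<Sum>i\<in>I. a i * x i)" for x
    define v where "v x = (\<Sum>i\<in>I. a' i * x i)" for x
    have s: "u x + v x = (\<Sum>i\<in>I. (a i + a' i) * x i)" "u x - v x = (\<Sum>i\<in>I. (a i - a' i) * x i)" for x
      by (simp_all add: u_def v_def sum.distrib sum_subtractf algebra_simps)
    have "(\<lambda>x. c * cos (u x + b) * (c' * cos (v x + b'))) =
      (\<lambda>x. c * c' / 2 * cos ((u x + v x) + (b + b')) + c * c' / 2 * cos ((u x - v x) + (b - b')))"
    proof
      fix x
      have "cos (u x + b) * cos (v x + b') =
          (cos ((u x - v x) + (b - b')) + cos ((u x + v x) + (b + b'))) / 2"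
        by (subst cos_times_cos) (simp add: algebra_simps)
      then have "c * c' * (cos (u x + b) * cos (v x + b')) =
          c * c' * ((cos ((u x - v x) + (b - b')) + cos ((u x + v x) + (b + b'))) / 2)"
        by (simp only:)
      then show "c * cos (u x + b) * (c' * cos (v x + b')) =
        c * c' / 2 * cos ((u x + v x) + (b + b')) + c * c' / 2 * cos ((u x - v x) + (b - b'))"
        by (simp only: distrib_left add_divide_distrib times_divide_eq_right times_divide_eq_left mult.assoc) (simp only: mult_ac add_ac)
    qed
    moreover have "trig_poly I (\<lambda>x. c * c' / 2 * cos ((u x + v x) + (b + b')) + c * c' / 2 * cos ((u x - v x) + (b - b')))"
      unfolding s by (intro trig_poly.intros)
    ultimately show ?case by (simp add: u_def v_def)
  next
    case (add f g)
    then show ?case using trig_poly.add by (simp add: distrib_left)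
  qed
next
  case (add f g)
  then show ?case using trig_poly.add by (simp add: distrib_right)
qed

lemma compact_box: "compact {y :: nat \<Rightarrow> real. \<forall>i. y i \<in> (if i \<in> I then {-L..L} else {0})}"
proof -
  have "compactin (product_topology (\<lambda>i. euclidean) UNIV) (PiE UNIV (\<lambda>i. if i \<in> I then {-L..L} else {0::real}))"
    by (subst compactin_PiE) auto
  moreover have "PiE UNIV (\<lambda>i. if i \<in> I then {-L..L} else {0}) = {y :: nat \<Rightarrow> real. \<forall>i. y i \<in> (if i \<in> I then {-L..L} else {0})}"
    by (auto simp: PiE_def Pi_def)
  ultimately show ?thesis
    by (simp add: euclidean_product_topology)
qed

text \<open>
  The map \<open>x \<mapsto> L * sin (x / L)\<close> is bounded by \<open>L\<close> and close to the identity for large \<open>L\<close>.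
  Composing with it turns polynomials in the coordinates into trigonometric polynomials, and
  confines their arguments to a compact box.
\<close>
definition sine_clip :: "nat set \<Rightarrow> real \<Rightarrow> (nat \<Rightarrow> real) \<Rightarrow> nat \<Rightarrow> real" where
  "sine_clip I L x i = (if i \<in> I then L * sin (x i / L) else 0)"

text \<open>
  Those functions on the box \<open>[- L, L] ^ I\<close> that become trigonometric polynomials after
  composition with the sine map form an algebra, which contains the coordinates and hence
  separates points. The theorem of Stone and Weierstrass applies.
\<close>
lemma trig_poly_approximation:
  fixes H :: "(nat \<Rightarrow> real) \<Rightarrow> real"
  assumes I: "finite I" and H: "continuous_on UNIV H" and L: "0 < L" and e: "0 < e"
  obtains g where "trig_poly I g" "\<And>x. \<bar>H (sine_clip I L x) - g x\<bar> < e"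
proof -
  let ?S = "{y :: nat \<Rightarrow> real. \<forall>i. y i \<in> (if i \<in> I then {-L..L} else {0})}"
  define R where "R = {q. continuous_on UNIV q \<and> trig_poly I (\<lambda>x. q (sine_clip I L x))}"
  \<comment> \<open>Outside \<open>I\<close> the box has a single point in each coordinate, so the coordinates in \<open>I\<close> separate its points.\<close>
  interpret function_ring_on R ?S
  proof
    show "compact ?S" by (rule compact_box)
    show "continuous_on ?S f" if "f \<in> R" for f
      using that by (auto simp: R_def intro: continuous_on_subset[OF _ subset_UNIV])
    show "(\<lambda>x. f x + g x) \<in> R" if "f \<in> R" "g \<in> R" for f g
      using that by (auto simp: R_def intro!: continuous_intros trig_poly.add)
    show "(\<lambda>x. f x * g x) \<in> R" if "f \<in> R" "g \<in> R" for f g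
      using that by (auto simp: R_def intro!: continuous_intros trig_poly_mult)
    show "(\<lambda>_. c) \<in> R" for c by (auto simp: R_def trig_poly_const)
    fix x y assume xy: "x \<in> ?S" "y \<in> ?S" "x \<noteq> y"
    then obtain i where i: "x i \<noteq> y i" by blast
    have iI: "i \<in> I"
    proof (rule ccontr)
      assume "i \<notin> I"
      moreover have "x i \<in> (if i \<in> I then {-L..L} else {0})" "y i \<in> (if i \<in> I then {-L..L} else {0})"
        using xy by blast+
      ultimately show False using i by simp
    qed
    have "(\<lambda>z. z i) \<in> R"
      using trig_poly_sin[OF I iI, of L "1 / L"] iI by (simp add: R_def sine_clip_def)
    with i show "\<exists>f\<in>R. f x \<noteq> f y" by (intro bexI[of _ "\<lambda>z. z i"])
  qed
  have "continuous_on ?S H" by (rule continuous_on_subset[OF H subset_UNIV])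
  from Stone_Weierstrass_basic[OF this e] obtain q where q: "q \<in> R" "\<forall>x\<in>?S. \<bar>H x - q x\<bar> < e" ..
  have "sine_clip I L x \<in> ?S" for x
  proof -
    have "\<bar>L * sin (x i / L)\<bar> \<le> L" for i
      using L mult_left_mono[OF abs_sin_le_one[of "x i / L"], of L] by (simp add: abs_mult)
    then have "- L \<le> L * sin (x i / L) \<and> L * sin (x i / L) \<le> L" for i by (simp add: abs_le_iff minus_le_iff)
    then show ?thesis by (simp add: sine_clip_def)
  qed
  then have "\<bar>H (sine_clip I L x) - q (sine_clip I L x)\<bar> < e" for x
    using q(2) by blast
  moreover have "trig_poly I (\<lambda>x. q (sine_clip I L x))"
    using q(1) by (simp add: R_def)
  ultimately show ?thesis by (intro that)
qed

lemma sine_clip_error: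
  fixes x L :: real
  assumes "0 < L"
  shows "\<bar>x - L * sin (x / L)\<bar> \<le> x\<^sup>2 / (2 * L)"
proof -
  have "\<bar>sin (x / L) - (\<Sum>m<2. sin_coeff m * (x / L) ^ m)\<bar> \<le> inverse (fact 2) * \<bar>x / L\<bar> ^ 2"
    by (rule Maclaurin_sin_bound)
  then have "\<bar>x / L - sin (x / L)\<bar> \<le> (x / L)\<^sup>2 / 2"
    by (simp add: sin_coeff_def numeral_2_eq_2 abs_minus_commute)
  then have "L * \<bar>x / L - sin (x / L)\<bar> \<le> L * ((x / L)\<^sup>2 / 2)"
    using assms by (intro mult_left_mono) auto
  moreover have "L * \<bar>x / L - sin (x / L)\<bar> = \<bar>L * (x / L - sin (x / L))\<bar>"
    using assms by (simp add: abs_mult)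
  moreover have "L * (x / L - sin (x / L)) = x - L * sin (x / L)"
    using assms by (simp add: algebra_simps)
  moreover have "L * ((x / L)\<^sup>2 / 2) = x\<^sup>2 / (2 * L)"
    using assms by (simp add: power2_eq_square field_simps)
  ultimately show ?thesis by simp
qed

lemma Lipschitz_finite_coordinates:
  fixes H :: "(nat \<Rightarrow> real) \<Rightarrow> real"
  assumes I: "finite I"
    and K: "0 \<le> K" and Lip: "\<And>x y. \<bar>H x - H y\<bar> \<le> K * (\<Sum>i\<in>I. \<bar>x i - y i\<bar>)"
    and e: "0 < e"
  shows "\<exists>\<delta>>0. \<forall>y. (\<forall>i\<in>I. \<bar>x i - y i\<bar> < \<delta>) \<longrightarrow> \<bar>H x - H y\<bar> < e"
proof -
  define C where "C = K * real (card I) + 1"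
  have C: "0 < C" using K by (simp add: C_def add_nonneg_pos)
  show ?thesis
  proof (intro exI[of _ "e / C"] conjI allI impI)
    fix y assume y: "\<forall>i\<in>I. \<bar>x i - y i\<bar> < e / C"
    have "(\<Sum>i\<in>I. \<bar>x i - y i\<bar>) \<le> real (card I) * (e / C)"
      using y by (intro sum_bounded_above) (auto intro: less_imp_le)
    then have "K * (\<Sum>i\<in>I. \<bar>x i - y i\<bar>) \<le> K * (real (card I) * (e / C))"
      using K by (intro mult_left_mono)
    also have "\<dots> = (C - 1) * (e / C)" by (simp add: C_def)
    also have "\<dots> < C * (e / C)" using C e by (intro mult_strict_right_mono) auto
    also have "\<dots> = e" using C by simp
    finally show "\<bar>H x - H y\<bar> < e" using Lip[of x y] by linarith
  qed (use C e in auto)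
qed

text \<open>
  Replacing \<open>x\<close> by \<open>L * sin (x / L)\<close> in each coordinate costs at most \<open>x\<^sup>2 / (2 * L)\<close>, which
  the second moment bound makes small in expectation, uniformly in \<open>n\<close>. The clipped function
  is uniformly close to a trigonometric polynomial, for which the expectations converge by
  hypothesis.
\<close>
theorem Cramer_Wold_Lipschitz:
  fixes V :: "nat \<Rightarrow> 'w \<Rightarrow> nat \<Rightarrow> real" and W :: "'v \<Rightarrow> nat \<Rightarrow> real"
  assumes M: "prob_space M" and N: "prob_space N" and I: "finite I"
    and V[measurable]: "\<And>n i. i \<in> I \<Longrightarrow> (\<lambda>\<omega>. V n \<omega> i) \<in> borel_measurable M"
    and W[measurable]: "\<And>i. i \<in> I \<Longrightarrow> (\<lambda>\<omega>. W \<omega> i) \<in> borel_measurable N"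
    and V2: "\<And>n i. i \<in> I \<Longrightarrow> integrable M (\<lambda>\<omega>. (V n \<omega> i)\<^sup>2)"
    and V2b: "\<And>n i. i \<in> I \<Longrightarrow> (\<integral>\<omega>. (V n \<omega> i)\<^sup>2 \<partial>M) \<le> C"
    and W2: "\<And>i. i \<in> I \<Longrightarrow> integrable N (\<lambda>\<omega>. (W \<omega> i)\<^sup>2)"
    and W2b: "\<And>i. i \<in> I \<Longrightarrow> (\<integral>\<omega>. (W \<omega> i)\<^sup>2 \<partial>N) \<le> C"
    and conv: "\<And>a b. (\<lambda>n. \<integral>\<omega>. cos ((\<Sum>i\<in>I. a i * V n \<omega> i) + b) \<partial>M) \<longlonglongrightarrow>
        (\<integral>\<omega>. cos ((\<Sum>i\<in>I. a i * W \<omega> i) + b) \<partial>N)"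
    and B: "\<And>x. \<bar>H x\<bar> \<le> B" and K: "0 \<le> K"
    and Lip: "\<And>x y. \<bar>H x - H y\<bar> \<le> K * (\<Sum>i\<in>I. \<bar>x i - y i\<bar>)"
  shows "(\<lambda>n. \<integral>\<omega>. H (V n \<omega>) \<partial>M) \<longlonglongrightarrow> (\<integral>\<omega>. H (W \<omega>) \<partial>N)"
proof (rule LIMSEQ_I)
  interpret M: prob_space M by (rule M)
  interpret N: prob_space N by (rule N)
  fix r :: real assume r: "0 < r"
  have loc: "\<exists>\<delta>>0. \<forall>y. (\<forall>i\<in>I. \<bar>x i - y i\<bar> < \<delta>) \<longrightarrow> \<bar>H x - H y\<bar> < e" if "0 < e" for x e
    by (rule Lipschitz_finite_coordinates[OF I K Lip that])
  have Hc: "continuous_on UNIV H" by (rule continuous_on_finite_coordinates[OF I loc])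
  have Hm: "(\<lambda>\<omega>. H (U \<omega>)) \<in> borel_measurable M'" if "\<And>i. i \<in> I \<Longrightarrow> (\<lambda>\<omega>. U \<omega> i) \<in> borel_measurable M'"
    for U and M' :: "'z measure"
    by (rule measurable_finite_coordinates[OF I loc that])
  have trig_int: "integrable M' (\<lambda>\<omega>. g (U \<omega>))"
    if "prob_space M'" and "\<And>i. i \<in> I \<Longrightarrow> (\<lambda>\<omega>. U \<omega> i) \<in> borel_measurable M'" and "trig_poly I g"
    for U g and M' :: "'z measure"
    using that(3)
  proof induction
    case (cos c a b)
    interpret prob_space M' by fact
    note [measurable] = that(2)
    have "(\<lambda>\<omega>. c * cos ((\<Sum>i\<in>I. a i * U \<omega> i) + b)) \<in> borel_measurable M'" by measurable
    moreover have "\<bar>c * cos ((\<Sum>i\<in>I. a i * U \<omega> i) + b)\<bar> \<le> \<bar>c\<bar>" for \<omega>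
      using mult_left_mono[OF abs_cos_le_one, of "\<bar>c\<bar>"] by (simp add: abs_mult)
    ultimately show ?case by (intro integrable_const_bound[where B="\<bar>c\<bar>"]) auto
  qed simp
  have trig_conv: "(\<lambda>n. \<integral>\<omega>. g (V n \<omega>) \<partial>M) \<longlonglongrightarrow> (\<integral>\<omega>. g (W \<omega>) \<partial>N)" if "trig_poly I g" for g
    using that
  proof induction
    case (cos c a b)
    show ?case by (simp add: tendsto_mult_left[OF conv])
  next
    case (add f g)
    have "integrable M (\<lambda>\<omega>. f (V n \<omega>))" "integrable M (\<lambda>\<omega>. g (V n \<omega>))" for n
      by (rule trig_int[OF M V add.hyps(1)] trig_int[OF M V add.hyps(2)], assumption)+
    moreover have "integrable N (\<lambda>\<omega>. f (W \<omega>))" "integrable N (\<lambda>\<omega>. g (W \<omega>))"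
      by (rule trig_int[OF N W add.hyps(1)] trig_int[OF N W add.hyps(2)], assumption)+
    ultimately show ?case using add.IH by (simp add: tendsto_add)
  qed
  \<comment> \<open>With this clipping level the clipping error is at most \<open>r / 4\<close>; the summand 1 keeps \<open>L\<close> positive.\<close>
  define L where "L = 2 * (K * real (card I) * \<bar>C\<bar> + 1) / r"
  have A: "0 < K * real (card I) * \<bar>C\<bar> + 1" using K by (intro add_nonneg_pos) auto
  have L: "0 < L" using r A by (simp add: L_def)
  have err: "\<bar>(\<integral>\<omega>. H (U \<omega>) \<partial>M') - (\<integral>\<omega>. H (sine_clip I L (U \<omega>)) \<partial>M')\<bar> \<le> r / 4"
    if M': "prob_space M'" and U[measurable]: "\<And>i. i \<in> I \<Longrightarrow> (\<lambda>\<omega>. U \<omega> i) \<in> borel_measurable M'"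
      and U2: "\<And>i. i \<in> I \<Longrightarrow> integrable M' (\<lambda>\<omega>. (U \<omega> i)\<^sup>2)"
      and U2b: "\<And>i. i \<in> I \<Longrightarrow> (\<integral>\<omega>. (U \<omega> i)\<^sup>2 \<partial>M') \<le> C" for U and M' :: "'z measure"
  proof -
    interpret prob_space M' by fact
    have m1: "(\<lambda>\<omega>. H (U \<omega>)) \<in> borel_measurable M'" by (rule Hm) simp
    have m2: "(\<lambda>\<omega>. H (sine_clip I L (U \<omega>))) \<in> borel_measurable M'"
      by (rule Hm) (simp add: sine_clip_def)
    have i1: "integrable M' (\<lambda>\<omega>. H (U \<omega>))" "integrable M' (\<lambda>\<omega>. H (sine_clip I L (U \<omega>)))"
      using B by (auto intro!: integrable_const_bound[where B=B] m1 m2)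
    have "\<bar>(\<integral>\<omega>. H (U \<omega>) \<partial>M') - (\<integral>\<omega>. H (sine_clip I L (U \<omega>)) \<partial>M')\<bar> =
        \<bar>\<integral>\<omega>. H (U \<omega>) - H (sine_clip I L (U \<omega>)) \<partial>M'\<bar>"
      using i1 by simp
    also have "\<dots> \<le> (\<integral>\<omega>. K * (\<Sum>i\<in>I. (U \<omega> i)\<^sup>2 / (2 * L)) \<partial>M')"
    proof (rule order_trans[OF integral_abs_bound], rule integral_mono)
      fix \<omega>
      have "\<bar>H (U \<omega>) - H (sine_clip I L (U \<omega>))\<bar> \<le> K * (\<Sum>i\<in>I. \<bar>U \<omega> i - sine_clip I L (U \<omega>) i\<bar>)"
        by (rule Lip)
      also have "\<dots> \<le> K * (\<Sum>i\<in>I. (U \<omega> i)\<^sup>2 / (2 * L))"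
        using K sine_clip_error[OF L] by (intro mult_left_mono sum_mono) (auto simp: sine_clip_def)
      finally show "\<bar>H (U \<omega>) - H (sine_clip I L (U \<omega>))\<bar> \<le> K * (\<Sum>i\<in>I. (U \<omega> i)\<^sup>2 / (2 * L))" .
    qed (use i1 U2 in auto)
    also have "\<dots> = K * (\<Sum>i\<in>I. (\<integral>\<omega>. (U \<omega> i)\<^sup>2 \<partial>M') / (2 * L))"
      using U2 by simp
    also have "\<dots> \<le> K * (\<Sum>i\<in>I. \<bar>C\<bar> / (2 * L))"
      using K L U2b by (intro mult_left_mono sum_mono divide_right_mono) (auto intro: order_trans[OF U2b])
    also have "\<dots> = (K * real (card I) * \<bar>C\<bar>) / (2 * L)" by simp
    also have "\<dots> \<le> (K * real (card I) * \<bar>C\<bar> + 1) / (2 * L)"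
      using L by (intro divide_right_mono) auto
    also have "\<dots> = r / 4"
      using A r by (simp add: L_def field_simps)
    finally show ?thesis .
  qed
  have "0 < r / 8" using r by simp
  from trig_poly_approximation[OF I Hc L this] obtain g where g: "trig_poly I g"
    "\<And>x. \<bar>H (sine_clip I L x) - g x\<bar> < r / 8" by metis
  have err': "\<bar>(\<integral>\<omega>. H (sine_clip I L (U \<omega>)) \<partial>M') - (\<integral>\<omega>. g (U \<omega>) \<partial>M')\<bar> \<le> r / 8"
    if M': "prob_space M'" and U[measurable]: "\<And>i. i \<in> I \<Longrightarrow> (\<lambda>\<omega>. U \<omega> i) \<in> borel_measurable M'"
    for U and M' :: "'z measure"
  proof -
    interpret prob_space M' by fact
    have m2: "(\<lambda>\<omega>. H (sine_clip I L (U \<omega>))) \<in> borel_measurable M'"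
      by (rule Hm) (simp add: sine_clip_def)
    have i1: "integrable M' (\<lambda>\<omega>. H (sine_clip I L (U \<omega>)))"
      using B by (auto intro!: integrable_const_bound[where B=B] m2)
    note i2 = trig_int[OF M' U g(1)]
    have "\<bar>(\<integral>\<omega>. H (sine_clip I L (U \<omega>)) \<partial>M') - (\<integral>\<omega>. g (U \<omega>) \<partial>M')\<bar> =
        \<bar>\<integral>\<omega>. H (sine_clip I L (U \<omega>)) - g (U \<omega>) \<partial>M'\<bar>" using i1 i2 by simp
    also have "\<dots> \<le> (\<integral>\<omega>. r / 8 \<partial>M')"
      using i1 i2 g(2) by (intro order_trans[OF integral_abs_bound] integral_mono) (auto intro: less_imp_le)
    also have "\<dots> = r / 8" by (simp add: prob_space)
    finally show ?thesis .
  qed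
  from LIMSEQ_D[OF trig_conv[OF g(1)] \<open>0 < r / 8\<close>] obtain n0 where
    n0: "\<forall>n\<ge>n0. norm ((\<integral>\<omega>. g (V n \<omega>) \<partial>M) - (\<integral>\<omega>. g (W \<omega>) \<partial>N)) < r / 8" ..
  show "\<exists>n0. \<forall>n\<ge>n0. norm ((\<integral>\<omega>. H (V n \<omega>) \<partial>M) - (\<integral>\<omega>. H (W \<omega>) \<partial>N)) < r"
  proof (intro exI[of _ n0] allI impI)
    fix n assume "n0 \<le> n"
    then have "\<bar>(\<integral>\<omega>. g (V n \<omega>) \<partial>M) - (\<integral>\<omega>. g (W \<omega>) \<partial>N)\<bar> < r / 8"
      using n0 by simp
    moreover note err[of M "V n", OF M V V2 V2b] err[of N W, OF N W W2 W2b]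
      err'[of M "V n", OF M V] err'[of N W, OF N W]
    ultimately have "\<bar>(\<integral>\<omega>. H (V n \<omega>) \<partial>M) - (\<integral>\<omega>. H (W \<omega>) \<partial>N)\<bar> < r" by linarith
    then show "norm ((\<integral>\<omega>. H (V n \<omega>) \<partial>M) - (\<integral>\<omega>. H (W \<omega>) \<partial>N)) < r" by simp
  qed
qed


section \<open>Centred Gaussian variables, the one-dimensional limit theorem and samples\<close>

text \<open>
  Describing the law as an image of the standard normal law, and not by a density, includes
  the case \<open>v = 0\<close>, where it is the point mass at 0.
\<close>
definition centred_gaussian :: "'w measure \<Rightarrow> real \<Rightarrow> ('w \<Rightarrow> real) \<Rightarrow> bool" where
  "centred_gaussian N v X \<longleftrightarrow> X \<in> borel_measurable N \<and> 0 \<le> v \<and>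
     distr N borel X = distr std_normal_distribution borel (\<lambda>z. sqrt v * z)"

lemma std_normal_prob_space: "prob_space std_normal_distribution"
  by (rule prob_space_normal_density) simp

text \<open>
  The real part of the characteristic function, turned by the phase \<open>b\<close>.
\<close>
lemma std_normal_cos: "(\<integral>z. cos (s * z + b) \<partial>std_normal_distribution) = exp (- s\<^sup>2 / 2) * cos b"
proof -
  interpret prob_space std_normal_distribution by (rule std_normal_prob_space)
  have int: "integrable std_normal_distribution (\<lambda>z. iexp (s * z))"
    by (rule integrable_const_bound[where B=1]) auto
  have "(\<integral>z. cos (s * z + b) \<partial>std_normal_distribution) =
      (\<integral>z. Re (iexp b * iexp (s * z)) \<partial>std_normal_distribution)"
  proof (rule Bochner_Integration.integral_cong[OF refl])
    fix z
    have "iexp b * iexp (s * z) = iexp (s * z + b)" by (simp add: exp_add[symmetric] algebra_simps)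
    then show "cos (s * z + b) = Re (iexp b * iexp (s * z))"
      by (simp only: cis_conv_exp[symmetric] cis.sel)
  qed
  also have "\<dots> = Re (CLINT z|std_normal_distribution. iexp b * iexp (s * z))"
    using int by (subst integral_Re) auto
  also have "(CLINT z|std_normal_distribution. iexp b * iexp (s * z)) =
      iexp b * char std_normal_distribution s"
    using int by (simp add: char_def)
  also have "Re (iexp b * char std_normal_distribution s) = exp (- s\<^sup>2 / 2) * cos b"
    unfolding cis_conv_exp[symmetric] by (simp add: char_std_normal_distribution)
  finally show ?thesis .
qed

lemma std_normal_moments:
  "integrable std_normal_distribution (\<lambda>z. z)" "(\<integral>z. z \<partial>std_normal_distribution) = 0"
  "integrable std_normal_distribution (\<lambda>z. z\<^sup>2)" "(\<integral>z. z\<^sup>2 \<partial>std_normal_distribution) = 1"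
  using integrable_std_normal_distribution_moment[of 1] integral_std_normal_distribution_moment_odd[of 1]
    std_normal_distribution_even_moments[of 1] by (simp_all add: fact_numeral)

lemma centred_gaussianD:
  assumes "centred_gaussian N v X"
  shows "integrable N X" "(\<integral>\<omega>. X \<omega> \<partial>N) = 0" "integrable N (\<lambda>\<omega>. (X \<omega>)\<^sup>2)" "(\<integral>\<omega>. (X \<omega>)\<^sup>2 \<partial>N) = v"
    "(\<integral>\<omega>. cos (X \<omega> + b) \<partial>N) = exp (- v / 2) * cos b"
proof -
  note [measurable] = assms[unfolded centred_gaussian_def, THEN conjunct1]
  have v: "0 \<le> v" and eq: "distr N borel X = distr std_normal_distribution borel (\<lambda>z. sqrt v * z)"
    using assms by (auto simp: centred_gaussian_def)
  have int: "integrable N (\<lambda>\<omega>. f (X \<omega>)) \<longleftrightarrow> integrable std_normal_distribution (\<lambda>z. f (sqrt v * z))"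
    "(\<integral>\<omega>. f (X \<omega>) \<partial>N) = (\<integral>z. f (sqrt v * z) \<partial>std_normal_distribution)"
    if [measurable]: "f \<in> borel_measurable borel" for f :: "real \<Rightarrow> real"
  proof -
    have "integrable N (\<lambda>\<omega>. f (X \<omega>)) \<longleftrightarrow> integrable (distr N borel X) f"
      by (simp add: integrable_distr_eq)
    also have "\<dots> \<longleftrightarrow> integrable std_normal_distribution (\<lambda>z. f (sqrt v * z))"
      unfolding eq by (simp add: integrable_distr_eq)
    finally show "integrable N (\<lambda>\<omega>. f (X \<omega>)) \<longleftrightarrow> integrable std_normal_distribution (\<lambda>z. f (sqrt v * z))" .
    have "(\<integral>\<omega>. f (X \<omega>) \<partial>N) = integral\<^sup>L (distr N borel X) f"
      by (simp add: integral_distr)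
    also have "\<dots> = (\<integral>z. f (sqrt v * z) \<partial>std_normal_distribution)"
      unfolding eq by (simp add: integral_distr)
    finally show "(\<integral>\<omega>. f (X \<omega>) \<partial>N) = (\<integral>z. f (sqrt v * z) \<partial>std_normal_distribution)" .
  qed
  note m = std_normal_moments
  have "integrable std_normal_distribution (\<lambda>z. sqrt v * z)"
    by (rule integrable_mult_right) (rule m(1))
  then show "integrable N X" using int(1)[of "\<lambda>x. x"] by simp
  have "(\<integral>\<omega>. X \<omega> \<partial>N) = (\<integral>z. sqrt v * z \<partial>std_normal_distribution)"
    using int(2)[of "\<lambda>x. x"] by simp
  also have "\<dots> = sqrt v * (\<integral>z. z \<partial>std_normal_distribution)"
    by (rule integral_mult_right_zero)
  finally show "(\<integral>\<omega>. X \<omega> \<partial>N) = 0" unfolding m(2) by simp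
  have sq: "(sqrt v * z)\<^sup>2 = v * z\<^sup>2" for z using v by (simp add: power_mult_distrib)
  have "integrable std_normal_distribution (\<lambda>z. v * z\<^sup>2)"
    by (rule integrable_mult_right) (rule m(3))
  then show "integrable N (\<lambda>\<omega>. (X \<omega>)\<^sup>2)"
    by (subst int(1)[of "\<lambda>x. x\<^sup>2"]) (simp, simp only: sq)
  have "(\<integral>\<omega>. (X \<omega>)\<^sup>2 \<partial>N) = (\<integral>z. v * z\<^sup>2 \<partial>std_normal_distribution)"
    by (subst int(2)[of "\<lambda>x. x\<^sup>2"]) (simp, simp only: sq)
  also have "\<dots> = v * (\<integral>z. z\<^sup>2 \<partial>std_normal_distribution)"
    by (rule integral_mult_right_zero)
  finally show "(\<integral>\<omega>. (X \<omega>)\<^sup>2 \<partial>N) = v" unfolding m(4) by simp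
  show "(\<integral>\<omega>. cos (X \<omega> + b) \<partial>N) = exp (- v / 2) * cos b"
    using int(2)[of "\<lambda>x. cos (x + b)"] v by (simp add: std_normal_cos)
qed

lemma centred_gaussian_density:
  assumes "0 < v"
  shows "distr std_normal_distribution borel (\<lambda>z. sqrt v * z) = density lborel (normal_density 0 (sqrt v))"
proof -
  interpret prob_space std_normal_distribution by (rule std_normal_prob_space)
  have "distr std_normal_distribution lborel (\<lambda>x. x) = std_normal_distribution"
    by (intro distr_id2) simp
  then have "distributed std_normal_distribution lborel (\<lambda>x. x) (normal_density 0 1)"
    by (simp add: distributed_def)
  from normal_density_affine[OF this, of "sqrt v" 0] assms
  have "distributed std_normal_distribution lborel (\<lambda>x. sqrt v * x) (normal_density 0 (sqrt v))"
    by simp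
  then have "distr std_normal_distribution lborel (\<lambda>x. sqrt v * x) = density lborel (normal_density 0 (sqrt v))"
    by (simp add: distributed_def)
  moreover have "distr std_normal_distribution lborel (\<lambda>x. sqrt v * x) = distr std_normal_distribution borel (\<lambda>x. sqrt v * x)"
    by (rule distr_cong) auto
  ultimately show ?thesis by simp
qed

lemma centred_gaussian_imp_gaussian_variable:
  assumes N: "prob_space N" and X: "centred_gaussian N v X"
  shows "gaussian_variable N X"
proof (cases "v = 0")
  case True
  interpret prob_space N by fact
  have "(\<integral>\<omega>. (X \<omega>)\<^sup>2 \<partial>N) = 0" using centred_gaussianD(4)[OF X] True by simp
  then have "AE \<omega> in N. (X \<omega>)\<^sup>2 = 0"
    by (subst (asm) integral_nonneg_eq_0_iff_AE) (auto simp: centred_gaussianD(3)[OF X])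
  then have "AE \<omega> in N. X \<omega> = 0" by simp
  then show ?thesis using X by (auto simp: gaussian_variable_def centred_gaussian_def)
next
  case False
  then have v: "0 < v" using X by (simp add: centred_gaussian_def)
  have [measurable]: "X \<in> borel_measurable N" using X by (simp add: centred_gaussian_def)
  have "distr N lborel X = distr N borel X" by (rule distr_cong) auto
  also have "\<dots> = density lborel (normal_density 0 (sqrt v))"
    using X v centred_gaussian_density by (simp add: centred_gaussian_def)
  finally have "distributed N lborel X (normal_density 0 (sqrt v))"
    by (simp add: distributed_def)
  moreover have "0 < sqrt v" using v by simp
  ultimately have "\<exists>\<mu> \<sigma>. \<sigma> > 0 \<and> distributed N lborel X (normal_density \<mu> \<sigma>)" by blast
  then show ?thesis by (simp add: gaussian_variable_def)
qed

lemma gaussian_variable_square_integrable: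
  assumes N: "prob_space N" and X: "gaussian_variable N X"
  shows "integrable N (\<lambda>\<omega>. (X \<omega>)\<^sup>2)"
proof -
  interpret prob_space N by fact
  have [measurable]: "X \<in> borel_measurable N" using X by (simp add: gaussian_variable_def)
  from X consider \<mu> \<sigma> where "\<sigma> > 0" "distributed N lborel X (normal_density \<mu> \<sigma>)"
    | c where "AE \<omega> in N. X \<omega> = c" by (auto simp: gaussian_variable_def)
  then show ?thesis
  proof cases
    case 1
    have "integrable N (\<lambda>\<omega>. (X \<omega> - \<mu>)\<^sup>2)"
      using integrable_normal_moment[OF 1(1), of \<mu> 2] distributed_integrable[OF 1(2), of "\<lambda>x. (x - \<mu>)\<^sup>2"]
      by simp
    moreover have "integrable N X"
      using distributed_integrable_var[OF 1(2)] integrable_normal_moment_nz_1[OF 1(1)] by simp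
    ultimately have "integrable N (\<lambda>\<omega>. (X \<omega> - \<mu>)\<^sup>2 + 2 * \<mu> * X \<omega> - \<mu>\<^sup>2)" by simp
    then show ?thesis by (simp add: power2_eq_square algebra_simps)
  next
    case 2
    then have "AE \<omega> in N. (X \<omega>)\<^sup>2 = c\<^sup>2" by auto
    then show ?thesis by (subst integrable_cong_AE[where g="\<lambda>_. c\<^sup>2"]) auto
  qed
qed

lemma gaussian_variable_imp_centred_gaussian:
  assumes N: "prob_space N" and X: "gaussian_variable N X"
    and mean: "(\<integral>\<omega>. X \<omega> \<partial>N) = 0" and v: "(\<integral>\<omega>. (X \<omega>)\<^sup>2 \<partial>N) = v"
  shows "centred_gaussian N v X"
proof -
  interpret prob_space N by fact
  have [measurable]: "X \<in> borel_measurable N" using X by (simp add: gaussian_variable_def)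
  from X consider \<mu> \<sigma> where "\<sigma> > 0" "distributed N lborel X (normal_density \<mu> \<sigma>)"
    | c where "AE \<omega> in N. X \<omega> = c" by (auto simp: gaussian_variable_def)
  then show ?thesis
  proof cases
    case 1
    have \<mu>: "\<mu> = 0" using normal_distributed_expectation[OF 1] mean by simp
    have "v = \<sigma>\<^sup>2" using normal_distributed_variance[OF 1] mean v by simp
    then have \<sigma>: "\<sigma> = sqrt v" "0 < v" using 1(1) by simp_all
    have "distr N borel X = distr N lborel X" by (rule distr_cong) auto
    also have "\<dots> = density lborel (normal_density 0 (sqrt v))"
      using 1(2) by (simp add: distributed_def \<mu> \<sigma>(1))
    finally show ?thesis using centred_gaussian_density[OF \<sigma>(2)] \<sigma>(2) by (simp add: centred_gaussian_def)
  next
    case 2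
    have "(\<integral>\<omega>. X \<omega> \<partial>N) = (\<integral>\<omega>. c \<partial>N)" using 2 by (intro integral_cong_AE) auto
    then have c: "c = 0" using mean by (simp add: prob_space)
    then have "AE \<omega> in N. (X \<omega>)\<^sup>2 = 0" using 2 by simp
    then have "(\<integral>\<omega>. (X \<omega>)\<^sup>2 \<partial>N) = (\<integral>\<omega>. 0 \<partial>N)" by (intro integral_cong_AE) auto
    then have v0: "v = 0" using v by simp
    interpret S: prob_space std_normal_distribution by (rule std_normal_prob_space)
    have "distr N borel X = distr N borel (\<lambda>_. 0)" using 2 c by (intro distr_cong_AE) auto
    also have "\<dots> = return borel 0" by (rule distr_const) simp
    also have "\<dots> = distr std_normal_distribution borel (\<lambda>_. 0)" by (rule S.distr_const[symmetric]) simp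
    finally show ?thesis by (simp add: centred_gaussian_def v0)
  qed
qed

lemma char_centred_gaussian:
  assumes "centred_gaussian N v X"
  shows "char (distr N borel X) u = complex_of_real (exp (- (v * u\<^sup>2) / 2))"
proof -
  have "char (distr N borel X) u = char std_normal_distribution (u * sqrt v)"
    using assms by (simp add: centred_gaussian_def char_def integral_distr mult.assoc)
  also have "\<dots> = complex_of_real (exp (- (v * u\<^sup>2) / 2))"
    using assms by (simp add: centred_gaussian_def char_std_normal_distribution power_mult_distrib mult.commute)
  finally show ?thesis .
qed

lemma centred_gaussian_if_char:
  assumes N: "prob_space N" and X[measurable]: "X \<in> borel_measurable N" and v: "0 \<le> v"
    and char: "\<And>u. char (distr N borel X) u = complex_of_real (exp (- (v * u\<^sup>2) / 2))"
  shows "centred_gaussian N v X"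
proof -
  interpret prob_space N by fact
  interpret S: prob_space std_normal_distribution by (rule std_normal_prob_space)
  have "distr N borel X = distr std_normal_distribution borel (\<lambda>z. sqrt v * z)"
  proof (rule Levy_uniqueness)
    show "real_distribution (distr N borel X)" by (rule real_distribution_distr) simp
    show "real_distribution (distr std_normal_distribution borel (\<lambda>z. sqrt v * z))"
      by (rule S.real_distribution_distr) simp
    have "char (distr std_normal_distribution borel (\<lambda>z. sqrt v * z)) u = complex_of_real (exp (- (v * u\<^sup>2) / 2))" for u
      using char_centred_gaussian[of std_normal_distribution v "\<lambda>z. sqrt v * z" u] v by (simp add: centred_gaussian_def)
    then show "char (distr N borel X) = char (distr std_normal_distribution borel (\<lambda>z. sqrt v * z))"
      using char by auto
  qed
  then show ?thesis using v by (simp add: centred_gaussian_def)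
qed

text \<open>
  Characteristic functions pass to the limit by dominated convergence and identify the limit
  law, and with it the moments of the limit.
\<close>
lemma centred_gaussian_limit:
  assumes N: "prob_space N" and Xn: "\<And>n. centred_gaussian N (v n) (X n)"
    and X[measurable]: "Y \<in> borel_measurable N"
    and lim: "AE \<omega> in N. (\<lambda>n. X n \<omega>) \<longlonglongrightarrow> Y \<omega>" and v: "v \<longlonglongrightarrow> w"
  shows "centred_gaussian N w Y"
proof (rule centred_gaussian_if_char[OF N X])
  interpret prob_space N by fact
  have [measurable]: "X n \<in> borel_measurable N" for n using Xn[of n] by (simp add: centred_gaussian_def)
  show "0 \<le> w" using Xn by (intro LIMSEQ_le_const[OF v]) (auto simp: centred_gaussian_def)
  fix u
  have "(\<lambda>n. CLINT \<omega>|N. iexp (u * X n \<omega>)) \<longlonglongrightarrow> (CLINT \<omega>|N. iexp (u * Y \<omega>))"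
  proof (rule integral_dominated_convergence[where w="\<lambda>_. 1"])
    show "AE \<omega> in N. (\<lambda>n. iexp (u * X n \<omega>)) \<longlonglongrightarrow> iexp (u * Y \<omega>)"
      using lim by eventually_elim (intro tendsto_intros)
  qed auto
  then have "(\<lambda>n. char (distr N borel (X n)) u) \<longlonglongrightarrow> char (distr N borel Y) u"
    by (simp add: char_def integral_distr)
  moreover have "(\<lambda>n. char (distr N borel (X n)) u) \<longlonglongrightarrow> complex_of_real (exp (- (w * u\<^sup>2) / 2))"
    unfolding char_centred_gaussian[OF Xn] by (intro tendsto_intros v) simp
  ultimately show "char (distr N borel Y) u = complex_of_real (exp (- (w * u\<^sup>2) / 2))"
    by (rule LIMSEQ_unique)
qed

text \<open>
  The degenerate case has to be treated apart because the central limit theorem normalises by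
  the standard deviation.
\<close>
lemma (in prob_space) central_limit_cos:
  fixes Y :: "nat \<Rightarrow> 'a \<Rightarrow> real"
  assumes indep: "indep_vars (\<lambda>i. borel) Y UNIV" and mean: "\<And>i. expectation (Y i) = 0"
    and sq: "\<And>i. integrable M (\<lambda>\<omega>. (Y i \<omega>)\<^sup>2)" and v: "\<And>i. expectation (\<lambda>\<omega>. (Y i \<omega>)\<^sup>2) = v"
    and same: "\<And>i. distr M borel (Y i) = \<mu>"
  shows "(\<lambda>n. \<integral>\<omega>. cos ((\<Sum>i<n. Y i \<omega>) / sqrt (real n) + b) \<partial>M) \<longlonglongrightarrow> exp (- v / 2) * cos b"
proof (cases "v = 0")
  case True
  have [measurable]: "Y i \<in> borel_measurable M" for i
    using indep by (simp add: indep_vars_def)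
  have "AE \<omega> in M. Y i \<omega> = 0" for i
  proof -
    have "AE \<omega> in M. (Y i \<omega>)\<^sup>2 = 0"
      using v[of i] True integral_nonneg_eq_0_iff_AE[OF sq[of i]] by simp
    then show ?thesis by simp
  qed
  then have 0: "AE \<omega> in M. \<forall>i. Y i \<omega> = 0" by (subst AE_all_countable) simp
  have "(\<integral>\<omega>. cos ((\<Sum>i<n. Y i \<omega>) / sqrt (real n) + b) \<partial>M) = (\<integral>\<omega>. cos b \<partial>M)" for n
    using 0 by (intro integral_cong_AE) auto
  then show ?thesis using True by (simp add: prob_space)
next
  case False
  have [measurable]: "Y i \<in> borel_measurable M" for i
    using indep by (simp add: indep_vars_def)
  have "0 \<le> expectation (\<lambda>\<omega>. (Y 0 \<omega>)\<^sup>2)" by simp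
  then have v0: "0 < v" using False v[of 0] by simp
  let ?S = "\<lambda>n \<omega>. (\<Sum>i<n. Y i \<omega>) / sqrt (real n * (sqrt v)\<^sup>2)"
  have "weak_conv_m (\<lambda>n. distr M borel (?S n)) std_normal_distribution"
    using v0 v mean by (intro central_limit_theorem_zero_mean[OF indep mean _ sq _ same]) auto
  then have "(\<lambda>n. \<integral>x. cos (sqrt v * x + b) \<partial>distr M borel (?S n)) \<longlonglongrightarrow>
      (\<integral>x. cos (sqrt v * x + b) \<partial>std_normal_distribution)"
    using real_dist_normal_dist
    by (intro weak_conv_imp_integral_bdd_continuous_conv[where B=1] real_distribution_distr) auto
  moreover have "(\<integral>x. cos (sqrt v * x + b) \<partial>distr M borel (?S n)) =
      (\<integral>\<omega>. cos ((\<Sum>i<n. Y i \<omega>) / sqrt (real n) + b) \<partial>M)" for n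
    using v0 by (simp add: integral_distr real_sqrt_mult)
  ultimately show ?thesis using v0 by (simp add: std_normal_cos)
qed

locale iid_sample =
  fixes M :: "'w measure" and P :: "'a measure" and D :: "nat \<Rightarrow> 'w \<Rightarrow> 'a"
  assumes prob_M: "prob_space M" and prob_P: "prob_space P"
    and indep: "prob_space.indep_vars M (\<lambda>_. P) D UNIV"
    and law: "\<And>i. distr M P (D i) = P"
begin

sublocale M: prob_space M by (rule prob_M)
sublocale P: prob_space P by (rule prob_P)

lemma D_measurable[measurable]: "D i \<in> measurable M P"
  using indep by (simp add: M.indep_vars_def)

text \<open>
  The empirical process evaluated at the function \<open>g\<close>.
\<close>
definition fluctuation :: "nat \<Rightarrow> ('a \<Rightarrow> real) \<Rightarrow> 'w \<Rightarrow> real" where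
  "fluctuation n g \<omega> = sqrt (real n) * (1 / real n * (\<Sum>i<n. g (D i \<omega>)) - (\<integral>E. g E \<partial>P))"

definition population_variance :: "('a \<Rightarrow> real) \<Rightarrow> real" where
  "population_variance g = (\<integral>E. (g E)\<^sup>2 \<partial>P) - (\<integral>E. g E \<partial>P)\<^sup>2"

lemma integral_D:
  assumes [measurable]: "f \<in> borel_measurable P"
  shows "(\<integral>\<omega>. f (D i \<omega>) \<partial>M) = (\<integral>E. f E \<partial>P :: real)"
proof -
  have "(\<integral>E. f E \<partial>P) = (\<integral>E. f E \<partial>distr M P (D i))" by (simp add: law)
  also have "\<dots> = (\<integral>\<omega>. f (D i \<omega>) \<partial>M)" by (simp add: integral_distr)
  finally show ?thesis by simp
qed

lemma population_variance_le: "population_variance g \<le> (\<integral>E. (g E)\<^sup>2 \<partial>P)" by (simp add: population_variance_def)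

definition centred_value :: "('a \<Rightarrow> real) \<Rightarrow> nat \<Rightarrow> 'w \<Rightarrow> real" where
  "centred_value g i \<omega> = g (D i \<omega>) - (\<integral>E. g E \<partial>P)"

lemma fluctuation_eq: "fluctuation n g \<omega> = (\<Sum>i<n. centred_value g i \<omega>) / sqrt (real n)"
proof (cases "n = 0")
  case False
  then have n: "real n > 0" by simp
  have "sqrt (real n) / real n = 1 / sqrt (real n)"
    using n by (simp add: field_simps)
  moreover have "fluctuation n g \<omega> = sqrt (real n) / real n * ((\<Sum>i<n. g (D i \<omega>)) - real n * (\<integral>E. g E \<partial>P))"
    using n by (simp add: fluctuation_def field_simps)
  moreover have "(\<Sum>i<n. centred_value g i \<omega>) = (\<Sum>i<n. g (D i \<omega>)) - real n * (\<integral>E. g E \<partial>P)"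
    by (simp add: centred_value_def sum_subtractf)
  ultimately show ?thesis by simp
qed (simp add: fluctuation_def)

context
  fixes g :: "'a \<Rightarrow> real" and B :: real
  assumes g[measurable]: "g \<in> borel_measurable P" and B: "\<And>E. E \<in> space P \<Longrightarrow> \<bar>g E\<bar> \<le> B"
begin

lemma bounded_integrable: "integrable P g" "integrable P (\<lambda>E. (g E)\<^sup>2)"
proof -
  show "integrable P g" by (rule P.integrable_const_bound[where B=B]) (auto intro: AE_I2 B)
  show "integrable P (\<lambda>E. (g E)\<^sup>2)"
  proof (rule P.integrable_const_bound[where B="B\<^sup>2"], rule AE_I2)
    fix E assume "E \<in> space P"
    then show "norm ((g E)\<^sup>2) \<le> B\<^sup>2" using power_mono[OF B abs_ge_zero, of E 2] by simp
  qed simp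
qed

lemma population_variance_eq: "population_variance g = (\<integral>E. (g E - (\<integral>E. g E \<partial>P))\<^sup>2 \<partial>P)"
proof -
  define c where "c = (\<integral>E. g E \<partial>P)"
  have "(\<integral>E. (g E - c)\<^sup>2 \<partial>P) = (\<integral>E. (g E)\<^sup>2 - 2 * c * g E + c\<^sup>2 \<partial>P)"
    by (intro Bochner_Integration.integral_cong) (auto simp: power2_eq_square algebra_simps)
  also have "\<dots> = (\<integral>E. (g E)\<^sup>2 \<partial>P) - 2 * c * c + c\<^sup>2"
    using bounded_integrable by (simp add: P.prob_space c_def)
  also have "\<dots> = population_variance g" by (simp add: population_variance_def c_def power2_eq_square)
  finally show ?thesis by (simp add: c_def)
qed

lemma population_variance_nonneg: "0 \<le> population_variance g" unfolding population_variance_eq by simp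

lemma centred_measurable[measurable]: "centred_value g i \<in> borel_measurable M"
  unfolding centred_value_def[abs_def] by measurable

lemma centred_bounded: "\<omega> \<in> space M \<Longrightarrow> \<bar>centred_value g i \<omega>\<bar> \<le> B + \<bar>\<integral>E. g E \<partial>P\<bar>"
  using B[of "D i \<omega>"] measurable_space[OF D_measurable, of \<omega> i] unfolding centred_value_def by linarith

lemma centred_integrable: "integrable M (centred_value g i)" "integrable M (\<lambda>\<omega>. centred_value g i \<omega> * centred_value g j \<omega>)"
proof -
  let ?C = "B + \<bar>\<integral>E. g E \<partial>P\<bar>"
  show "integrable M (centred_value g i)"
    by (rule M.integrable_const_bound[where B="?C"]) (auto intro!: AE_I2 centred_bounded)
  show "integrable M (\<lambda>\<omega>. centred_value g i \<omega> * centred_value g j \<omega>)"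
  proof (rule M.integrable_const_bound[where B="?C * ?C"], rule AE_I2)
    fix \<omega> assume \<omega>: "\<omega> \<in> space M"
    have "\<bar>centred_value g i \<omega>\<bar> * \<bar>centred_value g j \<omega>\<bar> \<le> ?C * ?C"
      using centred_bounded[OF \<omega>, of i] centred_bounded[OF \<omega>, of j] by (intro mult_mono) auto
    then show "norm (centred_value g i \<omega> * centred_value g j \<omega>) \<le> ?C * ?C" by (simp add: abs_mult)
  qed simp
qed

lemma indep_centred: "M.indep_vars (\<lambda>_. borel) (centred_value g) UNIV"
proof -
  have "M.indep_vars (\<lambda>_. borel) (\<lambda>i \<omega>. (\<lambda>E. g E - (\<integral>E. g E \<partial>P)) (D i \<omega>)) UNIV"
    by (rule M.indep_vars_compose2[OF indep]) simp
  then show ?thesis by (simp add: centred_value_def[abs_def])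
qed

lemma centred_mean: "(\<integral>\<omega>. centred_value g i \<omega> \<partial>M) = 0"
  unfolding centred_value_def using bounded_integrable
  by (subst integral_D[where f="\<lambda>E. g E - (\<integral>E. g E \<partial>P)"]) (auto simp: P.prob_space)

lemma centred_square: "(\<integral>\<omega>. (centred_value g i \<omega>)\<^sup>2 \<partial>M) = population_variance g"
  unfolding centred_value_def population_variance_eq
  by (subst integral_D[where f="\<lambda>E. (g E - (\<integral>E. g E \<partial>P))\<^sup>2"]) auto

lemma centred_uncorrelated:
  assumes "i \<noteq> j"
  shows "(\<integral>\<omega>. centred_value g i \<omega> * centred_value g j \<omega> \<partial>M) = 0"
proof -
  have "M.indep_vars (\<lambda>_. borel) (centred_value g) {i, j}" by (rule M.indep_vars_subset[OF indep_centred]) simp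
  then have "(\<integral>\<omega>. (\<Prod>k\<in>{i, j}. centred_value g k \<omega>) \<partial>M) = (\<Prod>k\<in>{i, j}. \<integral>\<omega>. centred_value g k \<omega> \<partial>M)"
    by (intro M.indep_vars_lebesgue_integral) (auto simp: centred_integrable)
  then show ?thesis using assms by (simp add: centred_mean)
qed

text \<open>
  A crude bound that grows with \<open>n\<close>; it serves to show that for fixed \<open>n\<close> the paths are
  bounded and Lipschitz.
\<close>
lemma fluctuation_abs_le:
  assumes "\<omega> \<in> space M"
  shows "\<bar>fluctuation n g \<omega>\<bar> \<le> real n * (2 * B)"
proof (cases "n = 0")
  case False
  have "\<bar>\<integral>E. g E \<partial>P\<bar> \<le> (\<integral>E. \<bar>g E\<bar> \<partial>P)" by (rule integral_abs_bound)
  also have "\<dots> \<le> (\<integral>E. B \<partial>P)" using bounded_integrable B by (intro integral_mono) auto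
  finally have "\<bar>\<integral>E. g E \<partial>P\<bar> \<le> B" by (simp add: P.prob_space)
  then have c: "\<bar>centred_value g i \<omega>\<bar> \<le> 2 * B" for i using centred_bounded[OF assms, of i] by linarith
  have "\<bar>\<Sum>i<n. centred_value g i \<omega>\<bar> \<le> (\<Sum>i<n. \<bar>centred_value g i \<omega>\<bar>)" by (rule sum_abs)
  also have "\<dots> \<le> real n * (2 * B)" using sum_bounded_above[of "{..<n}" "\<lambda>i. \<bar>centred_value g i \<omega>\<bar>" "2 * B"] c by simp
  finally have s: "\<bar>\<Sum>i<n. centred_value g i \<omega>\<bar> \<le> real n * (2 * B)" .
  have "1 \<le> sqrt (real n)" using False by simp
  then have "\<bar>fluctuation n g \<omega>\<bar> \<le> \<bar>\<Sum>i<n. centred_value g i \<omega>\<bar>"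
    unfolding fluctuation_eq by (simp add: divide_le_eq mult_le_cancel_left1)
  then show ?thesis using s by linarith
qed (simp add: fluctuation_def)

lemma fluctuation_measurable[measurable]: "fluctuation n g \<in> borel_measurable M"
  unfolding fluctuation_eq[abs_def] by measurable

text \<open>
  Distinct summands are uncorrelated, so only the diagonal of the double sum survives.
\<close>
lemma fluctuation_second_moment:
  shows "integrable M (\<lambda>\<omega>. (fluctuation n g \<omega>)\<^sup>2)" "(\<integral>\<omega>. (fluctuation n g \<omega>)\<^sup>2 \<partial>M) \<le> population_variance g"
proof -
  have eq: "(fluctuation n g \<omega>)\<^sup>2 = (\<Sum>i<n. \<Sum>j<n. centred_value g i \<omega> * centred_value g j \<omega>) / real n" for \<omega>
    unfolding fluctuation_eq by (simp add: power_divide power2_eq_square sum_product)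
  show "integrable M (\<lambda>\<omega>. (fluctuation n g \<omega>)\<^sup>2)"
    unfolding eq by (intro integrable_divide Bochner_Integration.integrable_sum centred_integrable)
  have "(\<integral>\<omega>. (fluctuation n g \<omega>)\<^sup>2 \<partial>M) = (\<Sum>i<n. \<Sum>j<n. (\<integral>\<omega>. centred_value g i \<omega> * centred_value g j \<omega> \<partial>M)) / real n"
    unfolding eq by (simp add: Bochner_Integration.integral_sum centred_integrable)
  also have "(\<Sum>i<n. \<Sum>j<n. (\<integral>\<omega>. centred_value g i \<omega> * centred_value g j \<omega> \<partial>M)) = (\<Sum>i<n. \<Sum>j<n. if i = j then population_variance g else 0)"
    using centred_square by (intro sum.cong) (auto simp: centred_uncorrelated power2_eq_square)
  also have "\<dots> = real n * population_variance g" by simp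
  also have "real n * population_variance g / real n \<le> population_variance g" using population_variance_nonneg by (cases "n = 0") auto
  finally show "(\<integral>\<omega>. (fluctuation n g \<omega>)\<^sup>2 \<partial>M) \<le> population_variance g" .
qed

lemma fluctuation_cos:
  "(\<lambda>n. \<integral>\<omega>. cos (fluctuation n g \<omega> + b) \<partial>M) \<longlonglongrightarrow> exp (- population_variance g / 2) * cos b"
  unfolding fluctuation_eq
proof (rule M.central_limit_cos[OF indep_centred centred_mean _ centred_square])
  show "integrable M (\<lambda>\<omega>. (centred_value g i \<omega>)\<^sup>2)" for i
    using centred_integrable(2)[of i i] by (simp add: power2_eq_square)
  show "distr M borel (centred_value g i) = distr P borel (\<lambda>E. g E - (\<integral>E. g E \<partial>P))" for i
  proof -
    have "distr P borel (\<lambda>E. g E - (\<integral>E. g E \<partial>P)) = distr (distr M P (D i)) borel (\<lambda>E. g E - (\<integral>E. g E \<partial>P))"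
      by (simp add: law)
    also have "\<dots> = distr M borel ((\<lambda>E. g E - (\<integral>E. g E \<partial>P)) \<circ> D i)" by (rule distr_distr) simp_all
    also have "\<dots> = distr M borel (centred_value g i)" by (simp add: comp_def centred_value_def[abs_def])
    finally show ?thesis by simp
  qed
qed

end

lemma fluctuation_sum:
  assumes "\<And>k. k \<in> J \<Longrightarrow> integrable P (g k)"
  shows "(\<Sum>k\<in>J. a k * fluctuation n (g k) \<omega>) = fluctuation n (\<lambda>E. \<Sum>k\<in>J. a k * g k E) \<omega>"
proof -
  have "(\<integral>E. (\<Sum>k\<in>J. a k * g k E) \<partial>P) = (\<Sum>k\<in>J. a k * (\<integral>E. g k E \<partial>P))"
    using assms by (subst Bochner_Integration.integral_sum) auto
  moreover have "(\<Sum>i<n. \<Sum>k\<in>J. a k * g k (D i \<omega>)) = (\<Sum>k\<in>J. a k * (\<Sum>i<n. g k (D i \<omega>)))"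
    by (subst sum.swap) (simp add: sum_distrib_left)
  ultimately show ?thesis
    by (simp add: fluctuation_def sum_distrib_left sum_subtractf algebra_simps)
qed

lemma population_variance_sum:
  assumes g: "\<And>k. k \<in> J \<Longrightarrow> integrable P (g k)"
    and gg: "\<And>k l. k \<in> J \<Longrightarrow> l \<in> J \<Longrightarrow> integrable P (\<lambda>E. g k E * g l E)"
  shows "population_variance (\<lambda>E. \<Sum>k\<in>J. a k * g k E) = (\<Sum>k\<in>J. \<Sum>l\<in>J. a k * a l *
    ((\<integral>E. g k E * g l E \<partial>P) - (\<integral>E. g k E \<partial>P) * (\<integral>E. g l E \<partial>P)))"
proof -
  have eq: "(\<Sum>k\<in>J. a k * x k)\<^sup>2 = (\<Sum>k\<in>J. \<Sum>l\<in>J. a k * a l * (x k * x l))" for x :: "_ \<Rightarrow> real"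
    unfolding power2_eq_square sum_product by (intro sum.cong refl) (simp add: mult_ac)
  have "(\<integral>E. (\<Sum>k\<in>J. a k * g k E)\<^sup>2 \<partial>P) = (\<Sum>k\<in>J. \<Sum>l\<in>J. a k * a l * (\<integral>E. g k E * g l E \<partial>P))"
    unfolding eq using gg by (simp add: Bochner_Integration.integral_sum)
  moreover have "(\<integral>E. (\<Sum>k\<in>J. a k * g k E) \<partial>P) = (\<Sum>k\<in>J. a k * (\<integral>E. g k E \<partial>P))"
    using g by (simp add: Bochner_Integration.integral_sum)
  ultimately show ?thesis
    unfolding population_variance_def by (simp add: eq right_diff_distrib sum_subtractf)
qed

end


section \<open>Mean-square Lipschitz processes\<close>

text \<open>
  The properties common to the empirical processes and to their limit on which the comparison
  of the two rests.
\<close>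
definition mean_square_Lipschitz :: "real \<Rightarrow> real \<Rightarrow> 'w measure \<Rightarrow> ('w \<Rightarrow> real \<Rightarrow> real) \<Rightarrow> bool" where
  "mean_square_Lipschitz T C N X \<longleftrightarrow> prob_space N \<and>
     (\<forall>t\<in>{0..T}. (\<lambda>\<omega>. X \<omega> t) \<in> borel_measurable N \<and> integrable N (\<lambda>\<omega>. (X \<omega> t)\<^sup>2) \<and>
        (\<integral>\<omega>. (X \<omega> t)\<^sup>2 \<partial>N) \<le> C) \<and>
     (\<forall>s\<in>{0..T}. \<forall>t\<in>{0..T}. (\<integral>\<omega>. (X \<omega> s - X \<omega> t)\<^sup>2 \<partial>N) \<le> (s - t)\<^sup>2)"

lemma grid_values_in_linf:
  fixes y :: "nat \<Rightarrow> real"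
  assumes T: "0 < T"
  shows "(\<lambda>t\<in>{0..T}. y (cell T m t)) \<in> mspace (linf {0..T})"
proof -
  have "\<bar>y (cell T m t)\<bar> \<le> (\<Sum>k\<le>16 ^ m. \<bar>y k\<bar>)" if "t \<in> {0..T}" for t
    by (rule member_le_sum[of "cell T m t" _ "\<lambda>k. \<bar>y k\<bar>"]) (use cell_le[OF T that] in auto)
  then have "\<exists>B. \<forall>t\<in>{0..T}. \<bar>(\<lambda>t\<in>{0..T}. y (cell T m t)) t\<bar> \<le> B"
    by (auto intro!: exI[of _ "\<Sum>k\<le>16 ^ m. \<bar>y k\<bar>"])
  then show ?thesis by (simp only: mspace_linf_iff) simp
qed

lemma step_in_linf: "0 < T \<Longrightarrow> step T m x \<in> mspace (linf {0..T})"
  unfolding step_def by (rule grid_values_in_linf)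

lemma step_functional_local:
  assumes T: "0 < T" and h: "continuous_map (mtopology_of (linf {0..T})) euclideanreal h" and e: "0 < e"
  shows "\<exists>\<delta>>0. \<forall>y. (\<forall>k\<in>{..16 ^ m}. \<bar>x k - y k\<bar> < \<delta>) \<longrightarrow>
    \<bar>h (\<lambda>t\<in>{0..T}. x (cell T m t)) - h (\<lambda>t\<in>{0..T}. y (cell T m t))\<bar> < (e :: real)"
proof -
  let ?i = "\<lambda>y :: nat \<Rightarrow> real. \<lambda>t\<in>{0..T}. y (cell T m t)"
  note i = grid_values_in_linf[OF T, of _ m]
  from h i[of x] e obtain \<delta> where \<delta>: "\<delta> > 0"
    "\<And>z. z \<in> mspace (linf {0..T}) \<Longrightarrow> mdist (linf {0..T}) (?i x) z < \<delta> \<Longrightarrow> \<bar>h (?i x) - h z\<bar> < e"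
    unfolding continuous_map_mtopology_of_iff by meson
  show ?thesis
  proof (intro exI[of _ "\<delta> / 2"] conjI allI impI)
    fix y assume y: "\<forall>k\<in>{..16 ^ m}. \<bar>x k - y k\<bar> < \<delta> / 2"
    have "mdist (linf {0..T}) (?i x) (?i y) \<le> \<delta> / 2"
      using T y cell_le[OF T] by (subst linf_dist_le_iff[OF i i]) (auto intro: less_imp_le)
    then show "\<bar>h (?i x) - h (?i y)\<bar> < e" using \<delta>(1) by (intro \<delta>(2) i) auto
  qed (use \<delta> in auto)
qed

text \<open>
  A functional of a step function depends continuously on finitely many coordinates of the
  path, so it is measurable although \<open>linf\<close> is not separable and the process need not be Borel
  measurable into it.
\<close>
lemma step_functional_measurable:
  assumes T: "0 < T" and h: "continuous_map (mtopology_of (linf {0..T})) euclideanreal h"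
    and X: "\<And>t. t \<in> {0..T} \<Longrightarrow> (\<lambda>\<omega>. X \<omega> t) \<in> borel_measurable N"
  shows "(\<lambda>\<omega>. h (step T m (X \<omega>))) \<in> borel_measurable N"
  unfolding step_def
  by (rule measurable_finite_coordinates[of "{..16 ^ m}" "\<lambda>y. h (\<lambda>t\<in>{0..T}. y (cell T m t))" "\<lambda>\<omega> k. X \<omega> (grid T m k)"])
    (use step_functional_local[OF T h] X grid_mem[OF T] in auto)

text \<open>
  The step functions converge uniformly to the path, so a continuous functional of the process
  is a limit of measurable variables.
\<close>
lemma functional_measurable:
  assumes T: "0 < T" and h: "continuous_map (mtopology_of (linf {0..T})) euclideanreal h"
    and X: "\<And>t. t \<in> {0..T} \<Longrightarrow> (\<lambda>\<omega>. X \<omega> t) \<in> borel_measurable N"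
    and mem: "\<And>\<omega>. \<omega> \<in> space N \<Longrightarrow> X \<omega> \<in> mspace (linf {0..T})"
    and lim: "\<And>\<omega>. \<omega> \<in> space N \<Longrightarrow> (\<lambda>m. mdist (linf {0..T}) (X \<omega>) (step T m (X \<omega>))) \<longlonglongrightarrow> 0"
  shows "(\<lambda>\<omega>. h (X \<omega>)) \<in> borel_measurable N"
proof (rule borel_measurable_LIMSEQ_real)
  fix \<omega> assume \<omega>: "\<omega> \<in> space N"
  show "(\<lambda>m. h (step T m (X \<omega>))) \<longlonglongrightarrow> h (X \<omega>)"
  proof (rule LIMSEQ_I)
    fix r :: real assume "0 < r"
    with h mem[OF \<omega>] obtain \<delta> where \<delta>: "\<delta> > 0"
      "\<And>z. z \<in> mspace (linf {0..T}) \<Longrightarrow> mdist (linf {0..T}) (X \<omega>) z < \<delta> \<Longrightarrow> \<bar>h (X \<omega>) - h z\<bar> < r"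
      unfolding continuous_map_mtopology_of_iff by meson
    from order_tendstoD(2)[OF lim[OF \<omega>] \<delta>(1)] obtain m0 where
      m0: "\<And>m. m \<ge> m0 \<Longrightarrow> mdist (linf {0..T}) (X \<omega>) (step T m (X \<omega>)) < \<delta>"
      by (auto simp: eventually_sequentially)
    show "\<exists>m0. \<forall>m\<ge>m0. norm (h (step T m (X \<omega>)) - h (X \<omega>)) < r"
    proof (intro exI[of _ m0] allI impI)
      fix m assume "m0 \<le> m"
      from \<delta>(2)[OF step_in_linf[OF T] m0[OF this]]
      show "norm (h (step T m (X \<omega>)) - h (X \<omega>)) < r" by (simp add: abs_minus_commute)
    qed
  qed
qed (rule step_functional_measurable[OF T h X])

lemma mean_square_Lipschitz_nn_integral:
  assumes X: "mean_square_Lipschitz T C N X" and s: "s \<in> {0..T}" and t: "t \<in> {0..T}"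
  shows "(\<integral>\<^sup>+\<omega>. ennreal ((X \<omega> s - X \<omega> t)\<^sup>2) \<partial>N) \<le> ennreal ((s - t)\<^sup>2)"
proof -
  have [measurable]: "(\<lambda>\<omega>. X \<omega> s) \<in> borel_measurable N" "(\<lambda>\<omega>. X \<omega> t) \<in> borel_measurable N"
    using X s t by (auto simp: mean_square_Lipschitz_def)
  have i: "integrable N (\<lambda>\<omega>. (X \<omega> s)\<^sup>2)" "integrable N (\<lambda>\<omega>. (X \<omega> t)\<^sup>2)"
    using X s t by (auto simp: mean_square_Lipschitz_def)
  have "integrable N (\<lambda>\<omega>. (X \<omega> s - X \<omega> t)\<^sup>2)"
  proof (rule Bochner_Integration.integrable_bound)
    show "integrable N (\<lambda>\<omega>. 2 * (X \<omega> s)\<^sup>2 + 2 * (X \<omega> t)\<^sup>2)" using i by simp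
    have "(a - b)\<^sup>2 \<le> 2 * a\<^sup>2 + 2 * b\<^sup>2" for a b :: real
      using zero_le_power2[of "a + b"] by (simp add: power2_eq_square algebra_simps)
    then show "AE \<omega> in N. norm ((X \<omega> s - X \<omega> t)\<^sup>2) \<le> norm (2 * (X \<omega> s)\<^sup>2 + 2 * (X \<omega> t)\<^sup>2)"
      by (intro AE_I2) (simp add: order_trans[OF _ abs_ge_self])
  qed simp
  then have "(\<integral>\<^sup>+\<omega>. ennreal ((X \<omega> s - X \<omega> t)\<^sup>2) \<partial>N) = ennreal (\<integral>\<omega>. (X \<omega> s - X \<omega> t)\<^sup>2 \<partial>N)"
    by (intro nn_integral_eq_integral) auto
  also have "\<dots> \<le> ennreal ((s - t)\<^sup>2)"
    using X s t by (intro ennreal_leI) (auto simp: mean_square_Lipschitz_def)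
  finally show ?thesis .
qed

lemma mean_square_Lipschitz_energy:
  assumes T: "0 < T" and X: "mean_square_Lipschitz T C N X"
  shows "(\<integral>\<^sup>+\<omega>. energy T (X \<omega>) \<partial>N) \<le> ennreal (64 * T\<^sup>2)"
  using grid_points_subset[OF T] X
  by (intro nn_integral_energy_le[OF T] mean_square_Lipschitz_nn_integral[OF X]) (auto simp: mean_square_Lipschitz_def)

lemma mean_square_Lipschitz_energy_finite:
  assumes T: "0 < T" and X: "mean_square_Lipschitz T C N X"
  shows "AE \<omega> in N. energy T (X \<omega>) < \<infinity>"
proof -
  have "(\<integral>\<^sup>+\<omega>. energy T (X \<omega>) \<partial>N) \<noteq> \<infinity>"
    using mean_square_Lipschitz_energy[OF T X] by (auto simp: top_unique)
  then have "AE \<omega> in N. energy T (X \<omega>) \<noteq> \<infinity>"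
    using X grid_points_subset[OF T]
    by (intro nn_integral_PInf_AE energy_measurable) (auto simp: mean_square_Lipschitz_def)
  then show ?thesis by (simp add: less_top)
qed

text \<open>
  The squared errors along the approximations of a fixed time have summable expectations. The
  exceptional null set depends on that time.
\<close>
lemma mean_square_Lipschitz_pointwise:
  assumes T: "0 < T" and X: "mean_square_Lipschitz T C N X" and s: "s \<in> {0..T}"
  shows "AE \<omega> in N. (\<lambda>n. X \<omega> (grid T n (cell T n s))) \<longlonglongrightarrow> X \<omega> s"
proof -
  let ?p = "\<lambda>n. grid T n (cell T n s)"
  have p: "?p n \<in> {0..T}" for n by (rule grid_mem[OF T cell_le[OF T s]])
  have [measurable]: "(\<lambda>\<omega>. X \<omega> t) \<in> borel_measurable N" if "t \<in> {0..T}" for t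
    using X that by (auto simp: mean_square_Lipschitz_def)
  note [measurable] = this[OF p] this[OF s]
  have "(\<integral>\<^sup>+\<omega>. (\<Sum>n. ennreal ((X \<omega> (?p n) - X \<omega> s)\<^sup>2)) \<partial>N) = (\<Sum>n. \<integral>\<^sup>+\<omega>. ennreal ((X \<omega> (?p n) - X \<omega> s)\<^sup>2) \<partial>N)"
    by (intro nn_integral_suminf) measurable
  also have "\<dots> \<le> (\<Sum>n. ennreal (T\<^sup>2 * (1 / 2) ^ n))"
  proof (intro suminf_le allI)
    fix n
    have "(\<integral>\<^sup>+\<omega>. ennreal ((X \<omega> (?p n) - X \<omega> s)\<^sup>2) \<partial>N) \<le> ennreal ((?p n - s)\<^sup>2)"
      by (rule mean_square_Lipschitz_nn_integral[OF X p s])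
    also have "\<dots> \<le> ennreal (T\<^sup>2 * (1 / 2) ^ n)"
    proof (rule ennreal_leI)
      have "(?p n - s)\<^sup>2 \<le> (T / 16 ^ n)\<^sup>2"
        using cell_bounds[OF T s, of n] by (subst power2_commute) (intro power_mono; linarith)
      also have "\<dots> = T\<^sup>2 * (1 / 256) ^ n"
        by (simp add: power_divide power2_eq_square field_simps flip: power_mult_distrib)
      also have "\<dots> \<le> T\<^sup>2 * (1 / 2) ^ n" by (intro mult_left_mono power_mono) auto
      finally show "(?p n - s)\<^sup>2 \<le> T\<^sup>2 * (1 / 2) ^ n" .
    qed
    finally show "(\<integral>\<^sup>+\<omega>. ennreal ((X \<omega> (?p n) - X \<omega> s)\<^sup>2) \<partial>N) \<le> ennreal (T\<^sup>2 * (1 / 2) ^ n)" .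
  qed auto
  also have "\<dots> = ennreal (\<Sum>n. T\<^sup>2 * (1 / 2) ^ n)"
    by (intro suminf_ennreal2 summable_mult summable_geometric) auto
  finally have "(\<integral>\<^sup>+\<omega>. (\<Sum>n. ennreal ((X \<omega> (?p n) - X \<omega> s)\<^sup>2)) \<partial>N) \<noteq> \<infinity>" by (auto simp: top_unique)
  then have "AE \<omega> in N. (\<Sum>n. ennreal ((X \<omega> (?p n) - X \<omega> s)\<^sup>2)) \<noteq> \<infinity>"
    by (intro nn_integral_PInf_AE) measurable
  then show ?thesis
  proof eventually_elim
    fix \<omega> assume "(\<Sum>n. ennreal ((X \<omega> (?p n) - X \<omega> s)\<^sup>2)) \<noteq> \<infinity>"
    then have "summable (\<lambda>n. (X \<omega> (?p n) - X \<omega> s)\<^sup>2)"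
      by (intro summable_suminf_not_top) auto
    then have "(\<lambda>n. sqrt ((X \<omega> (?p n) - X \<omega> s)\<^sup>2)) \<longlonglongrightarrow> sqrt 0"
      by (intro tendsto_real_sqrt summable_LIMSEQ_zero)
    then have "(\<lambda>n. X \<omega> (?p n) - X \<omega> s) \<longlonglongrightarrow> 0"
      by (simp add: tendsto_rabs_zero_iff)
    then show "(\<lambda>n. X \<omega> (?p n)) \<longlonglongrightarrow> X \<omega> s" by (simp add: LIM_zero_iff)
  qed
qed

lemma energy_controls_distance:
  assumes T: "0 < T" and fin: "energy T x < \<infinity>" and x: "x \<in> mspace (linf {0..T})"
    and lim: "\<And>t. t \<in> {0..T} \<Longrightarrow> (\<lambda>n. x (grid T n (cell T n t))) \<longlonglongrightarrow> x t"
  shows "mdist (linf {0..T}) x (step T m x) \<le> 2 * sqrt (enn2real (energy T x)) / 2 ^ m"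
proof -
  have "energy T x \<le> ennreal ((sqrt (enn2real (energy T x)))\<^sup>2)" using fin by simp
  from energy_controls_step[OF T _ this _ lim]
  show ?thesis using T x step_in_linf[OF T] by (subst linf_dist_le_iff) auto
qed

lemma geometric_bound_tendsto_zero:
  assumes "\<And>m. mdist d x (y m) \<le> c / 2 ^ m"
  shows "(\<lambda>m. mdist d x (y m)) \<longlonglongrightarrow> (0::real)"
proof (rule tendsto_sandwich[of "\<lambda>_. 0" _ _ "\<lambda>m. c / 2 ^ m"])
  show "(\<lambda>m. c / 2 ^ m) \<longlonglongrightarrow> 0" by real_asymp
qed (use assms in auto)

text \<open>
  The image of a real function is separable, so countably many arguments suffice to
  approximate all its values.
\<close>
lemma countable_near_sup:
  fixes g :: "'a \<Rightarrow> real"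
  obtains S where "countable S" "S \<subseteq> A" "\<And>t e. t \<in> A \<Longrightarrow> 0 < e \<Longrightarrow> \<exists>s\<in>S. g t < g s + e"
proof -
  obtain D where D: "countable D" "D \<subseteq> g ` A" "g ` A \<subseteq> closure D"
    using separable[of "g ` A"] by metis
  obtain S where S: "countable S" "S \<subseteq> A" "D = g ` S"
    using countable_subset_image[of D g A] D by metis
  show ?thesis
  proof (rule that[OF S(1,2)])
    fix t and e :: real assume t: "t \<in> A" and e: "0 < e"
    have "g t \<in> closure D" using D(3) t by auto
    then obtain d where "d \<in> D" "dist d (g t) < e" using e unfolding closure_approachable by blast
    then obtain s where "s \<in> S" "dist (g s) (g t) < e" using S(3) by auto
    then show "\<exists>s\<in>S. g t < g s + e" by (auto simp: dist_real_def intro!: bexI[of _ s])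
  qed
qed

lemma metric_borel_generators: "{U. openin (mtopology_of m) U} \<subseteq> Pow (mspace m)"
proof
  fix U assume "U \<in> {U. openin (mtopology_of m) U}"
  then have "U \<subseteq> topspace (mtopology_of m)" by (intro openin_subset) simp
  then show "U \<in> Pow (mspace m)" by simp
qed

lemma space_metric_borel: "space (metric_borel m) = mspace m"
  unfolding metric_borel_def by (rule space_measure_of[OF metric_borel_generators])

lemma closed_in_metric_borel:
  assumes "closedin (mtopology_of m) K"
  shows "K \<in> sets (metric_borel m)"
proof -
  have "openin (mtopology_of m) (mspace m - K)" and K: "K \<subseteq> mspace m"
    using assms by (simp_all add: closedin_def)
  then have "mspace m - K \<in> sets (metric_borel m)"
    unfolding metric_borel_def by (intro in_measure_of[OF metric_borel_generators]) simp
  then have "space (metric_borel m) - (mspace m - K) \<in> sets (metric_borel m)" by (rule sets.compl_sets)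
  then show ?thesis using K by (simp add: space_metric_borel double_diff)
qed

text \<open>
  Compact sets in a metric space are totally bounded. Countably many of them carry the whole
  mass.
\<close>
lemma tight_imp_separable_support:
  assumes tight: "tight_random_element m N X"
  obtains Q where "countable Q" "Q \<subseteq> mspace m"
    "AE \<omega> in N. \<forall>e>0. \<exists>q\<in>Q. mdist m (X \<omega>) q < e"
proof -
  interpret N: prob_space N using tight by (simp add: tight_random_element_def)
  interpret m: Metric_space "mspace m" "mdist m" by simp
  have X[measurable]: "X \<in> measurable N (metric_borel m)"
    and "\<forall>e>0. \<exists>K. compactin (mtopology_of m) K \<and> measure N {\<omega> \<in> space N. X \<omega> \<in> K} \<ge> 1 - e"
    using tight by (auto simp: tight_random_element_def)
  then have "\<forall>j::nat. \<exists>K. compactin (mtopology_of m) K \<and> measure N {\<omega> \<in> space N. X \<omega> \<in> K} \<ge> 1 - 1 / Suc j"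
    by simp
  then obtain K where K: "\<And>j. compactin (mtopology_of m) (K j)"
    "\<And>j::nat. measure N {\<omega> \<in> space N. X \<omega> \<in> K j} \<ge> 1 - 1 / Suc j" by metis
  have tb: "m.mtotally_bounded (K j)" for j
    using K(1)[of j] m.compactin_imp_mtotally_bounded by (simp add: mtopology_of_def)
  have "\<forall>j i::nat. \<exists>F. finite F \<and> F \<subseteq> K j \<and> K j \<subseteq> (\<Union>x\<in>F. m.mball x (1 / Suc i))"
    using tb unfolding m.mtotally_bounded_def by simp
  then obtain F where F: "\<And>j i. finite (F j i)" "\<And>j i. F j i \<subseteq> K j"
    "\<And>j i::nat. K j \<subseteq> (\<Union>x\<in>F j i. m.mball x (1 / Suc i))" by metis
  define Q where "Q = (\<Union>j. \<Union>i. F j i)"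
  have Ksub: "K j \<subseteq> mspace m" for j using K(1)[of j] by (simp add: compactin_def)
  have near: "\<exists>q\<in>Q. mdist m x q < e" if x: "x \<in> K j" and e: "0 < e" for x j e
  proof -
    obtain i where i: "1 / Suc i < e" using nat_approx_posE[OF e] by blast
    obtain q where "q \<in> F j i" "x \<in> m.mball q (1 / Suc i)" using F(3)[of j i] x by blast
    then show ?thesis using i by (intro bexI[of _ q]) (auto simp: Q_def m.commute)
  qed
  have [measurable]: "{\<omega> \<in> space N. X \<omega> \<in> K j} \<in> sets N" for j
  proof -
    have "closedin (mtopology_of m) (K j)"
      using compactin_imp_closedin[OF m.Hausdorff_space_mtopology] K(1)[of j]
      by (simp add: mtopology_of_def)
    then have "K j \<in> sets (metric_borel m)" by (rule closed_in_metric_borel)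
    from measurable_sets[OF X this] show ?thesis by (simp add: vimage_def Int_def conj_commute)
  qed
  have "AE \<omega> in N. \<exists>j. X \<omega> \<in> K j"
  proof -
    let ?A = "\<Union>j. {\<omega> \<in> space N. X \<omega> \<in> K j}"
    have "1 - 1 / Suc j \<le> measure N ?A" for j
    proof (rule order_trans[OF K(2)[of j]])
      show "measure N {\<omega> \<in> space N. X \<omega> \<in> K j} \<le> measure N ?A"
        by (rule N.finite_measure_mono) (auto intro!: sets.countable_UN)
    qed
    moreover have "(\<lambda>j. 1 - 1 / Suc j) \<longlonglongrightarrow> (1::real)" by real_asymp
    ultimately have "1 \<le> measure N ?A" by (intro LIMSEQ_le_const2) auto
    then have "N.prob ?A = 1" by (simp add: N.measure_ge_1_iff)
    then have "AE \<omega> in N. \<omega> \<in> ?A" by (subst N.AE_in_set_eq_1) (auto intro!: sets.countable_UN)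
    then show ?thesis by eventually_elim auto
  qed
  then have "AE \<omega> in N. \<forall>e>0. \<exists>q\<in>Q. mdist m (X \<omega>) q < e"
    by eventually_elim (use near in blast)
  moreover have "countable Q" unfolding Q_def by (intro countable_UN countableI_type countable_finite F(1))
  moreover have "Q \<subseteq> mspace m" using F(2) Ksub unfolding Q_def by blast
  ultimately show ?thesis by (rule that[rotated 2])
qed

text \<open>
  Chaining bounds \<open>\<bar>X t - step T m X t\<bar>\<close> for all \<open>t\<close> in a countable set simultaneously. To
  reach every \<open>t\<close>, choose for each element \<open>q\<close> of a countable dense subset of the support, and
  for each level \<open>m\<close>, countably many times at which \<open>\<bar>q - step T m q\<bar>\<close> comes close to each of
  its values. A path near \<open>q\<close> inherits the bound at \<open>t\<close> from the bound at such a time.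
\<close>
lemma tight_mean_square_Lipschitz_continuous:
  assumes T: "0 < T" and X: "mean_square_Lipschitz T C N X"
    and tight: "tight_random_element (linf {0..T}) N X"
  shows "AE \<omega> in N. \<forall>t\<in>{0..T}. (\<lambda>n. X \<omega> (grid T n (cell T n t))) \<longlonglongrightarrow> X \<omega> t"
proof -
  let ?l = "linf {0..T}"
  obtain Q where Q: "countable Q" "Q \<subseteq> mspace ?l"
    "AE \<omega> in N. \<forall>e>0. \<exists>q\<in>Q. mdist ?l (X \<omega>) q < e"
    by (rule tight_imp_separable_support[OF tight])
  have "\<forall>q m. \<exists>S. countable S \<and> S \<subseteq> {0..T} \<and>
      (\<forall>t\<in>{0..T}. \<forall>e>0. \<exists>s\<in>S. \<bar>q t - step T m q t\<bar> < \<bar>q s - step T m q s\<bar> + e)"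
    using countable_near_sup[of "{0..T}" "\<lambda>t. \<bar>q t - step T m q t\<bar>" for q m] by metis
  then obtain S where S: "\<And>q m. countable (S q m)" "\<And>q m. S q m \<subseteq> {0..T}"
    "\<And>q m t e. t \<in> {0..T} \<Longrightarrow> 0 < e \<Longrightarrow> \<exists>s\<in>S q m. \<bar>q t - step T m q t\<bar> < \<bar>q s - step T m q s\<bar> + e"
    by metis
  define S' where "S' = (\<Union>q\<in>Q. \<Union>m. S q m)"
  have S'sub: "S' \<subseteq> {0..T}" unfolding S'_def using S(2) by blast
  have "countable S'" unfolding S'_def using Q(1) S(1) by auto
  moreover have "AE \<omega> in N. (\<lambda>n. X \<omega> (grid T n (cell T n s))) \<longlonglongrightarrow> X \<omega> s" if "s \<in> S'" for s
    using S'sub that by (intro mean_square_Lipschitz_pointwise[OF T X]) blast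
  ultimately have "AE \<omega> in N. \<forall>s\<in>S'. (\<lambda>n. X \<omega> (grid T n (cell T n s))) \<longlonglongrightarrow> X \<omega> s"
    by (simp add: AE_ball_countable)
  moreover have "AE \<omega> in N. X \<omega> \<in> mspace ?l"
  proof (rule AE_I2)
    fix \<omega> assume "\<omega> \<in> space N"
    moreover have "X \<in> measurable N (metric_borel ?l)" using tight by (simp add: tight_random_element_def)
    ultimately show "X \<omega> \<in> mspace ?l" by (metis measurable_space space_metric_borel)
  qed
  ultimately show ?thesis
    using Q(3) mean_square_Lipschitz_energy_finite[OF T X]
  proof eventually_elim
    fix \<omega>
    assume conv: "\<forall>s\<in>S'. (\<lambda>n. X \<omega> (grid T n (cell T n s))) \<longlonglongrightarrow> X \<omega> s"
      and mem: "X \<omega> \<in> mspace ?l" and near: "\<forall>e>0. \<exists>q\<in>Q. mdist ?l (X \<omega>) q < e"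
      and fin: "energy T (X \<omega>) < \<infinity>"
    define c where "c = sqrt (enn2real (energy T (X \<omega>)))"
    have en: "energy T (X \<omega>) \<le> ennreal (c\<^sup>2)" and c: "0 \<le> c" using fin by (auto simp: c_def)
    have S'b: "\<bar>X \<omega> s - step T m (X \<omega>) s\<bar> \<le> 2 * c / 2 ^ m" if "s \<in> S'" for s m
      using that S'sub conv by (intro energy_controls_step[OF T _ en c]) blast+
    have all: "\<bar>X \<omega> t - step T m (X \<omega>) t\<bar> \<le> 2 * c / 2 ^ m" if t: "t \<in> {0..T}" for t m
    proof (rule field_le_epsilon)
      fix e :: real assume "0 < e"
      then have e: "0 < e / 5" by simp
      then obtain q where q: "q \<in> Q" "mdist ?l (X \<omega>) q < e / 5" using near by meson
      obtain s where s: "s \<in> S q m" "\<bar>q t - step T m q t\<bar> < \<bar>q s - step T m q s\<bar> + e / 5"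
        using S(3)[OF t e] by blast
      have s0: "s \<in> {0..T}" "s \<in> S'" using s(1) S(2) q(1) unfolding S'_def by blast+
      have d: "\<bar>X \<omega> u - q u\<bar> < e / 5" if "u \<in> {0..T}" for u
        using linf_abs_diff_le[OF mem _ that, of q] q Q(2) by auto
      have d': "\<bar>step T m (X \<omega>) u - step T m q u\<bar> < e / 5" if "u \<in> {0..T}" for u
        unfolding step_apply[OF that] by (rule d[OF grid_mem[OF T cell_le[OF T that]]])
      have q': "\<bar>x - y\<bar> \<le> \<bar>x' - y'\<bar> + (e / 5 + e / 5)"
        if "\<bar>x - x'\<bar> < e / 5" "\<bar>y - y'\<bar> < e / 5" for x y x' y' :: real
        using that by linarith
      have "\<bar>X \<omega> t - step T m (X \<omega>) t\<bar> \<le> \<bar>q t - step T m q t\<bar> + (e / 5 + e / 5)"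
        by (rule q'[OF d[OF t] d'[OF t]])
      also have "\<bar>q t - step T m q t\<bar> \<le> \<bar>q s - step T m q s\<bar> + e / 5" using s(2) by simp
      also have "\<bar>q s - step T m q s\<bar> \<le> \<bar>X \<omega> s - step T m (X \<omega>) s\<bar> + (e / 5 + e / 5)"
        by (rule q') (use d[OF s0(1)] d'[OF s0(1)] in \<open>simp_all add: abs_minus_commute\<close>)
      also have "\<bar>X \<omega> s - step T m (X \<omega>) s\<bar> \<le> 2 * c / 2 ^ m" by (rule S'b[OF s0(2)])
      finally show "\<bar>X \<omega> t - step T m (X \<omega>) t\<bar> \<le> 2 * c / 2 ^ m + e" by simp
    qed
    show "\<forall>t\<in>{0..T}. (\<lambda>n. X \<omega> (grid T n (cell T n t))) \<longlonglongrightarrow> X \<omega> t"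
    proof
      fix t assume t: "t \<in> {0..T}"
      have "(\<lambda>n. X \<omega> (grid T n (cell T n t)) - X \<omega> t) \<longlonglongrightarrow> 0"
      proof (rule Lim_null_comparison)
        show "\<forall>\<^sub>F n in sequentially. norm (X \<omega> (grid T n (cell T n t)) - X \<omega> t) \<le> 2 * c / 2 ^ n"
          using all[OF t] by (intro always_eventually) (auto simp: step_apply[OF t] abs_minus_commute)
        show "(\<lambda>n. 2 * c / 2 ^ n) \<longlonglongrightarrow> 0" by real_asymp
      qed
      then show "(\<lambda>n. X \<omega> (grid T n (cell T n t))) \<longlonglongrightarrow> X \<omega> t" by (simp add: LIM_zero_iff)
    qed
  qed
qed

lemma continuous_measurable_metric_borel:
  assumes h: "continuous_map (mtopology_of m) euclideanreal h"
  shows "h \<in> borel_measurable (metric_borel m)"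
proof (rule borel_measurableI)
  fix U :: "real set" assume "open U"
  then have "openin (mtopology_of m) {x \<in> topspace (mtopology_of m). h x \<in> U}"
    by (intro openin_continuous_map_preimage[OF h]) simp
  then have "{x \<in> mspace m. h x \<in> U} \<in> sets (metric_borel m)"
    unfolding metric_borel_def by (intro in_measure_of[OF metric_borel_generators]) simp
  moreover have "h -` U \<inter> space (metric_borel m) = {x \<in> mspace m. h x \<in> U}"
    by (auto simp: space_metric_borel)
  ultimately show "h -` U \<inter> space (metric_borel m) \<in> sets (metric_borel m)" by simp
qed

text \<open>
  The error is at most \<open>2 * sqrt W / 2 ^ m\<close> times the Lipschitz constant, where \<open>W\<close> is the
  energy, and \<open>sqrt W \<le> 1 + W\<close> has bounded expectation.
\<close>
lemma step_expectation_error: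
  assumes T: "0 < T" and X: "mean_square_Lipschitz T C N X"
    and mem: "AE \<omega> in N. X \<omega> \<in> mspace (linf {0..T})"
    and paths: "AE \<omega> in N. \<forall>t\<in>{0..T}. (\<lambda>n. X \<omega> (grid T n (cell T n t))) \<longlonglongrightarrow> X \<omega> t"
    and bdd: "\<And>x. x \<in> mspace (linf {0..T}) \<Longrightarrow> \<bar>h x\<bar> \<le> B" and K: "0 \<le> K"
    and Lip: "\<And>x y. x \<in> mspace (linf {0..T}) \<Longrightarrow> y \<in> mspace (linf {0..T}) \<Longrightarrow>
        \<bar>h x - h y\<bar> \<le> K * mdist (linf {0..T}) x y"
    and meas: "(\<lambda>\<omega>. h (X \<omega>)) \<in> borel_measurable N"
  shows "\<bar>(\<integral>\<omega>. h (X \<omega>) \<partial>N) - (\<integral>\<omega>. h (step T m (X \<omega>)) \<partial>N)\<bar> \<le> 2 * K * (1 + 64 * T\<^sup>2) / 2 ^ m"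
proof -
  interpret prob_space N using X by (simp add: mean_square_Lipschitz_def)
  let ?W = "\<lambda>\<omega>. enn2real (energy T (X \<omega>))"
  have coord: "(\<lambda>\<omega>. X \<omega> t) \<in> borel_measurable N" if "t \<in> {0..T}" for t
    using X that by (simp add: mean_square_Lipschitz_def)
  have h: "continuous_map (mtopology_of (linf {0..T})) euclideanreal h"
    by (rule Lipschitz_imp_continuous_map[OF Lip])
  have [measurable]: "(\<lambda>\<omega>. energy T (X \<omega>)) \<in> borel_measurable N"
    by (rule energy_measurable[OF coord]) (use grid_points_subset[OF T] in blast)
  have fin: "AE \<omega> in N. energy T (X \<omega>) < \<infinity>"
    by (rule mean_square_Lipschitz_energy_finite[OF T X])
  have "(\<integral>\<^sup>+\<omega>. ennreal (?W \<omega>) \<partial>N) = (\<integral>\<^sup>+\<omega>. energy T (X \<omega>) \<partial>N)"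
    by (rule nn_integral_cong_AE) (use fin in eventually_elim, simp)
  also have "\<dots> \<le> ennreal (64 * T\<^sup>2)" by (rule mean_square_Lipschitz_energy[OF T X])
  finally have W: "(\<integral>\<^sup>+\<omega>. ennreal (?W \<omega>) \<partial>N) \<le> ennreal (64 * T\<^sup>2)" .
  then have iW: "integrable N ?W"
    by (intro integrableI_nonneg) (auto simp: less_top[symmetric] top_unique)
  have "ennreal (\<integral>\<omega>. ?W \<omega> \<partial>N) \<le> ennreal (64 * T\<^sup>2)"
    using W by (subst nn_integral_eq_integral[OF iW, symmetric]) auto
  then have EW: "(\<integral>\<omega>. ?W \<omega> \<partial>N) \<le> 64 * T\<^sup>2" by (simp add: ennreal_le_iff)
  have i1: "integrable N (\<lambda>\<omega>. h (X \<omega>))"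
    by (rule integrable_const_bound[where B=B, OF _ meas]) (use mem in eventually_elim, simp add: bdd)
  have i2: "integrable N (\<lambda>\<omega>. h (step T m (X \<omega>)))"
    by (rule integrable_const_bound[where B=B, OF _ step_functional_measurable[OF T h coord]])
      (simp add: bdd step_in_linf[OF T])
  have "\<bar>(\<integral>\<omega>. h (X \<omega>) \<partial>N) - (\<integral>\<omega>. h (step T m (X \<omega>)) \<partial>N)\<bar> = \<bar>\<integral>\<omega>. h (X \<omega>) - h (step T m (X \<omega>)) \<partial>N\<bar>"
    using i1 i2 by simp
  also have "\<dots> \<le> (\<integral>\<omega>. \<bar>h (X \<omega>) - h (step T m (X \<omega>))\<bar> \<partial>N)" by (rule integral_abs_bound)
  also have "\<dots> \<le> (\<integral>\<omega>. 2 * K / 2 ^ m * (1 + ?W \<omega>) \<partial>N)"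
  proof (rule integral_mono_AE)
    show "AE \<omega> in N. \<bar>h (X \<omega>) - h (step T m (X \<omega>))\<bar> \<le> 2 * K / 2 ^ m * (1 + ?W \<omega>)"
      using mem paths fin
    proof eventually_elim
      fix \<omega>
      assume mem: "X \<omega> \<in> mspace (linf {0..T})" and fin: "energy T (X \<omega>) < \<infinity>"
        and paths: "\<forall>t\<in>{0..T}. (\<lambda>n. X \<omega> (grid T n (cell T n t))) \<longlonglongrightarrow> X \<omega> t"
      have "sqrt w \<le> 1 + w" if "0 \<le> w" for w :: real
      proof -
        have "w \<le> (1 + w)\<^sup>2" using that by (simp add: power2_eq_square algebra_simps)
        then show ?thesis using that by (intro real_le_lsqrt) auto
      qed
      from this[of "?W \<omega>"] have s: "sqrt (?W \<omega>) \<le> 1 + ?W \<omega>" by simp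
      have "\<bar>h (X \<omega>) - h (step T m (X \<omega>))\<bar> \<le> K * mdist (linf {0..T}) (X \<omega>) (step T m (X \<omega>))"
        by (rule Lip[OF mem step_in_linf[OF T]])
      also have "\<dots> \<le> K * (2 * sqrt (?W \<omega>) / 2 ^ m)"
        using K paths by (intro mult_left_mono energy_controls_distance[OF T fin mem]) auto
      also have "\<dots> \<le> K * (2 * (1 + ?W \<omega>) / 2 ^ m)"
        using K s by (intro mult_left_mono divide_right_mono) auto
      also have "\<dots> = 2 * K / 2 ^ m * (1 + ?W \<omega>)" by simp
      finally show "\<bar>h (X \<omega>) - h (step T m (X \<omega>))\<bar> \<le> 2 * K / 2 ^ m * (1 + ?W \<omega>)" .
    qed
  qed (use i1 i2 iW in auto)
  also have "\<dots> = 2 * K / 2 ^ m * (1 + (\<integral>\<omega>. ?W \<omega> \<partial>N))"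
    using iW by (simp add: prob_space)
  also have "\<dots> \<le> 2 * K / 2 ^ m * (1 + 64 * T\<^sup>2)"
    using EW K by (intro mult_left_mono) auto
  finally show ?thesis by simp
qed

text \<open>
  For a Lipschitz functional, both expectations change by little, uniformly in \<open>n\<close>, when the
  process is replaced by its step function of a fixed high level. What remains is a Lipschitz
  function of the finitely many values on that grid, and the Cramer-Wold device applies.
\<close>
theorem weak_convergence_criterion:
  assumes T: "0 < T"
    and X: "\<And>n. mean_square_Lipschitz T C M (X n)" and G: "mean_square_Lipschitz T C N G"
    and tight: "tight_random_element (linf {0..T}) N G"
    and mem: "\<And>n \<omega>. \<omega> \<in> space M \<Longrightarrow> X n \<omega> \<in> mspace (linf {0..T})"
    and lim: "\<And>n \<omega>. \<omega> \<in> space M \<Longrightarrow> (\<lambda>m. mdist (linf {0..T}) (X n \<omega>) (step T m (X n \<omega>))) \<longlonglongrightarrow> 0"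
    and cos: "\<And>m a b. (\<lambda>n. \<integral>\<omega>. cos ((\<Sum>k\<le>16 ^ m. a k * X n \<omega> (grid T m k)) + b) \<partial>M) \<longlonglongrightarrow>
        (\<integral>\<omega>. cos ((\<Sum>k\<le>16 ^ m. a k * G \<omega> (grid T m k)) + b) \<partial>N)"
  shows "converges_in_distribution (linf {0..T}) M X N G"
proof -
  let ?l = "linf {0..T}"
  interpret M: prob_space M using X by (simp add: mean_square_Lipschitz_def)
  interpret N: prob_space N using G by (simp add: mean_square_Lipschitz_def)
  have coordX: "(\<lambda>\<omega>. X n \<omega> t) \<in> borel_measurable M" if "t \<in> {0..T}" for t n
    using X[of n] that by (simp add: mean_square_Lipschitz_def)
  have coordG: "(\<lambda>\<omega>. G \<omega> t) \<in> borel_measurable N" if "t \<in> {0..T}" for t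
    using G that by (simp add: mean_square_Lipschitz_def)
  have Gm: "G \<in> measurable N (metric_borel ?l)" using tight by (simp add: tight_random_element_def)
  have memG: "G \<omega> \<in> mspace ?l" if "\<omega> \<in> space N" for \<omega>
    using measurable_space[OF Gm that] by (simp add: space_metric_borel)
  have hX: "(\<lambda>\<omega>. h (X n \<omega>)) \<in> borel_measurable M"
    if "continuous_map (mtopology_of ?l) euclideanreal h" for h n
    by (rule functional_measurable[OF T that coordX mem lim])
  have hG: "(\<lambda>\<omega>. h (G \<omega>)) \<in> borel_measurable N"
    if "continuous_map (mtopology_of ?l) euclideanreal h" for h
    by (rule measurable_compose[OF Gm continuous_measurable_metric_borel[OF that]])
  have pathX: "(\<lambda>k. X n \<omega> (grid T k (cell T k t))) \<longlonglongrightarrow> X n \<omega> t"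
    if \<omega>: "\<omega> \<in> space M" and t: "t \<in> {0..T}" for n \<omega> t
  proof -
    have "(\<lambda>k. X n \<omega> (grid T k (cell T k t)) - X n \<omega> t) \<longlonglongrightarrow> 0"
    proof (rule Lim_null_comparison[OF _ lim[OF \<omega>]])
      show "\<forall>\<^sub>F k in sequentially. norm (X n \<omega> (grid T k (cell T k t)) - X n \<omega> t) \<le>
          mdist ?l (X n \<omega>) (step T k (X n \<omega>))"
        using linf_abs_diff_le[OF mem[OF \<omega>] step_in_linf[OF T] t]
        by (intro always_eventually) (auto simp: step_apply[OF t] abs_minus_commute)
    qed
    then show ?thesis by (simp add: LIM_zero_iff)
  qed
  have Lipschitz: "(\<lambda>n. \<integral>\<omega>. h (X n \<omega>) \<partial>M) \<longlonglongrightarrow> (\<integral>\<omega>. h (G \<omega>) \<partial>N)"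
    if bdd: "\<And>x. x \<in> mspace ?l \<Longrightarrow> \<bar>h x\<bar> \<le> B"
      and Lip: "\<And>x y. x \<in> mspace ?l \<Longrightarrow> y \<in> mspace ?l \<Longrightarrow> \<bar>h x - h y\<bar> \<le> K * mdist ?l x y" and K: "0 \<le> K"
    for h B K
  proof (rule LIMSEQ_I)
    fix r :: real assume r: "0 < r"
    have h: "continuous_map (mtopology_of ?l) euclideanreal h" by (rule Lipschitz_imp_continuous_map[OF Lip])
    have "(\<lambda>m. 2 * K * (1 + 64 * T\<^sup>2) / 2 ^ m) \<longlonglongrightarrow> 0" by real_asymp
    then have "\<forall>\<^sub>F m in sequentially. 2 * K * (1 + 64 * T\<^sup>2) / 2 ^ m < r / 4"
      using r by (intro order_tendstoD) auto
    then obtain m where m: "2 * K * (1 + 64 * T\<^sup>2) / 2 ^ m < r / 4" by (auto simp: eventually_sequentially)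
    let ?H = "\<lambda>y :: nat \<Rightarrow> real. h (\<lambda>t\<in>{0..T}. y (cell T m t))"
    note i = grid_values_in_linf[OF T, of _ m]
    have "(\<lambda>n. \<integral>\<omega>. ?H (\<lambda>k. X n \<omega> (grid T m k)) \<partial>M) \<longlonglongrightarrow> (\<integral>\<omega>. ?H (\<lambda>k. G \<omega> (grid T m k)) \<partial>N)"
    proof (rule Cramer_Wold_Lipschitz[where I="{..16 ^ m}" and H="?H" and
          V="\<lambda>n \<omega> k. X n \<omega> (grid T m k)" and W="\<lambda>\<omega> k. G \<omega> (grid T m k)" and C=C and B=B and K=K])
      show "\<bar>?H x - ?H y\<bar> \<le> K * (\<Sum>k\<le>16 ^ m. \<bar>x k - y k\<bar>)" for x y
      proof -
        have "\<bar>x (cell T m t) - y (cell T m t)\<bar> \<le> (\<Sum>k\<le>16 ^ m. \<bar>x k - y k\<bar>)" if "t \<in> {0..T}" for t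
          by (rule member_le_sum[of "cell T m t" _ "\<lambda>k. \<bar>x k - y k\<bar>"]) (use cell_le[OF T that] in auto)
        then have "mdist ?l (\<lambda>t\<in>{0..T}. x (cell T m t)) (\<lambda>t\<in>{0..T}. y (cell T m t)) \<le> (\<Sum>k\<le>16 ^ m. \<bar>x k - y k\<bar>)"
          using T by (subst linf_dist_le_iff[OF i i]) auto
        then show ?thesis using Lip[OF i i, of x y] K by (meson mult_left_mono order_trans)
      qed
      show "\<bar>?H x\<bar> \<le> B" for x by (rule bdd[OF i])
    qed (use M.prob_space_axioms N.prob_space_axioms X G grid_mem[OF T] K cos in \<open>auto simp: mean_square_Lipschitz_def\<close>)
    moreover have "?H (\<lambda>k. x (grid T m k)) = h (step T m x)" for x by (simp add: step_def)
    ultimately have "(\<lambda>n. \<integral>\<omega>. h (step T m (X n \<omega>)) \<partial>M) \<longlonglongrightarrow> (\<integral>\<omega>. h (step T m (G \<omega>)) \<partial>N)" by simp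
    from LIMSEQ_D[OF this, of "r / 2"] r obtain n0 where
      n0: "\<And>n. n \<ge> n0 \<Longrightarrow> \<bar>(\<integral>\<omega>. h (step T m (X n \<omega>)) \<partial>M) - (\<integral>\<omega>. h (step T m (G \<omega>)) \<partial>N)\<bar> < r / 2" by force
    show "\<exists>n0. \<forall>n\<ge>n0. norm ((\<integral>\<omega>. h (X n \<omega>) \<partial>M) - (\<integral>\<omega>. h (G \<omega>) \<partial>N)) < r"
    proof (intro exI[of _ n0] allI impI)
      fix n assume n: "n0 \<le> n"
      have "\<bar>(\<integral>\<omega>. h (X n \<omega>) \<partial>M) - (\<integral>\<omega>. h (step T m (X n \<omega>)) \<partial>M)\<bar> \<le> 2 * K * (1 + 64 * T\<^sup>2) / 2 ^ m"
        by (rule step_expectation_error[OF T X _ _ bdd K Lip hX[OF h]]) (auto intro!: AE_I2 mem pathX)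
      moreover have "\<bar>(\<integral>\<omega>. h (G \<omega>) \<partial>N) - (\<integral>\<omega>. h (step T m (G \<omega>)) \<partial>N)\<bar> \<le> 2 * K * (1 + 64 * T\<^sup>2) / 2 ^ m"
        by (rule step_expectation_error[OF T G _ tight_mean_square_Lipschitz_continuous[OF T G tight] bdd K Lip hG[OF h]])
          (auto intro!: AE_I2 memG)
      ultimately have "\<bar>(\<integral>\<omega>. h (X n \<omega>) \<partial>M) - (\<integral>\<omega>. h (G \<omega>) \<partial>N)\<bar> < r" using n0[OF n] m by linarith
      then show "norm ((\<integral>\<omega>. h (X n \<omega>) \<partial>M) - (\<integral>\<omega>. h (G \<omega>) \<partial>N)) < r" by simp
    qed
  qed
  show ?thesis
    unfolding converges_in_distribution_def
  proof (intro conjI allI impI)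
    show "X n \<in> space M \<rightarrow> mspace ?l" for n using mem by auto
    show "tight_random_element ?l N G" by (rule tight)
    fix h :: "(real \<Rightarrow> real) \<Rightarrow> real"
    assume "continuous_map (mtopology_of ?l) euclideanreal h \<and> bounded (h ` mspace ?l)"
    then have h: "continuous_map (mtopology_of ?l) euclideanreal h" and "bounded (h ` mspace ?l)" by auto
    then obtain B where B: "\<And>x. x \<in> mspace ?l \<Longrightarrow> \<bar>h x\<bar> \<le> B" by (auto simp: bounded_real)
    have "integrable M (\<lambda>\<omega>. h (X n \<omega>))" for n
      by (rule M.integrable_const_bound[where B=B, OF _ hX[OF h]]) (auto intro!: AE_I2 B mem)
    then have "outer_expectation M (\<lambda>\<omega>. h (X n \<omega>)) = (\<integral>\<omega>. h (X n \<omega>) \<partial>M)" for n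
      by (rule outer_expectation_eq_integral)
    moreover have "(\<lambda>n. \<integral>\<omega>. h (X n \<omega>) \<partial>M) \<longlonglongrightarrow> (\<integral>\<omega>. h (G \<omega>) \<partial>N)"
      by (rule weak_convergence_from_Lipschitz[OF M.prob_space_axioms N.prob_space_axioms _ _ hX hG Lipschitz h B])
        (auto intro: mem memG)
    ultimately show "(\<lambda>n. outer_expectation M (\<lambda>\<omega>. h (X n \<omega>))) \<longlonglongrightarrow> (\<integral>\<omega>. h (G \<omega>) \<partial>N)" by simp
  qed
qed


section \<open>The empirical landscape process\<close>

locale landscape_sample = iid_sample M P D
  for M :: "'w measure" and P :: "(real \<times> real \<Rightarrow> enat) measure" and D +
  fixes T :: real
  assumes T: "0 < T" and space_P: "space P = persistence_diagrams T"
    and landscape_measurable: "\<And>t. t \<in> {0..T} \<Longrightarrow> (\<lambda>E. first_landscape E t) \<in> borel_measurable P"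
begin

lemma landscape_abs_le: "E \<in> space P \<Longrightarrow> \<bar>first_landscape E t\<bar> \<le> T / 2"
  using first_landscape_bounds[OF T, of E t] by (simp add: space_P)

lemma landscape_diff_abs_le:
  "E \<in> space P \<Longrightarrow> \<bar>first_landscape E s - first_landscape E t\<bar> \<le> \<bar>s - t\<bar>"
  using first_landscape_Lipschitz[OF T, of E s t] by (simp add: space_P)

lemma landscape_integrable: "t \<in> {0..T} \<Longrightarrow> integrable P (\<lambda>E. first_landscape E t)"
  by (rule bounded_integrable(1)[OF landscape_measurable landscape_abs_le])

lemma landscape_product_integrable:
  assumes "s \<in> {0..T}" "t \<in> {0..T}"
  shows "integrable P (\<lambda>E. first_landscape E s * first_landscape E t)"
proof (rule P.integrable_const_bound[where B="T / 2 * (T / 2)"], rule AE_I2)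
  fix E assume "E \<in> space P"
  then show "norm (first_landscape E s * first_landscape E t) \<le> T / 2 * (T / 2)"
    using landscape_abs_le[of E s] landscape_abs_le[of E t] T
    by (simp only: real_norm_def abs_mult) (intro mult_mono; simp)
qed (intro borel_measurable_times landscape_measurable assms)

lemma landscape_sum_measurable:
  "t ` J \<subseteq> {0..T} \<Longrightarrow> (\<lambda>E. \<Sum>k\<in>J. a k * first_landscape E (t k)) \<in> borel_measurable P"
  by (intro borel_measurable_sum borel_measurable_times landscape_measurable) auto

lemma landscape_sum_abs_le:
  assumes "E \<in> space P"
  shows "\<bar>\<Sum>k\<in>J. a k * first_landscape E (t k)\<bar> \<le> (\<Sum>k\<in>J. \<bar>a k\<bar> * (T / 2))"
proof (intro order_trans[OF sum_abs] sum_mono)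
  fix k show "\<bar>a k * first_landscape E (t k)\<bar> \<le> \<bar>a k\<bar> * (T / 2)"
    unfolding abs_mult by (rule mult_left_mono[OF landscape_abs_le[OF assms] abs_ge_zero])
qed

text \<open>
  Linear combinations of landscape values are functions of the diagram again, so the variance
  of every linear combination of the limit process is a population variance.
\<close>
lemma population_variance_landscape_sum:
  assumes "t ` J \<subseteq> {0..T}"
  shows "population_variance (\<lambda>E. \<Sum>k\<in>J. a k * first_landscape E (t k)) =
    (\<Sum>k\<in>J. \<Sum>l\<in>J. a k * a l * landscape_cov P (t k) (t l))"
  unfolding landscape_cov_def using assms
  by (intro population_variance_sum landscape_integrable landscape_product_integrable) auto

lemma population_variance_landscape_le:
  assumes "t \<in> {0..T}"
  shows "population_variance (\<lambda>E. first_landscape E t) \<le> T\<^sup>2"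
proof -
  have "(\<integral>E. (first_landscape E t)\<^sup>2 \<partial>P) \<le> (\<integral>E. T\<^sup>2 \<partial>P)"
  proof (rule integral_mono)
    show "integrable P (\<lambda>E. (first_landscape E t)\<^sup>2)"
      using landscape_product_integrable[OF assms assms] by (simp add: power2_eq_square)
    show "(first_landscape E t)\<^sup>2 \<le> T\<^sup>2" if "E \<in> space P" for E
      using landscape_abs_le[OF that, of t] T by (intro abs_le_square_iff[THEN iffD1]) linarith
  qed simp
  then have "(\<integral>E. (first_landscape E t)\<^sup>2 \<partial>P) \<le> T\<^sup>2" by (simp add: P.prob_space)
  then show ?thesis
    using population_variance_le[of "\<lambda>E. first_landscape E t"] by linarith
qed

lemma population_variance_landscape_diff_le:
  assumes "s \<in> {0..T}" "t \<in> {0..T}"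
  shows "population_variance (\<lambda>E. first_landscape E s - first_landscape E t) \<le> (s - t)\<^sup>2"
proof -
  have m: "(\<lambda>E. first_landscape E s - first_landscape E t) \<in> borel_measurable P"
    using assms by (intro borel_measurable_diff landscape_measurable)
  have "(\<integral>E. (first_landscape E s - first_landscape E t)\<^sup>2 \<partial>P) \<le> (\<integral>E. (s - t)\<^sup>2 \<partial>P)"
  proof (rule integral_mono)
    show "integrable P (\<lambda>E. (first_landscape E s - first_landscape E t)\<^sup>2)"
      by (rule bounded_integrable(2)[OF m landscape_diff_abs_le])
    show "(first_landscape E s - first_landscape E t)\<^sup>2 \<le> (s - t)\<^sup>2" if "E \<in> space P" for E
      using landscape_diff_abs_le[OF that, of s t] by (rule abs_le_square_iff[THEN iffD1])
  qed simp
  then have "(\<integral>E. (first_landscape E s - first_landscape E t)\<^sup>2 \<partial>P) \<le> (s - t)\<^sup>2"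
    by (simp add: P.prob_space)
  then show ?thesis
    using population_variance_le[of "\<lambda>E. first_landscape E s - first_landscape E t"] by linarith
qed

lemma empirical_process_eq:
  "t \<in> {0..T} \<Longrightarrow> empirical_process T P D n \<omega> t = fluctuation n (\<lambda>E. first_landscape E t) \<omega>"
  by (simp add: empirical_process_def fluctuation_def)

lemma empirical_process_sum:
  assumes "t ` J \<subseteq> {0..T}"
  shows "(\<Sum>k\<in>J. a k * empirical_process T P D n \<omega> (t k)) =
    fluctuation n (\<lambda>E. \<Sum>k\<in>J. a k * first_landscape E (t k)) \<omega>"
proof -
  have "(\<Sum>k\<in>J. a k * empirical_process T P D n \<omega> (t k)) =
      (\<Sum>k\<in>J. a k * fluctuation n (\<lambda>E. first_landscape E (t k)) \<omega>)"
    using assms by (intro sum.cong) (auto simp: empirical_process_eq)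
  also have "\<dots> = fluctuation n (\<lambda>E. \<Sum>k\<in>J. a k * first_landscape E (t k)) \<omega>"
    using assms by (intro fluctuation_sum landscape_integrable) auto
  finally show ?thesis .
qed

lemma empirical_process_diff:
  assumes "s \<in> {0..T}" "t \<in> {0..T}"
  shows "empirical_process T P D n \<omega> s - empirical_process T P D n \<omega> t =
    fluctuation n (\<lambda>E. first_landscape E s - first_landscape E t) \<omega>"
proof -
  have "(\<integral>E. first_landscape E s - first_landscape E t \<partial>P) =
      (\<integral>E. first_landscape E s \<partial>P) - (\<integral>E. first_landscape E t \<partial>P)"
    using assms landscape_integrable by (intro Bochner_Integration.integral_diff) auto
  then show ?thesis
    unfolding empirical_process_eq[OF assms(1)] empirical_process_eq[OF assms(2)] fluctuation_def
    by (simp only:) (simp add: sum_subtractf algebra_simps)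
qed

lemma empirical_process_mean_square_Lipschitz:
  "mean_square_Lipschitz T (T\<^sup>2) M (empirical_process T P D n)"
  unfolding mean_square_Lipschitz_def
proof (intro conjI ballI)
  show "prob_space M" by (rule prob_M)
  fix t assume t: "t \<in> {0..T}"
  note f = landscape_measurable[OF t] landscape_abs_le
  show "(\<lambda>\<omega>. empirical_process T P D n \<omega> t) \<in> borel_measurable M"
    unfolding empirical_process_eq[OF t] by (rule fluctuation_measurable[OF f])
  show "integrable M (\<lambda>\<omega>. (empirical_process T P D n \<omega> t)\<^sup>2)"
    unfolding empirical_process_eq[OF t] by (rule fluctuation_second_moment(1)[OF f])
  show "(\<integral>\<omega>. (empirical_process T P D n \<omega> t)\<^sup>2 \<partial>M) \<le> T\<^sup>2"
    unfolding empirical_process_eq[OF t]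
    by (rule order_trans[OF fluctuation_second_moment(2)[OF f] population_variance_landscape_le[OF t]])
next
  fix s t assume st: "s \<in> {0..T}" "t \<in> {0..T}"
  have m: "(\<lambda>E. first_landscape E s - first_landscape E t) \<in> borel_measurable P"
    using st by (intro borel_measurable_diff landscape_measurable)
  show "(\<integral>\<omega>. (empirical_process T P D n \<omega> s - empirical_process T P D n \<omega> t)\<^sup>2 \<partial>M) \<le> (s - t)\<^sup>2"
    unfolding empirical_process_diff[OF st]
    by (rule order_trans[OF fluctuation_second_moment(2)[OF m landscape_diff_abs_le] population_variance_landscape_diff_le[OF st]])
qed

lemma empirical_process_Lipschitz:
  assumes "\<omega> \<in> space M" "s \<in> {0..T}" "t \<in> {0..T}"
  shows "\<bar>empirical_process T P D n \<omega> s - empirical_process T P D n \<omega> t\<bar> \<le> real n * (2 * \<bar>s - t\<bar>)"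
proof -
  have m: "(\<lambda>E. first_landscape E s - first_landscape E t) \<in> borel_measurable P"
    using assms by (intro borel_measurable_diff landscape_measurable)
  show ?thesis unfolding empirical_process_diff[OF assms(2,3)]
    by (rule fluctuation_abs_le[OF m landscape_diff_abs_le assms(1)])
qed

lemma empirical_process_in_linf:
  assumes "\<omega> \<in> space M"
  shows "empirical_process T P D n \<omega> \<in> mspace (linf {0..T})"
proof -
  have "\<bar>empirical_process T P D n \<omega> t\<bar> \<le> real n * (2 * (T / 2))" if t: "t \<in> {0..T}" for t
    unfolding empirical_process_eq[OF t]
    by (rule fluctuation_abs_le[OF landscape_measurable[OF t] landscape_abs_le assms])
  then have "\<exists>B. \<forall>t\<in>{0..T}. \<bar>empirical_process T P D n \<omega> t\<bar> \<le> B" by blast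
  then show ?thesis by (simp only: mspace_linf_iff) (simp add: empirical_process_def)
qed

lemma empirical_process_step:
  assumes \<omega>: "\<omega> \<in> space M"
  shows "(\<lambda>m. mdist (linf {0..T}) (empirical_process T P D n \<omega>) (step T m (empirical_process T P D n \<omega>))) \<longlonglongrightarrow> 0"
proof (rule tendsto_sandwich[of "\<lambda>_. 0" _ _ "\<lambda>m. real n * (2 * (T / 16 ^ m))"])
  let ?x = "empirical_process T P D n \<omega>"
  have "mdist (linf {0..T}) ?x (step T m ?x) \<le> real n * (2 * (T / 16 ^ m))" for m
  proof (subst linf_dist_le_iff[OF empirical_process_in_linf[OF \<omega>] step_in_linf[OF T]])
    show "\<forall>t\<in>{0..T}. \<bar>?x t - step T m ?x t\<bar> \<le> real n * (2 * (T / 16 ^ m))"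
    proof
      fix t assume t: "t \<in> {0..T}"
      have "\<bar>t - grid T m (cell T m t)\<bar> \<le> T / 16 ^ m" using cell_bounds[OF T t, of m] by linarith
      then have "real n * (2 * \<bar>t - grid T m (cell T m t)\<bar>) \<le> real n * (2 * (T / 16 ^ m))"
        by (intro mult_left_mono) auto
      with empirical_process_Lipschitz[OF \<omega> t grid_mem[OF T cell_le[OF T t]], of n m]
      show "\<bar>?x t - step T m ?x t\<bar> \<le> real n * (2 * (T / 16 ^ m))"
        unfolding step_apply[OF t] by linarith
    qed
  qed (use T in auto)
  then show "\<forall>\<^sub>F m in sequentially. mdist (linf {0..T}) ?x (step T m ?x) \<le> real n * (2 * (T / 16 ^ m))"
    by simp
  show "(\<lambda>m. real n * (2 * (T / 16 ^ m))) \<longlonglongrightarrow> 0" by real_asymp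
qed auto

lemma empirical_process_cos:
  assumes "t ` J \<subseteq> {0..T}"
  shows "(\<lambda>n. \<integral>\<omega>. cos ((\<Sum>k\<in>J. a k * empirical_process T P D n \<omega> (t k)) + b) \<partial>M) \<longlonglongrightarrow>
    exp (- population_variance (\<lambda>E. \<Sum>k\<in>J. a k * first_landscape E (t k)) / 2) * cos b"
  unfolding empirical_process_sum[OF assms]
  by (rule fluctuation_cos[OF landscape_sum_measurable[OF assms] landscape_sum_abs_le])

text \<open>
  A Gaussian variable is determined by its mean and second moment, and the covariance of the
  bridge turns the latter into a population variance. Integrability of the products, on which
  the expansion of the second moment depends, follows from Gaussianity of the single
  coordinates.
\<close>
lemma brownian_bridge_centred_gaussian:
  assumes bridge: "brownian_bridge T P N G" and J: "finite J" "J \<subseteq> {0..T}"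
  shows "centred_gaussian N (population_variance (\<lambda>E. \<Sum>t\<in>J. a t * first_landscape E t)) (\<lambda>\<omega>. \<Sum>t\<in>J. a t * G \<omega> t)"
proof -
  have N: "prob_space N" and gv: "gaussian_variable N (\<lambda>\<omega>. \<Sum>t\<in>J. a t * G \<omega> t)"
    if "finite J" "J \<subseteq> {0..T}" for J a
    using bridge that by (auto simp: brownian_bridge_def gaussian_process_def)
  interpret N: prob_space N using N[OF J] .
  have gt: "gaussian_variable N (\<lambda>\<omega>. G \<omega> t)" if "t \<in> {0..T}" for t
    using gv[of "{t}" "\<lambda>_. 1"] that by simp
  have meas[measurable]: "(\<lambda>\<omega>. G \<omega> t) \<in> borel_measurable N" if "t \<in> {0..T}" for t
    using gt[OF that] by (simp add: gaussian_variable_def)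
  have sq: "integrable N (\<lambda>\<omega>. (G \<omega> t)\<^sup>2)" if "t \<in> {0..T}" for t
    by (rule gaussian_variable_square_integrable[OF N[OF J] gt[OF that]])
  have int: "integrable N (\<lambda>\<omega>. G \<omega> t)" if "t \<in> {0..T}" for t
    by (rule N.square_integrable_imp_integrable[OF meas[OF that] sq[OF that]])
  have prod: "integrable N (\<lambda>\<omega>. G \<omega> s * G \<omega> t)" if "s \<in> {0..T}" "t \<in> {0..T}" for s t
  proof (rule Bochner_Integration.integrable_bound)
    show "integrable N (\<lambda>\<omega>. (G \<omega> s)\<^sup>2 + (G \<omega> t)\<^sup>2)" using sq that by simp
    have "\<bar>x * y\<bar> \<le> x\<^sup>2 + y\<^sup>2" for x y :: real
    proof -
      have "2 * (\<bar>x\<bar> * \<bar>y\<bar>) \<le> x\<^sup>2 + y\<^sup>2" using sum_squares_bound[of "\<bar>x\<bar>" "\<bar>y\<bar>"] by simp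
      moreover have "0 \<le> \<bar>x\<bar> * \<bar>y\<bar>" by simp
      ultimately show ?thesis unfolding abs_mult by linarith
    qed
    then show "AE \<omega> in N. norm (G \<omega> s * G \<omega> t) \<le> norm ((G \<omega> s)\<^sup>2 + (G \<omega> t)\<^sup>2)"
      by (intro AE_I2) simp
    show "(\<lambda>\<omega>. G \<omega> s * G \<omega> t) \<in> borel_measurable N" using that by measurable
  qed
  have mean: "(\<integral>\<omega>. G \<omega> t \<partial>N) = 0" if "t \<in> {0..T}" for t
    using bridge that by (simp add: brownian_bridge_def)
  have cov: "(\<integral>\<omega>. G \<omega> s * G \<omega> t \<partial>N) = landscape_cov P s t" if "s \<in> {0..T}" "t \<in> {0..T}" for s t
    using bridge that by (simp add: brownian_bridge_def)
  have JT: "t \<in> {0..T}" if "t \<in> J" for t using J that by auto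
  show ?thesis
  proof (rule gaussian_variable_imp_centred_gaussian[OF N[OF J] gv[OF J]])
    have "(\<integral>\<omega>. (\<Sum>t\<in>J. a t * G \<omega> t) \<partial>N) = (\<Sum>t\<in>J. a t * (\<integral>\<omega>. G \<omega> t \<partial>N))"
      using int JT by (subst Bochner_Integration.integral_sum) auto
    then show "(\<integral>\<omega>. (\<Sum>t\<in>J. a t * G \<omega> t) \<partial>N) = 0" using mean JT by simp
    have eq: "(\<Sum>t\<in>J. a t * G \<omega> t)\<^sup>2 = (\<Sum>s\<in>J. \<Sum>t\<in>J. a s * a t * (G \<omega> s * G \<omega> t))" for \<omega>
      unfolding power2_eq_square sum_product by (intro sum.cong refl) (simp add: mult_ac)
    have "(\<integral>\<omega>. (\<Sum>t\<in>J. a t * G \<omega> t)\<^sup>2 \<partial>N) = (\<Sum>s\<in>J. \<Sum>t\<in>J. a s * a t * (\<integral>\<omega>. G \<omega> s * G \<omega> t \<partial>N))"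
      unfolding eq using prod JT by (simp add: Bochner_Integration.integral_sum)
    also have "\<dots> = (\<Sum>s\<in>J. \<Sum>t\<in>J. a s * a t * landscape_cov P s t)"
      using cov JT by (intro sum.cong refl) auto
    also have "\<dots> = population_variance (\<lambda>E. \<Sum>t\<in>J. a t * first_landscape E t)"
      using population_variance_landscape_sum[of "\<lambda>t. t" J a] J by simp
    finally show "(\<integral>\<omega>. (\<Sum>t\<in>J. a t * G \<omega> t)\<^sup>2 \<partial>N) = population_variance (\<lambda>E. \<Sum>t\<in>J. a t * first_landscape E t)" .
  qed
qed

lemma brownian_bridge_mean_square_Lipschitz:
  assumes bridge: "brownian_bridge T P N G"
  shows "mean_square_Lipschitz T (T\<^sup>2) N G"
  unfolding mean_square_Lipschitz_def
proof (intro conjI ballI)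
  show "prob_space N" using bridge by (simp add: brownian_bridge_def gaussian_process_def)
  fix t assume t: "t \<in> {0..T}"
  have cg: "centred_gaussian N (population_variance (\<lambda>E. first_landscape E t)) (\<lambda>\<omega>. G \<omega> t)"
    using brownian_bridge_centred_gaussian[OF bridge, of "{t}" "\<lambda>_. 1"] t by simp
  show "(\<lambda>\<omega>. G \<omega> t) \<in> borel_measurable N" using cg by (simp add: centred_gaussian_def)
  show "integrable N (\<lambda>\<omega>. (G \<omega> t)\<^sup>2)" by (rule centred_gaussianD(3)[OF cg])
  show "(\<integral>\<omega>. (G \<omega> t)\<^sup>2 \<partial>N) \<le> T\<^sup>2"
    using centred_gaussianD(4)[OF cg] population_variance_landscape_le[OF t] by simp
next
  fix s t assume st: "s \<in> {0..T}" "t \<in> {0..T}"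
  show "(\<integral>\<omega>. (G \<omega> s - G \<omega> t)\<^sup>2 \<partial>N) \<le> (s - t)\<^sup>2"
  proof (cases "s = t")
    case False
    have "centred_gaussian N (population_variance (\<lambda>E. first_landscape E s - first_landscape E t)) (\<lambda>\<omega>. G \<omega> s - G \<omega> t)"
      using brownian_bridge_centred_gaussian[OF bridge, of "{s, t}" "\<lambda>u. if u = s then 1 else - 1"] st False
      by simp
    from centred_gaussianD(4)[OF this] population_variance_landscape_diff_le[OF st] show ?thesis by simp
  qed simp
qed

lemma brownian_bridge_cos:
  assumes bridge: "brownian_bridge T P N G"
  shows "(\<integral>\<omega>. cos ((\<Sum>k\<le>16 ^ m. a k * G \<omega> (grid T m k)) + b) \<partial>N) =
    exp (- population_variance (\<lambda>E. \<Sum>k\<le>16 ^ m. a k * first_landscape E (grid T m k)) / 2) * cos b"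
proof -
  have inj: "inj_on (grid T m) {..16 ^ m}" using T by (auto simp: grid_def inj_on_def)
  let ?J = "grid T m ` {..16 ^ m}"
  let ?a = "\<lambda>t. a (inv_into {..16 ^ m} (grid T m) t)"
  have re: "(\<Sum>t\<in>?J. ?a t * f t) = (\<Sum>k\<le>16 ^ m. a k * f (grid T m k))" for f :: "real \<Rightarrow> real"
    by (subst sum.reindex[OF inj]) (auto intro!: sum.cong simp: inv_into_f_f[OF inj])
  have "?J \<subseteq> {0..T}" using grid_mem[OF T] by blast
  from brownian_bridge_centred_gaussian[OF bridge _ this, of ?a]
  have "centred_gaussian N (population_variance (\<lambda>E. \<Sum>k\<le>16 ^ m. a k * first_landscape E (grid T m k)))
      (\<lambda>\<omega>. \<Sum>k\<le>16 ^ m. a k * G \<omega> (grid T m k))"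
    unfolding re by simp
  from centred_gaussianD(5)[OF this] show ?thesis .
qed

theorem empirical_process_converges:
  assumes bridge: "brownian_bridge T P N G" and tight: "tight_random_element (linf {0..T}) N G"
  shows "converges_in_distribution (linf {0..T}) M (empirical_process T P D) N G"
proof (rule weak_convergence_criterion[OF T empirical_process_mean_square_Lipschitz
      brownian_bridge_mean_square_Lipschitz[OF bridge] tight empirical_process_in_linf empirical_process_step])
  fix m a b
  have "grid T m ` {..16 ^ m} \<subseteq> {0..T}" using grid_mem[OF T] by blast
  from empirical_process_cos[OF this]
  show "(\<lambda>n. \<integral>\<omega>. cos ((\<Sum>k\<le>16 ^ m. a k * empirical_process T P D n \<omega> (grid T m k)) + b) \<partial>M) \<longlonglongrightarrow>
      (\<integral>\<omega>. cos ((\<Sum>k\<le>16 ^ m. a k * G \<omega> (grid T m k)) + b) \<partial>N)"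
    unfolding brownian_bridge_cos[OF bridge] .
qed

end


section \<open>Gaussian sequences with a prescribed covariance\<close>

definition kernel_form :: "(nat \<Rightarrow> nat \<Rightarrow> real) \<Rightarrow> nat \<Rightarrow> (nat \<Rightarrow> real) \<Rightarrow> (nat \<Rightarrow> real) \<Rightarrow> real" where
  "kernel_form K n a b = (\<Sum>i<n. \<Sum>j<n. a i * b j * K i j)"

locale psd_kernel =
  fixes K :: "nat \<Rightarrow> nat \<Rightarrow> real"
  assumes sym: "K i j = K j i"
    and psd: "0 \<le> kernel_form K n a a"
begin

lemma kernel_form_add: "kernel_form K n (\<lambda>i. a i + t * b i) c = kernel_form K n a c + t * kernel_form K n b c"
  by (simp add: kernel_form_def distrib_right sum.distrib sum_distrib_left mult.assoc)

lemma kernel_form_commute: "kernel_form K n a b = kernel_form K n b a"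
proof -
  have "kernel_form K n a b = (\<Sum>j<n. \<Sum>i<n. a i * b j * K i j)" unfolding kernel_form_def by (rule sum.swap)
  also have "\<dots> = kernel_form K n b a"
    unfolding kernel_form_def by (intro sum.cong refl) (simp add: sym[of _ "_"] mult_ac)
  finally show ?thesis .
qed

text \<open>
  The Cauchy-Schwarz inequality in the degenerate case: otherwise the quadratic form would
  take negative values along the line \<open>a + t * r\<close>.
\<close>
lemma kernel_form_null:
  assumes "kernel_form K n r r = 0"
  shows "kernel_form K n a r = 0"
proof (rule ccontr)
  assume nz: "kernel_form K n a r \<noteq> 0"
  define A where "A = kernel_form K n a a"
  define B where "B = kernel_form K n a r"
  \<comment> \<open>The multiple of \<open>r\<close> for which the quadratic form takes the value \<open>- 1\<close>.\<close>
  define t where "t = - (A + 1) / (2 * B)"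
  have "0 \<le> kernel_form K n (\<lambda>i. a i + t * r i) (\<lambda>i. a i + t * r i)" by (rule psd)
  also have "\<dots> = A + 2 * t * B"
    unfolding kernel_form_add kernel_form_commute[of n _ "\<lambda>i. a i + t * r i"] 
    using assms by (simp add: A_def B_def kernel_form_commute[of n r a])
  also have "\<dots> = - 1" using nz by (simp add: t_def B_def field_simps)
  finally show False by simp
qed

lemma kernel_form_diff: "kernel_form K n (\<lambda>i. a i - b i) c = kernel_form K n a c - kernel_form K n b c"
  using kernel_form_add[of n a "-1" b c] by simp

lemma kernel_form_unit: "j < n \<Longrightarrow> kernel_form K n a (\<lambda>i. if i = j then 1 else 0) = (\<Sum>i<n. a i * K i j)"
  unfolding kernel_form_def
proof (rule sum.cong[OF refl])
  fix i assume "j < n"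
  have "(\<Sum>k<n. a i * (if k = j then 1 else 0) * K i k) = (\<Sum>k<n. if k = j then a i * K i k else 0)"
    by (rule sum.cong) auto
  then show "(\<Sum>k<n. a i * (if k = j then 1 else 0) * K i k) = a i * K i j" using \<open>j < n\<close> by simp
qed

text \<open>
  Orthogonal projection onto the span of the first \<open>j\<close> unit vectors with respect to a possibly
  degenerate form, one dimension at a time: the residual \<open>r\<close> of the next unit vector is
  orthogonal to the earlier ones, and subtracting a multiple of it restores orthogonality. If
  \<open>r\<close> has length 0, then it is orthogonal to everything already, and the convention
  \<open>x / 0 = 0\<close> gives the correct coefficient.
\<close>
lemma kernel_projection:
  assumes "j \<le> n"
  shows "\<exists>c. (\<forall>k\<ge>j. c k = 0) \<and> (\<forall>i<j. kernel_form K n (\<lambda>k. a k - c k) (\<lambda>k. if k = i then 1 else 0) = 0)"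
  using assms
proof (induction j arbitrary: a)
  case 0
  show ?case by (intro exI[of _ "\<lambda>_. 0"]) simp
next
  case (Suc j)
  let ?u = "\<lambda>i k :: nat. if k = i then 1 else (0::real)"
  from Suc.IH[of a] Suc.prems obtain c where c: "\<And>k. k \<ge> j \<Longrightarrow> c k = 0"
    "\<And>i. i < j \<Longrightarrow> kernel_form K n (\<lambda>k. a k - c k) (?u i) = 0" by auto
  from Suc.IH[of "?u j"] Suc.prems obtain d where d: "\<And>k. k \<ge> j \<Longrightarrow> d k = 0"
    "\<And>i. i < j \<Longrightarrow> kernel_form K n (\<lambda>k. ?u j k - d k) (?u i) = 0" by auto
  define r where "r k = ?u j k - d k" for k
  define y where "y k = a k - c k" for k
  define t where "t = kernel_form K n y r / kernel_form K n r r"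
  define c' where "c' k = c k + t * r k" for k
  have y': "(\<lambda>k. a k - c' k) = (\<lambda>k. y k + (- t) * r k)" by (auto simp: c'_def y_def)
  have orth: "kernel_form K n (\<lambda>k. a k - c' k) (?u i) = 0" if "i < j" for i
    unfolding y' kernel_form_add using c(2)[OF that] d(2)[OF that] by (simp add: y_def[abs_def] r_def[abs_def])
  have orth_r: "kernel_form K n (\<lambda>k. a k - c' k) r = 0"
  proof (cases "kernel_form K n r r = 0")
    case True
    then show ?thesis by (rule kernel_form_null)
  next
    case False
    then show ?thesis unfolding y' kernel_form_add by (simp add: t_def)
  qed
  have exp_d: "kernel_form K n b d = (\<Sum>i<j. d i * kernel_form K n b (?u i))" for b
  proof -
    have "kernel_form K n b d = (\<Sum>i<n. d i * (\<Sum>k<n. b k * K k i))"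
      unfolding kernel_form_def by (subst sum.swap) (simp add: sum_distrib_left mult_ac)
    also have "\<dots> = (\<Sum>i<j. d i * (\<Sum>k<n. b k * K k i))"
      using d(1) Suc.prems by (intro sum.mono_neutral_right) auto
    also have "\<dots> = (\<Sum>i<j. d i * kernel_form K n b (?u i))"
      using Suc.prems by (intro sum.cong refl) (simp add: kernel_form_unit)
    finally show ?thesis .
  qed
  have "kernel_form K n (\<lambda>k. a k - c' k) (?u j) = kernel_form K n (\<lambda>k. a k - c' k) r + kernel_form K n (\<lambda>k. a k - c' k) d"
  proof -
    have "?u j = (\<lambda>k. r k + 1 * d k)" by (auto simp: r_def)
    then have "kernel_form K n (?u j) z = kernel_form K n r z + kernel_form K n d z" for z
      using kernel_form_add[of n r 1 d z] by simp
    then show ?thesis by (simp only: kernel_form_commute[of n "\<lambda>k. a k - c' k"])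
  qed
  also have "kernel_form K n (\<lambda>k. a k - c' k) d = 0" unfolding exp_d using orth by simp
  finally have orth_j: "kernel_form K n (\<lambda>k. a k - c' k) (?u j) = 0" using orth_r by simp
  show ?case
  proof (intro exI[of _ c'] conjI allI impI)
    fix k assume "Suc j \<le> k" then show "c' k = 0" using c(1)[of k] d(1)[of k] by (simp add: c'_def r_def)
  next
    fix i assume "i < Suc j" then show "kernel_form K n (\<lambda>k. a k - c' k) (?u i) = 0"
      using orth orth_j by (cases "i = j") auto
  qed
qed

text \<open>
  The coefficients of the best linear prediction of the variable \<open>j\<close> from its predecessors,
  and the nonnegativity of the residual variance.
\<close>
lemma kernel_regression:
  "\<exists>c. (\<forall>i<j. K j i = (\<Sum>k<j. c k * K k i)) \<and> 0 \<le> K j j - (\<Sum>k<j. c k * K k j)"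
proof -
  let ?u = "\<lambda>i k :: nat. if k = i then 1 else (0::real)"
  from kernel_projection[of j "Suc j" "?u j"] obtain c where c: "\<And>k. k \<ge> j \<Longrightarrow> c k = 0"
    "\<And>i. i < j \<Longrightarrow> kernel_form K (Suc j) (\<lambda>k. ?u j k - c k) (?u i) = 0" by auto
  have row: "kernel_form K (Suc j) (\<lambda>k. ?u j k - c k) (?u i) = K j i - (\<Sum>k<j. c k * K k i)" if "i < Suc j" for i
  proof -
    have "(\<Sum>k<Suc j. (?u j k - c k) * K k i) = (\<Sum>k<j. - (c k * K k i)) + K j i"
    proof -
      have "(\<Sum>k<j. (?u j k - c k) * K k i) = (\<Sum>k<j. - (c k * K k i))"
        by (intro sum.cong refl) auto
      then show ?thesis using c(1)[of j] by simp
    qed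
    then show ?thesis using that by (simp only: kernel_form_unit sum_negf)
  qed
  have exp_c: "kernel_form K (Suc j) b c = (\<Sum>i<j. c i * kernel_form K (Suc j) b (?u i))" for b
  proof -
    have "kernel_form K (Suc j) b c = (\<Sum>i<Suc j. c i * (\<Sum>k<Suc j. b k * K k i))"
      unfolding kernel_form_def by (subst sum.swap) (simp only: sum_distrib_left mult_ac)
    also have "\<dots> = (\<Sum>i<j. c i * (\<Sum>k<Suc j. b k * K k i))" using c(1)[of j] by simp
    also have "\<dots> = (\<Sum>i<j. c i * kernel_form K (Suc j) b (?u i))"
      by (intro sum.cong refl) (simp only: kernel_form_unit less_SucI lessThan_iff)
    finally show ?thesis .
  qed
  have "0 \<le> kernel_form K (Suc j) (\<lambda>k. ?u j k - c k) (\<lambda>k. ?u j k - c k)" by (rule psd)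
  also have "\<dots> = kernel_form K (Suc j) (\<lambda>k. ?u j k - c k) (?u j) - kernel_form K (Suc j) (\<lambda>k. ?u j k - c k) c"
    by (subst kernel_form_commute, subst kernel_form_diff) (simp only: kernel_form_commute)
  also have "kernel_form K (Suc j) (\<lambda>k. ?u j k - c k) c = 0" unfolding exp_c using c(2) by simp
  finally have "0 \<le> K j j - (\<Sum>k<j. c k * K k j)" using row[of j] by simp
  moreover have "K j i = (\<Sum>k<j. c k * K k i)" if "i < j" for i using row[of i] c(2)[OF that] that by simp
  ultimately show ?thesis by blast
qed

end

text \<open>
  The coordinates of a sequence of vectors of which each is the combination of its
  predecessors with coefficients \<open>c\<close>, plus a new orthogonal direction with length \<open>s\<close>.
\<close>
fun autoregression :: "(nat \<Rightarrow> nat \<Rightarrow> real) \<Rightarrow> (nat \<Rightarrow> real) \<Rightarrow> nat \<Rightarrow> nat \<Rightarrow> real" where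
  "autoregression c s j l = (\<Sum>k<j. c j k * autoregression c s k l) + (if l = j then s j else 0)"

declare autoregression.simps[simp del]

lemma autoregression_above: "j < l \<Longrightarrow> autoregression c s j l = 0"
proof (induction j rule: less_induct)
  case (less j)
  then have "(\<Sum>k<j. c j k * autoregression c s k l) = 0" by (intro sum.neutral) auto
  then show ?case using less.prems by (subst autoregression.simps) simp
qed

text \<open>
  An infinite Cholesky factorization. Regressing each variable on its predecessors also
  handles singular kernels, where the new direction gets length 0.
\<close>
theorem (in psd_kernel) kernel_factorization:
  obtains A :: "nat \<Rightarrow> nat \<Rightarrow> real" where "\<And>j l. j < l \<Longrightarrow> A j l = 0"
    "\<And>i j n. i < n \<Longrightarrow> j < n \<Longrightarrow> (\<Sum>l<n. A i l * A j l) = K i j"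
proof -
  obtain c where c: "\<And>j i. i < j \<Longrightarrow> K j i = (\<Sum>k<j. c j k * K k i)"
    "\<And>j. 0 \<le> K j j - (\<Sum>k<j. c j k * K k j)" using kernel_regression by metis
  define s where "s j = sqrt (K j j - (\<Sum>k<j. c j k * K k j))" for j
  let ?A = "autoregression c s"
  have *: "i \<le> j \<Longrightarrow> j < n \<Longrightarrow> (\<Sum>l<n. ?A j l * ?A i l) = K j i" for i j n
  proof (induction j arbitrary: i rule: less_induct)
    case (less j)
    have IH: "(\<Sum>l<n. ?A k l * ?A i l) = K k i" if "k < j" "i < j" for k i
      using less.IH[of k i] less.IH[of i k] that less.prems sym[of i k]
      by (cases "i \<le> k") (auto simp: mult.commute)
    have rec: "(\<Sum>l<n. ?A j l * ?A i l) = (\<Sum>k<j. c j k * (\<Sum>l<n. ?A k l * ?A i l)) + s j * ?A i j" for i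
    proof -
      have "(\<Sum>l<n. ?A j l * ?A i l) = (\<Sum>l<n. (\<Sum>k<j. c j k * (?A k l * ?A i l)) + (if l = j then s j * ?A i l else 0))"
        by (subst (1) autoregression.simps) (auto intro!: sum.cong simp: distrib_right sum_distrib_right mult.assoc)
      also have "\<dots> = (\<Sum>l<n. \<Sum>k<j. c j k * (?A k l * ?A i l)) + s j * ?A i j"
        using less.prems by (simp add: sum.distrib)
      also have "(\<Sum>l<n. \<Sum>k<j. c j k * (?A k l * ?A i l)) = (\<Sum>k<j. c j k * (\<Sum>l<n. ?A k l * ?A i l))"
        by (subst sum.swap) (simp add: sum_distrib_left)
      finally show ?thesis .
    qed
    have below: "(\<Sum>l<n. ?A j l * ?A i l) = K j i" if "i < j" for i
      unfolding rec using that c(1)[OF that] IH by (simp add: autoregression_above)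
    show ?case
    proof (cases "i = j")
      case False
      then show ?thesis using below less.prems by simp
    next
      case True
      have "?A j j = s j" by (subst autoregression.simps) (simp add: autoregression_above)
      moreover have "(\<Sum>l<n. ?A k l * ?A j l) = K k j" if "k < j" for k
        using below[OF that] sym[of k j] by (simp add: mult.commute)
      ultimately have "(\<Sum>l<n. ?A j l * ?A j l) = (\<Sum>k<j. c j k * K k j) + s j * s j" by (simp add: rec)
      also have "s j * s j = K j j - (\<Sum>k<j. c j k * K k j)" using c(2)[of j] by (simp add: s_def)
      finally show ?thesis using True by simp
    qed
  qed
  show ?thesis
  proof (rule that[OF autoregression_above])
    fix i j n :: nat assume "i < n" "j < n"
    then show "(\<Sum>l<n. ?A i l * ?A j l) = K i j"
      using *[of i j n] *[of j i n] sym[of i j] by (cases "i \<le> j") (auto simp: mult.commute)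
  qed
qed

text \<open>
  Independent standard normal variables. They are indexed by the reals, of which the natural
  numbers are used, so that a single product space of functions \<open>real \<Rightarrow> real\<close> serves as the
  probability space of the bridge.
\<close>
abbreviation white_noise :: "(real \<Rightarrow> real) measure" where
  "white_noise \<equiv> PiM UNIV (\<lambda>_. std_normal_distribution)"

lemma white_noise_prob_space: "prob_space white_noise"
  by (rule prob_space_PiM) (rule std_normal_prob_space)

text \<open>
  Characteristic functions of independent summands multiply.
\<close>
lemma white_noise_sum:
  assumes R: "finite R"
  shows "centred_gaussian white_noise (\<Sum>r\<in>R. (c r)\<^sup>2) (\<lambda>\<omega>. \<Sum>r\<in>R. c r * \<omega> r)"
proof -
  interpret product_prob_space "\<lambda>_::real. std_normal_distribution" UNIV
    by (intro product_prob_spaceI std_normal_prob_space)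
  have comp: "distr white_noise std_normal_distribution (\<lambda>\<omega>. \<omega> r) = std_normal_distribution" for r
    by (rule PiM_component) simp
  have rv: "(\<lambda>\<omega>. \<omega> r) \<in> measurable white_noise std_normal_distribution" for r
    by (rule measurable_component_singleton) simp
  have "P.indep_vars (\<lambda>_. std_normal_distribution) (\<lambda>r \<omega>. \<omega> r) UNIV"
  proof (subst P.indep_vars_iff_distr_eq_PiM[OF _ rv])
    have "distr white_noise white_noise (\<lambda>x. \<lambda>i\<in>UNIV. x i) = distr white_noise white_noise (\<lambda>x. x)"
      by (rule distr_cong) auto
    also have "\<dots> = white_noise" by (rule distr_id2) simp
    finally show "distr white_noise white_noise (\<lambda>x. \<lambda>i\<in>UNIV. x i) =
        Pi\<^sub>M UNIV (\<lambda>r. distr white_noise std_normal_distribution (\<lambda>\<omega>. \<omega> r))"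
      unfolding comp .
  qed simp
  then have "P.indep_vars (\<lambda>_. std_normal_distribution) (\<lambda>r \<omega>. \<omega> r) R" by (rule P.indep_vars_subset) simp
  then have ind: "P.indep_vars (\<lambda>_. borel) (\<lambda>r \<omega>. c r * \<omega> r) R"
    by (rule P.indep_vars_compose2[where Y="\<lambda>r x. c r * x"]) simp
  have m: "(\<lambda>\<omega>. c r * \<omega> r) \<in> borel_measurable white_noise" for r
    by (rule measurable_compose[OF rv]) simp
  have ch: "char (distr white_noise borel (\<lambda>\<omega>. c r * \<omega> r)) u = complex_of_real (exp (- ((c r)\<^sup>2 * u\<^sup>2) / 2))" for r u
  proof -
    have "char (distr white_noise borel (\<lambda>\<omega>. c r * \<omega> r)) u = (CLINT \<omega>|white_noise. iexp (u * (c r * \<omega> r)))"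
      unfolding char_def by (subst integral_distr[OF m]) auto
    also have "\<dots> = (CLINT x|distr white_noise std_normal_distribution (\<lambda>\<omega>. \<omega> r). iexp (u * (c r * x)))"
      by (subst integral_distr[OF rv]) auto
    also have "\<dots> = char std_normal_distribution (u * c r)" unfolding comp by (simp add: char_def mult.assoc)
    finally show ?thesis by (simp add: char_std_normal_distribution power_mult_distrib mult.commute)
  qed
  show ?thesis
  proof (rule centred_gaussian_if_char[OF white_noise_prob_space])
    show "(\<lambda>\<omega>. \<Sum>r\<in>R. c r * \<omega> r) \<in> borel_measurable white_noise" by (intro borel_measurable_sum m)
    show "0 \<le> (\<Sum>r\<in>R. (c r)\<^sup>2)" by (simp add: sum_nonneg)
    fix u
    have "char (distr white_noise borel (\<lambda>\<omega>. \<Sum>r\<in>R. c r * \<omega> r)) u =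
        (\<Prod>r\<in>R. complex_of_real (exp (- ((c r)\<^sup>2 * u\<^sup>2) / 2)))"
      by (subst P.char_distr_sum[OF ind]) (simp only: ch)
    also have "\<dots> = complex_of_real (exp (\<Sum>r\<in>R. - ((c r)\<^sup>2 * u\<^sup>2) / 2))"
      using R by (simp only: exp_sum of_real_prod)
    also have "(\<Sum>r\<in>R. - ((c r)\<^sup>2 * u\<^sup>2) / 2) = - ((\<Sum>r\<in>R. (c r)\<^sup>2) * u\<^sup>2) / 2"
      by (simp add: sum_divide_distrib sum_distrib_right sum_negf)
    finally show "char (distr white_noise borel (\<lambda>\<omega>. \<Sum>r\<in>R. c r * \<omega> r)) u =
        complex_of_real (exp (- ((\<Sum>r\<in>R. (c r)\<^sup>2) * u\<^sup>2) / 2))" .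
  qed
qed

lemma white_noise_nat_sum:
  "centred_gaussian white_noise (\<Sum>l<n. (b l)\<^sup>2) (\<lambda>\<omega>. \<Sum>l<n. b l * \<omega> (real l))"
proof -
  have inj: "inj_on real {..<n}" by (simp add: inj_on_def)
  have "centred_gaussian white_noise (\<Sum>r\<in>real ` {..<n}. (b (nat \<lfloor>r\<rfloor>))\<^sup>2)
      (\<lambda>\<omega>. \<Sum>r\<in>real ` {..<n}. b (nat \<lfloor>r\<rfloor>) * \<omega> r)"
    by (rule white_noise_sum) simp
  then show ?thesis by (simp add: sum.reindex[OF inj])
qed

theorem (in psd_kernel) gaussian_sequence:
  obtains \<eta> :: "nat \<Rightarrow> (real \<Rightarrow> real) \<Rightarrow> real" where
    "\<And>J a. finite J \<Longrightarrow> centred_gaussian white_noise (\<Sum>i\<in>J. \<Sum>j\<in>J. a i * a j * K i j) (\<lambda>\<omega>. \<Sum>j\<in>J. a j * \<eta> j \<omega>)"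
proof -
  obtain A where A0: "\<And>j l. j < l \<Longrightarrow> A j l = 0"
    and A: "\<And>i j n. i < n \<Longrightarrow> j < n \<Longrightarrow> (\<Sum>l<n. A i l * A j l) = K i j"
    using kernel_factorization by metis
  define \<eta> where "\<eta> j \<omega> = (\<Sum>l<Suc j. A j l * \<omega> (real l))" for j \<omega>
  show ?thesis
  proof (rule that)
    fix J :: "nat set" and a assume J: "finite J"
    obtain n where n: "\<And>j. j \<in> J \<Longrightarrow> j < n" using J finite_nat_set_iff_bounded by auto
    have \<eta>: "\<eta> j \<omega> = (\<Sum>l<n. A j l * \<omega> (real l))" if "j \<in> J" for j \<omega>
      unfolding \<eta>_def using n[OF that] A0 by (intro sum.mono_neutral_left) auto
    have 1: "(\<Sum>j\<in>J. a j * \<eta> j \<omega>) = (\<Sum>l<n. (\<Sum>j\<in>J. a j * A j l) * \<omega> (real l))" for \<omega>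
    proof -
      have "(\<Sum>j\<in>J. a j * \<eta> j \<omega>) = (\<Sum>j\<in>J. \<Sum>l<n. a j * A j l * \<omega> (real l))"
        by (simp add: \<eta> sum_distrib_left mult.assoc)
      also have "\<dots> = (\<Sum>l<n. (\<Sum>j\<in>J. a j * A j l) * \<omega> (real l))"
        by (subst sum.swap) (simp add: sum_distrib_right)
      finally show ?thesis .
    qed
    have "(\<Sum>l<n. (\<Sum>j\<in>J. a j * A j l)\<^sup>2) = (\<Sum>l<n. \<Sum>i\<in>J. \<Sum>j\<in>J. a i * a j * (A i l * A j l))"
      unfolding power2_eq_square sum_product by (intro sum.cong refl) (simp add: mult_ac)
    also have "\<dots> = (\<Sum>i\<in>J. \<Sum>j\<in>J. \<Sum>l<n. a i * a j * (A i l * A j l))"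
      by (subst sum.swap) (intro sum.cong refl sum.swap)
    also have "\<dots> = (\<Sum>i\<in>J. \<Sum>j\<in>J. a i * a j * K i j)"
      using n A by (intro sum.cong refl) (simp flip: sum_distrib_left)
    finally have 2: "(\<Sum>l<n. (\<Sum>j\<in>J. a j * A j l)\<^sup>2) = (\<Sum>i\<in>J. \<Sum>j\<in>J. a i * a j * K i j)" .
    show "centred_gaussian white_noise (\<Sum>i\<in>J. \<Sum>j\<in>J. a i * a j * K i j) (\<lambda>\<omega>. \<Sum>j\<in>J. a j * \<eta> j \<omega>)"
      using white_noise_nat_sum[of "\<lambda>l. \<Sum>j\<in>J. a j * A j l" n] unfolding 1 2 .
  qed
qed


section \<open>Existence of a tight Brownian bridge\<close>

text \<open>
  Setting paths of infinite energy to 0 makes every extension, and not just almost every one,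
  bounded and uniformly approximable by its step functions; measurability of functionals needs
  this on the whole sample space.
\<close>
definition path_extension :: "real \<Rightarrow> (real \<Rightarrow> real) \<Rightarrow> real \<Rightarrow> real" where
  "path_extension T x = (\<lambda>t\<in>{0..T}.
     if energy T x < \<infinity> then lim (\<lambda>m. x (grid T m (cell T m t))) else 0)"

lemma finite_energy_sqrt:
  assumes "energy T x < \<infinity>"
  shows "energy T x \<le> ennreal ((sqrt (enn2real (energy T x)))\<^sup>2)"
  using assms by simp

lemma path_extension_limit:
  assumes T: "0 < T" and fin: "energy T x < \<infinity>" and t: "t \<in> {0..T}"
  shows "(\<lambda>m. x (grid T m (cell T m t))) \<longlonglongrightarrow> path_extension T x t"
proof -
  let ?c = "sqrt (enn2real (energy T x))"
  have "Cauchy (\<lambda>m. x (grid T m (cell T m t)))"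
  proof (rule metric_CauchyI)
    fix e :: real assume "0 < e"
    have "(\<lambda>m. 2 * c / 2 ^ m) \<longlonglongrightarrow> 0" for c :: real by real_asymp
    from order_tendstoD(2)[OF this[of ?c], of "e / 2"] \<open>0 < e\<close> obtain m where m: "2 * ?c / 2 ^ m < e / 2"
      by (auto simp: eventually_sequentially)
    have near: "\<bar>x (grid T n (cell T n t)) - x (grid T m (cell T m t))\<bar> < e / 2" if "n \<ge> m" for n
    proof -
      have "0 \<le> 2 * ?c / 2 ^ n" by simp
      then show ?thesis
        using energy_controls_levels[OF T t finite_energy_sqrt[OF fin] _ that] m
        by (smt (verit) enn2real_nonneg real_sqrt_ge_zero)
    qed
    show "\<exists>m. \<forall>n\<ge>m. \<forall>n'\<ge>m. dist (x (grid T n (cell T n t))) (x (grid T n' (cell T n' t))) < e"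
    proof (intro exI[of _ m] allI impI)
      fix n n' assume "m \<le> n" "m \<le> n'"
      then show "dist (x (grid T n (cell T n t))) (x (grid T n' (cell T n' t))) < e"
        using near[of n] near[of n'] unfolding dist_real_def by linarith
    qed
  qed
  then have "convergent (\<lambda>m. x (grid T m (cell T m t)))" by (simp add: Cauchy_convergent_iff)
  then show ?thesis using fin t by (simp add: path_extension_def convergent_LIMSEQ_iff)
qed

text \<open>
  A grid point coincides with its own approximations from its level on, so the extension does
  not change the values there, nor the energy.
\<close>
lemma path_extension_grid:
  assumes T: "0 < T" and fin: "energy T x < \<infinity>" and t: "t \<in> grid_points T"
  shows "path_extension T x t = x t"
proof -
  obtain m k where mk: "t = grid T m k" "k \<le> 16 ^ m" using t by (auto simp: grid_points_def)
  have "t \<in> {0..T}" using t grid_points_subset[OF T] by blast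
  from path_extension_limit[OF T fin this]
  have "(\<lambda>n. x (grid T n (cell T n t))) \<longlonglongrightarrow> path_extension T x t" .
  moreover have "(\<lambda>n. x (grid T n (cell T n t))) \<longlonglongrightarrow> x t"
    by (rule tendsto_eventually)
      (use cell_grid[OF T] mk in \<open>auto simp: eventually_sequentially intro!: exI[of _ m]\<close>)
  ultimately show ?thesis by (rule LIMSEQ_unique)
qed

lemma energy_path_extension:
  assumes T: "0 < T" and fin: "energy T x < \<infinity>"
  shows "energy T (path_extension T x) = energy T x"
proof -
  have "path_extension T x (grid T (Suc j) k) - path_extension T x (grid T j (k div 16)) =
      x (grid T (Suc j) k) - x (grid T j (k div 16))" if "k \<in> {..16 ^ Suc j}" for j k
    using that div_16_le[of k j] by (simp add: path_extension_grid[OF T fin] grid_in_grid_points)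
  then show ?thesis unfolding energy_def by simp
qed

text \<open>
  A path of finite energy extends to an element of one of these sets, which are relatively
  compact like balls of Hoelder continuous functions.
\<close>
definition modulus_ball :: "real \<Rightarrow> real \<Rightarrow> (real \<Rightarrow> real) set" where
  "modulus_ball T L = {x \<in> mspace (linf {0..T}).
     \<forall>t\<in>{0..T}. \<bar>x t\<bar> \<le> L \<and> (\<forall>m. \<bar>x t - step T m x t\<bar> \<le> L / 2 ^ m)}"

lemma path_extension_in_modulus_ball:
  assumes T: "0 < T"
  obtains L where "path_extension T x \<in> modulus_ball T L"
proof (cases "energy T x < \<infinity>")
  case False
  then have z: "path_extension T x t = 0" if "t \<in> {0..T}" for t using that by (simp add: path_extension_def)
  have "\<exists>B. \<forall>t\<in>{0..T}. \<bar>path_extension T x t\<bar> \<le> B" using z by auto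
  then have mem: "path_extension T x \<in> mspace (linf {0..T})"
    by (simp only: mspace_linf_iff) (simp add: path_extension_def)
  have "step T m (path_extension T x) t = 0" if "t \<in> {0..T}" for m t
    unfolding step_apply[OF that] by (rule z[OF grid_mem[OF T cell_le[OF T that]]])
  then have "path_extension T x \<in> modulus_ball T 0" using z mem by (simp add: modulus_ball_def)
  then show ?thesis by (rule that)
next
  case True
  let ?y = "path_extension T x" and ?c = "sqrt (enn2real (energy T x))"
  have en: "energy T ?y \<le> ennreal (?c\<^sup>2)"
    using True by (simp add: energy_path_extension[OF T True])
  have lim: "(\<lambda>n. ?y (grid T n (cell T n t))) \<longlonglongrightarrow> ?y t" if t: "t \<in> {0..T}" for t
  proof -
    have "?y (grid T n (cell T n t)) = x (grid T n (cell T n t))" for n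
      by (rule path_extension_grid[OF T True grid_in_grid_points[OF cell_le[OF T t]]])
    then show ?thesis using path_extension_limit[OF T True t] by simp
  qed
  have close: "\<bar>?y t - step T m ?y t\<bar> \<le> 2 * ?c / 2 ^ m" if "t \<in> {0..T}" for t m
    by (rule energy_controls_step[OF T that en _ lim[OF that]]) simp
  define L where "L = \<bar>?y (grid T 0 0)\<bar> + \<bar>?y (grid T 0 1)\<bar> + 2 * ?c"
  have bd: "\<bar>?y t\<bar> \<le> L" if t: "t \<in> {0..T}" for t
  proof -
    \<comment> \<open>The coarsest grid consists of the two end points.\<close>
    have "cell T 0 t = 0 \<or> cell T 0 t = 1" using cell_le[OF T t, of 0] by auto
    then have "\<bar>step T 0 ?y t\<bar> \<le> \<bar>?y (grid T 0 0)\<bar> + \<bar>?y (grid T 0 1)\<bar>"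
      unfolding step_apply[OF t] by auto
    then show ?thesis using close[OF t, of 0] by (simp add: L_def)
  qed
  then have "\<exists>B. \<forall>t\<in>{0..T}. \<bar>?y t\<bar> \<le> B" by blast
  then have mem: "?y \<in> mspace (linf {0..T})"
    by (simp only: mspace_linf_iff) (simp add: path_extension_def)
  have "2 * ?c / 2 ^ m \<le> L / 2 ^ m" for m by (intro divide_right_mono) (simp_all add: L_def)
  then have "?y \<in> modulus_ball T L"
    using bd mem order_trans[OF close] unfolding modulus_ball_def by blast
  then show ?thesis by (rule that)
qed

lemma modulus_ball_step:
  assumes T: "0 < T" and x: "x \<in> modulus_ball T L"
  shows "(\<lambda>m. mdist (linf {0..T}) x (step T m x)) \<longlonglongrightarrow> 0"
proof (rule geometric_bound_tendsto_zero)
  show "mdist (linf {0..T}) x (step T m x) \<le> L / 2 ^ m" for m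
    using x T by (subst linf_dist_le_iff[OF _ step_in_linf[OF T]]) (auto simp: modulus_ball_def)
qed

lemma modulus_ball_mono:
  assumes "L \<le> L'"
  shows "modulus_ball T L \<subseteq> modulus_ball T L'"
proof -
  have "L / 2 ^ m \<le> L' / 2 ^ m" for m using assms by (simp add: divide_right_mono)
  then show ?thesis
    unfolding modulus_ball_def using assms by (blast intro: order_trans)
qed

lemma linf_mcomplete: "Metric_space.mcomplete (mspace (linf S)) (mdist (linf S))"
proof -
  have "Met_TC.mcomplete TYPE(real)" by (simp add: complete_UNIV)
  from Met_TC.mcomplete_funspace[OF this]
  have "mcomplete_of (funspace S (euclidean_metric :: real metric))" by (simp add: Met_TC.Self_def euclidean_metric_def)
  then show ?thesis by (simp add: linf_def mcomplete_of_def)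
qed

text \<open>
  Up to a small error a path in the ball is determined by its values on a fixed grid, and
  rounding these bounded values leaves finitely many possibilities.
\<close>
lemma modulus_ball_totally_bounded:
  assumes T: "0 < T"
  shows "Metric_space.mtotally_bounded (mspace (linf {0..T})) (mdist (linf {0..T})) (modulus_ball T L)"
proof -
  interpret l: Metric_space "mspace (linf {0..T})" "mdist (linf {0..T})" by simp
  show ?thesis
    unfolding l.mtotally_bounded_def
  proof (intro allI impI)
    fix e :: real assume e: "0 < e"
    have "(\<lambda>m. L / 2 ^ m) \<longlonglongrightarrow> 0" by real_asymp
    from order_tendstoD(2)[OF this, of "e / 4"] e obtain m where m: "L / 2 ^ m < e / 4"
      by (auto simp: eventually_sequentially)
    \<comment> \<open>The mesh to which the values on the grid are rounded.\<close>
    define \<delta> where "\<delta> = e / 4"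
    have \<delta>: "0 < \<delta>" using e by (simp add: \<delta>_def)
    define \<phi> where "\<phi> x = (\<lambda>k\<in>{..16 ^ m}. \<lfloor>x (grid T m k) / \<delta>\<rfloor>)" for x :: "real \<Rightarrow> real"
    have "\<phi> ` modulus_ball T L \<subseteq> PiE {..16 ^ m} (\<lambda>_. {\<lfloor>- L / \<delta>\<rfloor>..\<lfloor>L / \<delta>\<rfloor>})"
    proof (clarsimp simp: \<phi>_def)
      fix x k assume x: "x \<in> modulus_ball T L" and k: "k \<le> (16 :: nat) ^ m"
      have "\<bar>x (grid T m k)\<bar> \<le> L" using x grid_mem[OF T k] unfolding modulus_ball_def by blast
      then have "- L \<le> x (grid T m k)" "x (grid T m k) \<le> L" by auto
      from this[THEN divide_right_mono[OF _ less_imp_le[OF \<delta>]]]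
      show "\<lfloor>- (L / \<delta>)\<rfloor> \<le> \<lfloor>x (grid T m k) / \<delta>\<rfloor> \<and> \<lfloor>x (grid T m k) / \<delta>\<rfloor> \<le> \<lfloor>L / \<delta>\<rfloor>"
        by (auto intro!: floor_mono)
    qed
    moreover have "finite (PiE {..16 ^ m} (\<lambda>_. {\<lfloor>- L / \<delta>\<rfloor>..\<lfloor>L / \<delta>\<rfloor>}) :: (nat \<Rightarrow> int) set)"
      by (intro finite_PiE) auto
    ultimately have "finite (\<phi> ` modulus_ball T L)" by (rule finite_subset)
    then obtain F where F: "F \<subseteq> modulus_ball T L" "finite F" "\<phi> ` modulus_ball T L = \<phi> ` F"
      using finite_subset_image[of "\<phi> ` modulus_ball T L" \<phi> "modulus_ball T L"] by auto
    have "modulus_ball T L \<subseteq> (\<Union>y\<in>F. l.mball y e)"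
    proof
      fix x assume x: "x \<in> modulus_ball T L"
      then obtain y where y: "y \<in> F" "\<phi> x = \<phi> y" using F(3) by blast
      have yM: "y \<in> modulus_ball T L" using y F by blast
      have mem: "x \<in> mspace (linf {0..T})" "y \<in> mspace (linf {0..T})" using x yM by (auto simp: modulus_ball_def)
      have "mdist (linf {0..T}) y x \<le> L / 2 ^ m + \<delta> + L / 2 ^ m"
      proof (subst linf_dist_le_iff[OF mem(2,1)])
        show "\<forall>t\<in>{0..T}. \<bar>y t - x t\<bar> \<le> L / 2 ^ m + \<delta> + L / 2 ^ m"
        proof
          fix t assume t: "t \<in> {0..T}"
          have "\<phi> x (cell T m t) = \<phi> y (cell T m t)" using y(2) by simp
          then have fl: "\<lfloor>step T m x t / \<delta>\<rfloor> = \<lfloor>step T m y t / \<delta>\<rfloor>"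
            using cell_le[OF T t] by (simp add: \<phi>_def step_apply[OF t])
          have "\<bar>step T m y t / \<delta> - step T m x t / \<delta>\<bar> \<le> 1"
            using fl by linarith
          then have "\<bar>step T m y t - step T m x t\<bar> / \<delta> \<le> 1"
            using \<delta> by (simp flip: diff_divide_distrib abs_div_pos)
          then have "\<bar>step T m y t - step T m x t\<bar> \<le> \<delta>" using \<delta> by (simp add: divide_le_eq)
          moreover have "\<bar>x t - step T m x t\<bar> \<le> L / 2 ^ m" "\<bar>y t - step T m y t\<bar> \<le> L / 2 ^ m"
            using x yM t unfolding modulus_ball_def by blast+
          ultimately show "\<bar>y t - x t\<bar> \<le> L / 2 ^ m + \<delta> + L / 2 ^ m" by linarith
        qed
      qed (use T in auto)
      also have "\<dots> < e" using m e by (simp add: \<delta>_def)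
      finally show "x \<in> (\<Union>y\<in>F. l.mball y e)" using y(1) mem by auto
    qed
    then show "\<exists>F. finite F \<and> F \<subseteq> modulus_ball T L \<and> modulus_ball T L \<subseteq> (\<Union>y\<in>F. l.mball y e)"
      using F by blast
  qed
qed

text \<open>
  An open set is the positivity set of the distance to its complement, which is a continuous
  functional.
\<close>
lemma measurable_metric_borel_if_functionals:
  assumes X: "X \<in> space N \<rightarrow> mspace m"
    and h: "\<And>h. continuous_map (mtopology_of m) euclideanreal h \<Longrightarrow> (\<lambda>\<omega>. h (X \<omega>)) \<in> borel_measurable N"
  shows "X \<in> measurable N (metric_borel m)"
  unfolding metric_borel_def
proof (rule measurable_measure_of[OF metric_borel_generators X])
  interpret m: Metric_space "mspace m" "mdist m" by simp
  fix U assume "U \<in> {U. openin (mtopology_of m) U}"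
  then have U: "openin m.mtopology U" by (simp add: mtopology_of_def)
  then have Us: "U \<subseteq> mspace m" by (simp add: m.openin_mtopology)
  show "X -` U \<inter> space N \<in> sets N"
  proof (cases "U = mspace m")
    case True
    then have "X -` U \<inter> space N = space N" using X by auto
    then show ?thesis by simp
  next
    case False
    \<comment> \<open>The case distinction ensures that the infimum defining the distance is over a nonempty set.\<close>
    define C where "C = mspace m - U"
    have C: "C \<noteq> {}" "C \<subseteq> mspace m" using False Us by (auto simp: C_def)
    define h where "h x = (INF y\<in>C. mdist m x y)" for x
    have bdd: "bdd_below (mdist m x ` C)" for x by (rule bdd_belowI[where m=0]) auto
    have hle: "h x \<le> h y + mdist m x y" if xy: "x \<in> mspace m" "y \<in> mspace m" for x y
    proof -
      have "h x - mdist m x y \<le> h y"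
        unfolding h_def[of y]
      proof (rule cINF_greatest[OF C(1)])
        fix z assume z: "z \<in> C"
        have "h x \<le> mdist m x z" unfolding h_def by (rule cINF_lower[OF bdd z])
        also have "\<dots> \<le> mdist m x y + mdist m y z" using xy z C(2) by (intro mdist_triangle) auto
        finally show "h x - mdist m x y \<le> mdist m y z" by simp
      qed
      then show ?thesis by simp
    qed
    have cont: "continuous_map (mtopology_of m) euclideanreal h"
    proof (rule Lipschitz_imp_continuous_map)
      fix x y assume "x \<in> mspace m" "y \<in> mspace m"
      then show "\<bar>h x - h y\<bar> \<le> 1 * mdist m x y"
        using hle[of x y] hle[of y x] by (simp add: mdist_commute)
    qed
    have pos: "x \<in> U \<longleftrightarrow> 0 < h x" if x: "x \<in> mspace m" for x
    proof
      assume "x \<in> U"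
      then obtain r where r: "r > 0" "m.mball x r \<subseteq> U" using U by (auto simp: m.openin_mtopology)
      have "r \<le> h x" unfolding h_def
      proof (rule cINF_greatest[OF C(1)])
        fix y assume "y \<in> C"
        then have "y \<in> mspace m" "y \<notin> m.mball x r" using r(2) by (auto simp: C_def)
        then show "r \<le> mdist m x y" using x by auto
      qed
      then show "0 < h x" using r(1) by simp
    next
      assume "0 < h x"
      show "x \<in> U"
      proof (rule ccontr)
        assume "x \<notin> U"
        then have "x \<in> C" using x by (simp add: C_def)
        then have "h x \<le> mdist m x x" unfolding h_def by (rule cINF_lower[OF bdd])
        moreover have "mdist m x x = 0" using x by simp
        ultimately show False using \<open>0 < h x\<close> by simp
      qed
    qed
    have "X -` U \<inter> space N = {\<omega> \<in> space N. 0 < h (X \<omega>)}" using X pos by auto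
    also have "\<dots> \<in> sets N" using h[OF cont] by simp
    finally show ?thesis .
  qed
qed

text \<open>
  The closures of the modulus balls are compact, and they exhaust the space of paths of the
  process.
\<close>
lemma tight_if_modulus_bounds:
  assumes T: "0 < T" and N: "prob_space N" and X: "X \<in> measurable N (metric_borel (linf {0..T}))"
    and bound: "\<And>\<omega>. \<omega> \<in> space N \<Longrightarrow> \<exists>L. X \<omega> \<in> modulus_ball T L"
  shows "tight_random_element (linf {0..T}) N X"
  unfolding tight_random_element_def
proof (intro conjI allI impI)
  let ?l = "linf {0..T}"
  interpret N: prob_space N by (rule N)
  interpret l: Metric_space "mspace ?l" "mdist ?l" by simp
  show "prob_space N" "X \<in> measurable N (metric_borel ?l)" by (rule N X)+
  fix e :: real assume e: "0 < e"
  define C where "C n = l.mtopology closure_of (modulus_ball T (real n))" for n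
  have compact: "compactin l.mtopology (C n)" for n
    using modulus_ball_totally_bounded[OF T] l.mtotally_bounded_eq_compact_closure_of[OF linf_mcomplete]
    by (simp add: C_def)
  have sub: "modulus_ball T (real n) \<subseteq> C n" for n
    unfolding C_def by (rule closure_of_subset) (auto simp: modulus_ball_def)
  have meas: "{\<omega> \<in> space N. X \<omega> \<in> C n} \<in> sets N" for n
  proof -
    have "C n \<in> sets (metric_borel ?l)"
      by (rule closed_in_metric_borel) (simp add: C_def mtopology_of_def)
    from measurable_sets[OF X this] show ?thesis by (simp add: vimage_def Int_def conj_commute)
  qed
  have "(\<lambda>n. N.prob {\<omega> \<in> space N. X \<omega> \<in> C n}) \<longlonglongrightarrow> N.prob (\<Union>n. {\<omega> \<in> space N. X \<omega> \<in> C n})"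
  proof (rule N.finite_Lim_measure_incseq)
    show "incseq (\<lambda>n. {\<omega> \<in> space N. X \<omega> \<in> C n})"
    proof (rule incseq_SucI)
      fix n
      have "C n \<subseteq> C (Suc n)" unfolding C_def by (intro closure_of_mono modulus_ball_mono) simp
      then show "{\<omega> \<in> space N. X \<omega> \<in> C n} \<subseteq> {\<omega> \<in> space N. X \<omega> \<in> C (Suc n)}" by auto
    qed
  qed (use meas in auto)
  moreover have "(\<Union>n. {\<omega> \<in> space N. X \<omega> \<in> C n}) = space N"
  proof -
    have "\<exists>n. X \<omega> \<in> C n" if \<omega>: "\<omega> \<in> space N" for \<omega>
    proof -
      obtain L where "X \<omega> \<in> modulus_ball T L" using bound[OF \<omega>] by blast
      moreover obtain n :: nat where "L \<le> real n" using real_arch_simple by blast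
      ultimately show ?thesis using modulus_ball_mono[of L "real n" T] sub by blast
    qed
    then show ?thesis by auto
  qed
  ultimately have "(\<lambda>n. N.prob {\<omega> \<in> space N. X \<omega> \<in> C n}) \<longlonglongrightarrow> 1" by (simp add: N.prob_space)
  from order_tendstoD(1)[OF this, of "1 - e"] e obtain n where "1 - e < N.prob {\<omega> \<in> space N. X \<omega> \<in> C n}"
    by (auto simp: eventually_sequentially)
  then show "\<exists>K. compactin (mtopology_of ?l) K \<and> 1 - e \<le> N.prob {\<omega> \<in> space N. X \<omega> \<in> K}"
    using compact[of n] by (intro exI[of _ "C n"]) (auto simp: mtopology_of_def)
qed

context landscape_sample
begin

text \<open>
  The times \<open>t k\<close> may coincide for different indices, since distinct times can have the same
  grid approximation; coefficients with equal times are added up first.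
\<close>
lemma gaussian_on_grid:
  obtains H :: "(real \<Rightarrow> real) \<Rightarrow> real \<Rightarrow> real" where
    "\<And>(J :: real set) a t. finite J \<Longrightarrow> t ` J \<subseteq> grid_points T \<Longrightarrow>
      centred_gaussian white_noise (population_variance (\<lambda>E. \<Sum>k\<in>J. a k * first_landscape E (t k)))
        (\<lambda>\<omega>. \<Sum>k\<in>J. a k * H \<omega> (t k))"
proof -
  define u where "u = from_nat_into (grid_points T)"
  define idx where "idx = to_nat_on (grid_points T)"
  have ne: "grid_points T \<noteq> {}" using grid_in_grid_points[of 0 0] by blast
  have u: "u i \<in> {0..T}" for i
    using from_nat_into[OF ne, of i] grid_points_subset[OF T] by (auto simp: u_def)
  have u_idx: "u (idx t) = t" if "t \<in> grid_points T" for t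
    using that countable_grid_points by (simp add: u_def idx_def)
  interpret psd_kernel "\<lambda>i j. landscape_cov P (u i) (u j)"
  proof
    show "landscape_cov P (u i) (u j) = landscape_cov P (u j) (u i)" for i j
      by (simp add: landscape_cov_def mult.commute)
    show "0 \<le> kernel_form (\<lambda>i j. landscape_cov P (u i) (u j)) n a a" for n a
    proof -
      have "0 \<le> population_variance (\<lambda>E. \<Sum>k<n. a k * first_landscape E (u k))"
        by (rule population_variance_nonneg[OF landscape_sum_measurable landscape_sum_abs_le]) (use u in auto)
      also have "\<dots> = kernel_form (\<lambda>i j. landscape_cov P (u i) (u j)) n a a"
        unfolding kernel_form_def by (rule population_variance_landscape_sum) (use u in auto)
      finally show ?thesis .
    qed
  qed
  obtain \<eta> :: "nat \<Rightarrow> (real \<Rightarrow> real) \<Rightarrow> real" where \<eta>: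
    "\<And>J a. finite J \<Longrightarrow> centred_gaussian white_noise
      (\<Sum>i\<in>J. \<Sum>j\<in>J. a i * a j * landscape_cov P (u i) (u j)) (\<lambda>\<omega>. \<Sum>j\<in>J. a j * \<eta> j \<omega>)"
    by (rule gaussian_sequence) blast
  show ?thesis
  proof (rule that[of "\<lambda>\<omega> t. \<eta> (idx t) \<omega>"])
    fix J :: "real set" and a t :: "real \<Rightarrow> real" assume J: "finite J" and t: "t ` J \<subseteq> grid_points T"
    \<comment> \<open>The total coefficient of the time with number \<open>j\<close>.\<close>
    define b where "b j = (\<Sum>k\<in>{k \<in> J. idx (t k) = j}. a k)" for j
    have regroup: "(\<Sum>j\<in>(\<lambda>k. idx (t k)) ` J. b j * f j) = (\<Sum>k\<in>J. a k * f (idx (t k)))" for f :: "nat \<Rightarrow> real"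
    proof -
      have "(\<Sum>k\<in>J. a k * f (idx (t k))) = (\<Sum>j\<in>(\<lambda>k. idx (t k)) ` J. \<Sum>k\<in>{k \<in> J. idx (t k) = j}. a k * f (idx (t k)))"
        by (rule sum.image_gen[OF J])
      also have "\<dots> = (\<Sum>j\<in>(\<lambda>k. idx (t k)) ` J. b j * f j)"
        unfolding b_def sum_distrib_right by (intro sum.cong refl) auto
      finally show ?thesis by simp
    qed
    have "(\<Sum>k\<in>J. a k * first_landscape E (u (idx (t k)))) = (\<Sum>k\<in>J. a k * first_landscape E (t k))" for E
      using t u_idx by (intro sum.cong refl) auto
    then have v: "(\<Sum>i\<in>(\<lambda>k. idx (t k)) ` J. \<Sum>j\<in>(\<lambda>k. idx (t k)) ` J. b i * b j * landscape_cov P (u i) (u j)) =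
        population_variance (\<lambda>E. \<Sum>k\<in>J. a k * first_landscape E (t k))"
      using u by (subst population_variance_landscape_sum[symmetric]) (auto simp: regroup)
    show "centred_gaussian white_noise (population_variance (\<lambda>E. \<Sum>k\<in>J. a k * first_landscape E (t k)))
        (\<lambda>\<omega>. \<Sum>k\<in>J. a k * \<eta> (idx (t k)) \<omega>)"
      using \<eta>[of "(\<lambda>k. idx (t k)) ` J" b] J unfolding v regroup by simp
  qed
qed

lemma population_variance_landscape_continuous:
  assumes J: "finite J" "J \<subseteq> {0..T}"
  shows "(\<lambda>m. population_variance (\<lambda>E. \<Sum>t\<in>J. a t * first_landscape E (grid T m (cell T m t)))) \<longlonglongrightarrow>
    population_variance (\<lambda>E. \<Sum>t\<in>J. a t * first_landscape E t)"
proof -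
  let ?g = "\<lambda>m E. \<Sum>t\<in>J. a t * first_landscape E (grid T m (cell T m t))"
  let ?f = "\<lambda>E. \<Sum>t\<in>J. a t * first_landscape E t"
  let ?B = "\<Sum>k\<in>J. \<bar>a k\<bar> * (T / 2)"
  have gm: "?g m \<in> borel_measurable P" for m
    using J grid_mem[OF T cell_le[OF T]] by (intro landscape_sum_measurable) blast
  have fm: "?f \<in> borel_measurable P" using J by (intro landscape_sum_measurable) auto
  have gB: "\<bar>?g m E\<bar> \<le> ?B" if "E \<in> space P" for m E by (rule landscape_sum_abs_le[OF that])
  have lim: "(\<lambda>m. ?g m E) \<longlonglongrightarrow> ?f E" if E: "E \<in> space P" for E
  proof (intro tendsto_sum tendsto_mult tendsto_const)
    fix t assume "t \<in> J"
    then have t: "t \<in> {0..T}" using J by blast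
    have "(\<lambda>m. first_landscape E (grid T m (cell T m t)) - first_landscape E t) \<longlonglongrightarrow> 0"
    proof (rule Lim_null_comparison)
      show "\<forall>\<^sub>F m in sequentially. norm (first_landscape E (grid T m (cell T m t)) - first_landscape E t)
          \<le> \<bar>grid T m (cell T m t) - t\<bar>"
        using landscape_diff_abs_le[OF E] by simp
      show "(\<lambda>m. \<bar>grid T m (cell T m t) - t\<bar>) \<longlonglongrightarrow> 0"
        using cell_tendsto[OF T t] by (simp add: tendsto_rabs_zero_iff LIM_zero_iff)
    qed
    then show "(\<lambda>m. first_landscape E (grid T m (cell T m t))) \<longlonglongrightarrow> first_landscape E t"
      by (simp add: LIM_zero_iff)
  qed
  have "(\<lambda>m. \<integral>E. (?g m E)\<^sup>2 \<partial>P) \<longlonglongrightarrow> (\<integral>E. (?f E)\<^sup>2 \<partial>P)"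
  proof (rule integral_dominated_convergence[where w="\<lambda>_. ?B\<^sup>2"])
    show "AE E in P. (\<lambda>m. (?g m E)\<^sup>2) \<longlonglongrightarrow> (?f E)\<^sup>2" by (intro AE_I2 tendsto_power lim)
    show "AE E in P. norm ((?g m E)\<^sup>2) \<le> ?B\<^sup>2" for m
    proof (rule AE_I2)
      fix E assume "E \<in> space P"
      from power_mono[OF gB[OF this] abs_ge_zero, where n=2] show "norm ((?g m E)\<^sup>2) \<le> ?B\<^sup>2" by simp
    qed
  qed (use gm fm in \<open>auto intro: borel_measurable_power\<close>)
  moreover have "(\<lambda>m. \<integral>E. ?g m E \<partial>P) \<longlonglongrightarrow> (\<integral>E. ?f E \<partial>P)"
  proof (rule integral_dominated_convergence[where w="\<lambda>_. ?B"])
    show "AE E in P. (\<lambda>m. ?g m E) \<longlonglongrightarrow> ?f E" by (intro AE_I2 lim)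
    show "AE E in P. norm (?g m E) \<le> ?B" for m using gB by (intro AE_I2) simp
  qed (use gm fm in auto)
  ultimately show ?thesis unfolding population_variance_def by (intro tendsto_diff tendsto_power)
qed

text \<open>
  Gaussianity of finite linear combinations survives the limit from the grid to \<open>[0, T]\<close>
  because population variances are continuous in the times. The covariance follows from the
  variances by polarization.
\<close>
theorem brownian_bridge_exists:
  obtains G :: "(real \<Rightarrow> real) \<Rightarrow> real \<Rightarrow> real" where
    "brownian_bridge T P white_noise G" "tight_random_element (linf {0..T}) white_noise G"
proof -
  interpret W: prob_space white_noise by (rule white_noise_prob_space)
  obtain H :: "(real \<Rightarrow> real) \<Rightarrow> real \<Rightarrow> real" where H:
    "\<And>(J :: real set) a t. finite J \<Longrightarrow> t ` J \<subseteq> grid_points T \<Longrightarrow>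
      centred_gaussian white_noise (population_variance (\<lambda>E. \<Sum>k\<in>J. a k * first_landscape E (t k)))
        (\<lambda>\<omega>. \<Sum>k\<in>J. a k * H \<omega> (t k))"
    by (rule gaussian_on_grid) blast
  define G where "G \<omega> = path_extension T (H \<omega>)" for \<omega>
  have Hm: "(\<lambda>\<omega>. H \<omega> t) \<in> borel_measurable white_noise" if "t \<in> grid_points T" for t
    using H[of "{0}" "\<lambda>_. t" "\<lambda>_. 1"] that by (simp add: centred_gaussian_def)
  have incr: "(\<integral>\<^sup>+\<omega>. ennreal ((H \<omega> s - H \<omega> t)\<^sup>2) \<partial>white_noise) \<le> ennreal ((s - t)\<^sup>2)"
    if st: "s \<in> grid_points T" "t \<in> grid_points T" for s t
  proof -
    have cg: "centred_gaussian white_noise (population_variance (\<lambda>E. first_landscape E s - first_landscape E t)) (\<lambda>\<omega>. H \<omega> s - H \<omega> t)"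
      using H[of "{0, 1}" "\<lambda>k. if k = 0 then s else t" "\<lambda>k. if k = 0 then 1 else - 1"] st by simp
    have "(\<integral>\<^sup>+\<omega>. ennreal ((H \<omega> s - H \<omega> t)\<^sup>2) \<partial>white_noise) =
        ennreal (\<integral>\<omega>. (H \<omega> s - H \<omega> t)\<^sup>2 \<partial>white_noise)"
      by (rule nn_integral_eq_integral[OF centred_gaussianD(3)[OF cg]]) simp
    also have "\<dots> \<le> ennreal ((s - t)\<^sup>2)"
      unfolding centred_gaussianD(4)[OF cg] using st grid_points_subset[OF T]
      by (intro ennreal_leI population_variance_landscape_diff_le) auto
    finally show ?thesis .
  qed
  have Em: "(\<lambda>\<omega>. energy T (H \<omega>)) \<in> borel_measurable white_noise" by (rule energy_measurable[OF Hm])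
  have "(\<integral>\<^sup>+\<omega>. energy T (H \<omega>) \<partial>white_noise) \<le> ennreal (64 * T\<^sup>2)"
    by (rule nn_integral_energy_le[OF T Hm incr])
  then have "(\<integral>\<^sup>+\<omega>. energy T (H \<omega>) \<partial>white_noise) \<noteq> \<infinity>" by (auto simp: top_unique)
  then have "AE \<omega> in white_noise. energy T (H \<omega>) \<noteq> \<infinity>" by (rule nn_integral_PInf_AE[OF Em])
  then have fin: "AE \<omega> in white_noise. energy T (H \<omega>) < \<infinity>" by (simp add: less_top)
  have Gm: "(\<lambda>\<omega>. G \<omega> t) \<in> borel_measurable white_noise" if t: "t \<in> {0..T}" for t
  proof -
    have [measurable]: "(\<lambda>\<omega>. H \<omega> (grid T m (cell T m t))) \<in> borel_measurable white_noise" for m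
      by (rule Hm[OF grid_in_grid_points[OF cell_le[OF T t]]])
    note [measurable] = Em
    have "(\<lambda>\<omega>. if energy T (H \<omega>) < \<infinity> then lim (\<lambda>m. H \<omega> (grid T m (cell T m t))) else 0)
        \<in> borel_measurable white_noise" by measurable
    then show ?thesis using t by (simp add: G_def path_extension_def)
  qed
  have cg: "centred_gaussian white_noise (population_variance (\<lambda>E. \<Sum>t\<in>J. a t * first_landscape E t)) (\<lambda>\<omega>. \<Sum>t\<in>J. a t * G \<omega> t)"
    if J: "finite J" "J \<subseteq> {0..T}" for J a
  proof (rule centred_gaussian_limit[OF white_noise_prob_space _ _ _ population_variance_landscape_continuous[OF J]])
    show "centred_gaussian white_noise (population_variance (\<lambda>E. \<Sum>t\<in>J. a t * first_landscape E (grid T m (cell T m t))))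
        (\<lambda>\<omega>. \<Sum>t\<in>J. a t * H \<omega> (grid T m (cell T m t)))" for m
      using J grid_in_grid_points[OF cell_le[OF T]] by (intro H) blast+
    show "(\<lambda>\<omega>. \<Sum>t\<in>J. a t * G \<omega> t) \<in> borel_measurable white_noise"
      using J by (intro borel_measurable_sum borel_measurable_times Gm) auto
    show "AE \<omega> in white_noise. (\<lambda>m. \<Sum>t\<in>J. a t * H \<omega> (grid T m (cell T m t))) \<longlonglongrightarrow> (\<Sum>t\<in>J. a t * G \<omega> t)"
      using fin
    proof eventually_elim
      fix \<omega> assume "energy T (H \<omega>) < \<infinity>"
      then show "(\<lambda>m. \<Sum>t\<in>J. a t * H \<omega> (grid T m (cell T m t))) \<longlonglongrightarrow> (\<Sum>t\<in>J. a t * G \<omega> t)"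
        unfolding G_def using J by (intro tendsto_sum tendsto_mult tendsto_const path_extension_limit[OF T]) auto
    qed
  qed
  have cg1: "centred_gaussian white_noise (landscape_cov P t t) (\<lambda>\<omega>. G \<omega> t)" if "t \<in> {0..T}" for t
    using cg[of "{t}" "\<lambda>_. 1"] population_variance_landscape_sum[of "\<lambda>t. t" "{t}" "\<lambda>_. 1"] that by simp
  have cov: "(\<integral>\<omega>. G \<omega> s * G \<omega> t \<partial>white_noise) = landscape_cov P s t" if st: "s \<in> {0..T}" "t \<in> {0..T}" for s t
  proof (cases "s = t")
    case True
    then show ?thesis using centred_gaussianD(4)[OF cg1[OF st(2)]] by (simp add: power2_eq_square)
  next
    case False
    have sym: "landscape_cov P t s = landscape_cov P s t" by (simp add: landscape_cov_def mult.commute)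
    have "population_variance (\<lambda>E. first_landscape E s + first_landscape E t) =
        landscape_cov P s s + 2 * landscape_cov P s t + landscape_cov P t t"
      using population_variance_landscape_sum[of "\<lambda>t. t" "{s, t}" "\<lambda>_. 1"] st False sym by simp
    then have cg2: "centred_gaussian white_noise (landscape_cov P s s + 2 * landscape_cov P s t + landscape_cov P t t)
        (\<lambda>\<omega>. G \<omega> s + G \<omega> t)"
      using cg[of "{s, t}" "\<lambda>_. 1"] st False by simp
    have "G \<omega> s * G \<omega> t = ((G \<omega> s + G \<omega> t)\<^sup>2 - (G \<omega> s)\<^sup>2 - (G \<omega> t)\<^sup>2) / 2" for \<omega>
      by (simp add: power2_eq_square algebra_simps)
    then have "(\<integral>\<omega>. G \<omega> s * G \<omega> t \<partial>white_noise) =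
        (\<integral>\<omega>. ((G \<omega> s + G \<omega> t)\<^sup>2 - (G \<omega> s)\<^sup>2 - (G \<omega> t)\<^sup>2) / 2 \<partial>white_noise)"
      by (intro Bochner_Integration.integral_cong refl)
    also have "\<dots> = ((\<integral>\<omega>. (G \<omega> s + G \<omega> t)\<^sup>2 \<partial>white_noise) - (\<integral>\<omega>. (G \<omega> s)\<^sup>2 \<partial>white_noise) -
        (\<integral>\<omega>. (G \<omega> t)\<^sup>2 \<partial>white_noise)) / 2"
      using centred_gaussianD(3)[OF cg2] centred_gaussianD(3)[OF cg1[OF st(1)]] centred_gaussianD(3)[OF cg1[OF st(2)]]
      by (simp only: integral_divide_zero Bochner_Integration.integral_diff Bochner_Integration.integrable_diff)
    also have "\<dots> = landscape_cov P s t"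
      using centred_gaussianD(4)[OF cg2] centred_gaussianD(4)[OF cg1[OF st(1)]] centred_gaussianD(4)[OF cg1[OF st(2)]]
      by simp
    finally show ?thesis .
  qed
  have bridge: "brownian_bridge T P white_noise G"
    unfolding brownian_bridge_def gaussian_process_def
    using white_noise_prob_space centred_gaussian_imp_gaussian_variable[OF white_noise_prob_space cg]
      centred_gaussianD(2)[OF cg1] cov by auto
  have ball: "\<exists>L. G \<omega> \<in> modulus_ball T L" for \<omega>
    unfolding G_def using path_extension_in_modulus_ball[OF T] by metis
  have mem: "G \<omega> \<in> mspace (linf {0..T})" for \<omega> using ball[of \<omega>] by (auto simp: modulus_ball_def)
  have "G \<in> measurable white_noise (metric_borel (linf {0..T}))"
  proof (rule measurable_metric_borel_if_functionals)
    show "(\<lambda>\<omega>. h (G \<omega>)) \<in> borel_measurable white_noise"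
      if "continuous_map (mtopology_of (linf {0..T})) euclideanreal h" for h
      using ball modulus_ball_step[OF T] by (intro functional_measurable[OF T that Gm mem]) blast+
  qed (use mem in auto)
  then have "tight_random_element (linf {0..T}) white_noise G"
    by (rule tight_if_modulus_bounds[OF T white_noise_prob_space]) (rule ball)
  with bridge show ?thesis by (rule that)
qed

end


section \<open>The functional central limit theorem\<close>

theorem theorem2p4:
  fixes T :: real
    and P :: "(real \<times> real \<Rightarrow> enat) measure"
    and M :: "'w measure"
    and D :: "nat \<Rightarrow> 'w \<Rightarrow> real \<times> real \<Rightarrow> enat"
  assumes "0 < T"
    and "prob_space P"
    and "space P = persistence_diagrams T"
    and "\<And>t. t \<in> {0..T} \<Longrightarrow> (\<lambda>E. first_landscape E t) \<in> borel_measurable P"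
    and "prob_space M"
    and "prob_space.indep_vars M (\<lambda>_. P) D UNIV"
    and "\<And>i. distr M P (D i) = P"
  shows "(\<exists>(N :: (real \<Rightarrow> real) measure) G.
            brownian_bridge T P N G \<and>
            converges_in_distribution (linf {0..T}) M (empirical_process T P D) N G) \<and>
         (\<forall>(N :: 'v measure) G.
            brownian_bridge T P N G \<and> tight_random_element (linf {0..T}) N G \<longrightarrow>
            converges_in_distribution (linf {0..T}) M (empirical_process T P D) N G)"
proof -
  interpret landscape_sample M P D T
    using assms
    by (intro landscape_sample.intro iid_sample.intro landscape_sample_axioms.intro) auto
  obtain G :: "(real \<Rightarrow> real) \<Rightarrow> real \<Rightarrow> real" where
    "brownian_bridge T P white_noise G" "tight_random_element (linf {0..T}) white_noise G"
    by (rule brownian_bridge_exists)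
  then have "\<exists>(N :: (real \<Rightarrow> real) measure) G. brownian_bridge T P N G \<and>
      converges_in_distribution (linf {0..T}) M (empirical_process T P D) N G"
    using empirical_process_converges by blast
  moreover have "\<forall>(N :: 'v measure) G.
      brownian_bridge T P N G \<and> tight_random_element (linf {0..T}) N G \<longrightarrow>
      converges_in_distribution (linf {0..T}) M (empirical_process T P D) N G"
    using empirical_process_converges by blast
  ultimately show ?thesis ..
qed

end
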